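(* Let $N\ge1$, $l\ge0$. The degenerate cyclotomic DAHA $\mathcal H^l_{N,\deg}$ is generated, as an algebra over $\mathbb C[\hbar,k,z_1,\dots,z_l]$, by $S_N$ and elements $y_i,X_i,D_i$, $i=1,\dots,N$ (where $D_i$ corresponds to $s_{1i}X_1^{-1}(y_1-z_1)\cdots(y_1-z_l)s_{1i}$), with the following defining relations (in addition to the relations of $S_N$): $$s_iy_i=y_{i+1}s_i+k,\qquad s_iy_j=y_js_i\ (j\neq i,i+1),\qquad [y_i,y_j]=0,$$ $$sX_i=X_{s(i)}s\ (s\in S_N),\qquad [X_i,X_j]=0,$$ $$[y_i,X_1]=kX_1s_{1i}\ (i>1),\qquad [y_1,X_1]=\hbar X_1-k\sum_{i>1}X_1s_{1i},$$ $$sD_i=D_{s(i)}s\ (s\in S_N),\qquad [D_i,D_j]=0,$$ $$[y_j,D_1]=-ks_{1j}D_1\ (j>1),\qquad [y_1,D_1]=-\hbar D_1+k\sum_{i>1}s_{1i}D_1,$$ $$[D_1,X_1]=\sum_{r=1}^l\ \prod_{i=1}^{r-1}\Big(y_1-z_i+\hbar-k\sum_{j>1}s_{1j}\Big)\Big(\hbar-k\sum_{j>1}s_{1j}\Big)\prod_{i=r+1}^l(y_1-z_i),$$ $$[D_1,X_m]=k\sum_{r=1}^l\ \prod_{i=1}^{r-1}\Big(y_1-z_i+\hbar-k\sum_{j>1}s_{1j}\Big)s_{1m}\prod_{i=r+1}^l(y_1-z_i)\quad(m>1),$$ $$X_1D_1=(y_1-z_1)\cdots(y_1-z_l).$$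
   Context: $s_{ij}\in S_N$ is the transposition of $i,j$, $s_i=s_{i,i+1}$ ($1\le i\le N-1$), and $\hbar,k,z_1,\dots,z_l$ are (central) variables. $\mathcal H_{N,\deg}$ (degenerate, or trigonometric, double affine Hecke algebra) is the $\mathbb C[\hbar,k]$-algebra generated by the group $S_N\ltimes\mathbb Z^N$ (with $\mathbb Z^N$ generated by commuting invertible $X_1,\dots,X_N$, $sX_i=X_{s(i)}s$) and elements $y_1,\dots,y_N$, with relations: $s_iy_i=y_{i+1}s_i+k$; $s_iy_j=y_js_i$ for $j\ne i,i+1$; $[y_i,y_j]=0$; $[y_i,X_j]=kX_js_{ij}$ for $i>j$; $[y_i,X_j]=kX_is_{ij}$ for $i<j$; $[y_i,X_i]=\hbar X_i-k\sum_{r<i}X_rs_{ir}-k\sum_{r>i}X_is_{ir}$. Put $\pi=X_1s_1\cdots s_{N-1}$. The degenerate cyclotomic DAHA $\mathcal H^l_{N,\deg}$ is the subalgebra of $\mathcal H_{N,\deg}[z_1,\dots,z_l]$ generated over $\mathbb C[\hbar,k,z_1,\dots,z_l]$ by $s_1,\dots,s_{N-1}$, $y_1,\dots,y_N$, $\pi$ and $\pi_-:=\pi^{-1}\prod_{i=1}^l(y_1-z_i)$. *)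

theory Defs
  imports
    Complex_Main
    "HOL-Library.Poly_Mapping"
    "HOL-Computational_Algebra.Polynomial"
    "HOL-Combinatorics.Permutations"
    "HOL-Algebra.QuotRing"
    "HOL-Algebra.Generated_Rings"
begin

section \<open>Free algebras and presentations\<close>

text \<open>
  Words form a monoid under concatenation, so that \<open>'g list \<Rightarrow>\<^sub>0 'k\<close> with the convolution
  product of \<^theory>\<open>HOL-Library.Poly_Mapping\<close> is the free associative unital algebra on \<open>'g\<close>
  over the commutative ring \<open>'k\<close>.
\<close>

instantiation list :: (type) monoid_add
begin

definition plus_list_def: "xs + ys = xs @ ys" for xs ys :: "'a list"
definition zero_list_def: "0 = ([] :: 'a list)"

instance
  by standard (simp_all add: plus_list_def zero_list_def)

end

definition free_const :: "'k::comm_ring_1 \<Rightarrow> ('g list \<Rightarrow>\<^sub>0 'k)"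
  where "free_const c = Poly_Mapping.single [] c"

definition free_gen :: "'g \<Rightarrow> ('g list \<Rightarrow>\<^sub>0 'k::comm_ring_1)"
  where "free_gen g = Poly_Mapping.single [g] 1"

text \<open>The free algebra on the set \<open>G\<close> over the subring \<open>K\<close> of \<open>'k\<close>.\<close>

definition free_algebra :: "'k::comm_ring_1 set \<Rightarrow> 'g set \<Rightarrow> ('g list \<Rightarrow>\<^sub>0 'k) ring"
  where "free_algebra K G =
    \<lparr>carrier = {f. (\<forall>w \<in> Poly_Mapping.keys f. set w \<subseteq> G) \<and> (\<forall>w. Poly_Mapping.lookup f w \<in> K)},
     mult = (*), one = 1, zero = 0, add = (+)\<rparr>"

text \<open>A relation \<open>a = b\<close> is the pair \<open>(a, b)\<close>; \<^const>\<open>genideal\<close> is the two-sided ideal.\<close>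

definition rel_ideal :: "'a::ring_1 ring \<Rightarrow> ('a \<times> 'a) set \<Rightarrow> 'a set"
  where "rel_ideal F R = Idl\<^bsub>F\<^esub> {a - b | a b. (a, b) \<in> R}"

definition presented_algebra :: "'a::ring_1 ring \<Rightarrow> ('a \<times> 'a) set \<Rightarrow> 'a set ring"
  where "presented_algebra F R = F Quot (rel_ideal F R)"

definition presented_class :: "'a::ring_1 ring \<Rightarrow> ('a \<times> 'a) set \<Rightarrow> 'a \<Rightarrow> 'a set"
  where "presented_class F R a = rel_ideal F R +>\<^bsub>F\<^esub> a"

abbreviation commutator :: "'a::ring \<Rightarrow> 'a \<Rightarrow> 'a"
  where "commutator a b \<equiv> a * b - b * a"

section \<open>Polynomial rings over a not necessarily commutative ring\<close>

text \<open>
  Polynomials over the ring \<open>R\<close> in central commuting variables from \<open>V\<close>, as coefficient functions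
  on monomials; a monomial is its exponent vector, of type \<open>'v \<Rightarrow>\<^sub>0 nat\<close>.
\<close>

definition mpoly_ring :: "('a, 'b) ring_scheme \<Rightarrow> 'v set \<Rightarrow> (('v \<Rightarrow>\<^sub>0 nat) \<Rightarrow> 'a) ring"
  where "mpoly_ring R V =
    \<lparr>carrier = {f. (\<forall>m. f m \<in> carrier R) \<and> finite {m. f m \<noteq> \<zero>\<^bsub>R\<^esub>} \<and>
                   (\<forall>m. f m \<noteq> \<zero>\<^bsub>R\<^esub> \<longrightarrow> Poly_Mapping.keys m \<subseteq> V)},
     mult = (\<lambda>f g m. \<Oplus>\<^bsub>R\<^esub>p \<in> {p. fst p + snd p = m}. f (fst p) \<otimes>\<^bsub>R\<^esub> g (snd p)),
     one = (\<lambda>m. if m = 0 then \<one>\<^bsub>R\<^esub> else \<zero>\<^bsub>R\<^esub>),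
     zero = (\<lambda>m. \<zero>\<^bsub>R\<^esub>),
     add = (\<lambda>f g m. f m \<oplus>\<^bsub>R\<^esub> g m)\<rparr>"

definition mpoly_const :: "('a, 'b) ring_scheme \<Rightarrow> 'a \<Rightarrow> (('v \<Rightarrow>\<^sub>0 nat) \<Rightarrow> 'a)"
  where "mpoly_const R a = (\<lambda>m. if m = 0 then a else \<zero>\<^bsub>R\<^esub>)"

section \<open>Coefficients\<close>

text \<open>
  \<open>\<complex>[\<hbar>, k]\<close> is \<^typ>\<open>complex poly poly\<close>, with \<open>\<hbar>\<close> the inner and \<open>k\<close> the outer variable, and
  \<open>\<complex>[\<hbar>, k, z\<^sub>1, \<dots>, z\<^sub>l]\<close> is the subring \<open>coeffs_z l\<close> of a polynomial ring over it in variables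
  indexed by \<^typ>\<open>nat\<close>.
\<close>

type_synonym coeff_hk = "complex poly poly"
type_synonym coeff_hkz = "(nat \<Rightarrow>\<^sub>0 nat) \<Rightarrow>\<^sub>0 coeff_hk"

definition hbar_var :: coeff_hk where "hbar_var = [:[:0, 1:]:]"
definition k_var :: coeff_hk where "k_var = [:0, 1:]"

definition coeffs_z :: "nat \<Rightarrow> coeff_hkz set"
  where "coeffs_z l = {c. \<forall>m \<in> Poly_Mapping.keys c. Poly_Mapping.keys m \<subseteq> {1..l}}"

definition hk_const :: "coeff_hk \<Rightarrow> coeff_hkz"
  where "hk_const c = Poly_Mapping.single 0 c"

definition z_var :: "nat \<Rightarrow> coeff_hkz"
  where "z_var i = Poly_Mapping.single (Poly_Mapping.single i 1) 1"

section \<open>The degenerate double affine Hecke algebra\<close>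

text \<open>
  \<open>S\<^sub>N\<close> is the group of permutations of \<open>{1..N}\<close>, with composition of functions as product.
  The relation sets below are stated in an arbitrary ring in which the generators \<open>T p\<close>
  (\<open>p \<in> S\<^sub>N\<close>), \<open>Y i\<close>, \<open>X i\<close>, \dots\ and the parameters are interpreted.
\<close>

definition symmetric_group_rels ::
    "nat \<Rightarrow> ((nat \<Rightarrow> nat) \<Rightarrow> 'a::ring_1) \<Rightarrow> ('a \<times> 'a) set"
  where "symmetric_group_rels N T =
    {(T id, 1)} \<union>
    {(T p * T q, T (p \<circ> q)) | p q. p permutes {1..N} \<and> q permutes {1..N}}"

definition hecke_rels ::
    "nat \<Rightarrow> 'a::ring_1 \<Rightarrow> ((nat \<Rightarrow> nat) \<Rightarrow> 'a) \<Rightarrow> (nat \<Rightarrow> 'a) \<Rightarrow> ('a \<times> 'a) set"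
  where "hecke_rels N k T Y =
    {(T (transpose i (i+1)) * Y i, Y (i+1) * T (transpose i (i+1)) + k) | i. i \<in> {1..<N}} \<union>
    {(T (transpose i (i+1)) * Y j, Y j * T (transpose i (i+1))) | i j.
       i \<in> {1..<N} \<and> j \<in> {1..N} \<and> j \<noteq> i \<and> j \<noteq> i+1} \<union>
    {(commutator (Y i) (Y j), 0) | i j. i \<in> {1..N} \<and> j \<in> {1..N}}"

text \<open>A commuting family of elements permuted by \<open>S\<^sub>N\<close>.\<close>

definition permuted_family_rels ::
    "nat \<Rightarrow> ((nat \<Rightarrow> nat) \<Rightarrow> 'a::ring_1) \<Rightarrow> (nat \<Rightarrow> 'a) \<Rightarrow> ('a \<times> 'a) set"
  where "permuted_family_rels N T X =
    {(T p * X i, X (p i) * T p) | p i. p permutes {1..N} \<and> i \<in> {1..N}} \<union>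
    {(commutator (X i) (X j), 0) | i j. i \<in> {1..N} \<and> j \<in> {1..N}}"

definition daha_rels ::
    "nat \<Rightarrow> 'a::ring_1 \<Rightarrow> 'a \<Rightarrow> ((nat \<Rightarrow> nat) \<Rightarrow> 'a) \<Rightarrow> (nat \<Rightarrow> 'a) \<Rightarrow> (nat \<Rightarrow> 'a) \<Rightarrow> (nat \<Rightarrow> 'a)
      \<Rightarrow> ('a \<times> 'a) set"
  where "daha_rels N h k T X Xinv Y =
    symmetric_group_rels N T \<union>
    permuted_family_rels N T X \<union>
    {(X i * Xinv i, 1) | i. i \<in> {1..N}} \<union>
    {(Xinv i * X i, 1) | i. i \<in> {1..N}} \<union>
    hecke_rels N k T Y \<union>
    {(commutator (Y i) (X j), k * X j * T (transpose i j)) | i j.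
       i \<in> {1..N} \<and> j \<in> {1..N} \<and> i > j} \<union>
    {(commutator (Y i) (X j), k * X i * T (transpose i j)) | i j.
       i \<in> {1..N} \<and> j \<in> {1..N} \<and> i < j} \<union>
    {(commutator (Y i) (X i),
       h * X i - k * (\<Sum>r \<in> {1..<i}. X r * T (transpose i r))
               - k * (\<Sum>r \<in> {i<..N}. X i * T (transpose i r))) | i. i \<in> {1..N}}"

datatype daha_gen = Perm "nat \<Rightarrow> nat" | GX nat | GXinv nat | GY nat

definition daha_gens :: "nat \<Rightarrow> daha_gen set"
  where "daha_gens N = Perm ` {p. p permutes {1..N}} \<union> GX ` {1..N} \<union> GXinv ` {1..N} \<union> GY ` {1..N}"

abbreviation daha_free :: "nat \<Rightarrow> (daha_gen list \<Rightarrow>\<^sub>0 coeff_hk) ring"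
  where "daha_free N \<equiv> free_algebra UNIV (daha_gens N)"

abbreviation daha_relations ::
    "nat \<Rightarrow> ((daha_gen list \<Rightarrow>\<^sub>0 coeff_hk) \<times> (daha_gen list \<Rightarrow>\<^sub>0 coeff_hk)) set"
  where "daha_relations N \<equiv>
    daha_rels N (free_const hbar_var) (free_const k_var)
      (\<lambda>p. free_gen (Perm p)) (\<lambda>i. free_gen (GX i)) (\<lambda>i. free_gen (GXinv i)) (\<lambda>i. free_gen (GY i))"

definition degenerate_daha :: "nat \<Rightarrow> (daha_gen list \<Rightarrow>\<^sub>0 coeff_hk) set ring"
  where "degenerate_daha N = presented_algebra (daha_free N) (daha_relations N)"

definition daha_class :: "nat \<Rightarrow> (daha_gen list \<Rightarrow>\<^sub>0 coeff_hk) \<Rightarrow> (daha_gen list \<Rightarrow>\<^sub>0 coeff_hk) set"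
  where "daha_class N = presented_class (daha_free N) (daha_relations N)"

section \<open>The degenerate cyclotomic DAHA\<close>

type_synonym daha_z = "(nat \<Rightarrow>\<^sub>0 nat) \<Rightarrow> (daha_gen list \<Rightarrow>\<^sub>0 coeff_hk) set"

definition daha_z_ring :: "nat \<Rightarrow> nat \<Rightarrow> daha_z ring"
  where "daha_z_ring N l = mpoly_ring (degenerate_daha N) {1..l}"

text \<open>The structure map of the polynomial ring as an algebra over \<open>coeffs_z l\<close>.\<close>

definition daha_z_scalar :: "nat \<Rightarrow> coeff_hkz \<Rightarrow> daha_z"
  where "daha_z_scalar N c = (\<lambda>m. daha_class N (free_const (Poly_Mapping.lookup c m)))"

definition daha_z_elem :: "nat \<Rightarrow> (daha_gen list \<Rightarrow>\<^sub>0 coeff_hk) \<Rightarrow> daha_z"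
  where "daha_z_elem N f = mpoly_const (degenerate_daha N) (daha_class N f)"

definition el_perm :: "nat \<Rightarrow> (nat \<Rightarrow> nat) \<Rightarrow> daha_z"
  where "el_perm N p = daha_z_elem N (free_gen (Perm p))"

definition el_X :: "nat \<Rightarrow> nat \<Rightarrow> daha_z"
  where "el_X N i = daha_z_elem N (free_gen (GX i))"

definition el_Y :: "nat \<Rightarrow> nat \<Rightarrow> daha_z"
  where "el_Y N i = daha_z_elem N (free_gen (GY i))"

definition list_prod :: "('a, 'b) monoid_scheme \<Rightarrow> 'a list \<Rightarrow> 'a"
  where "list_prod G xs = foldr (\<lambda>x y. x \<otimes>\<^bsub>G\<^esub> y) xs \<one>\<^bsub>G\<^esub>"

text \<open>\<open>(y\<^sub>1 - z\<^sub>1) \<cdots> (y\<^sub>1 - z\<^sub>l)\<close>\<close>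

definition el_cyc :: "nat \<Rightarrow> nat \<Rightarrow> daha_z"
  where "el_cyc N l = list_prod (daha_z_ring N l)
    (map (\<lambda>i. el_Y N 1 \<ominus>\<^bsub>daha_z_ring N l\<^esub> daha_z_scalar N (z_var i)) [1..<l+1])"

text \<open>\<open>\<pi> = X\<^sub>1 s\<^sub>1 \<cdots> s\<^bsub>N-1\<^esub>\<close> and \<open>\<pi>\<^sub>- = \<pi>\<inverse> (y\<^sub>1 - z\<^sub>1) \<cdots> (y\<^sub>1 - z\<^sub>l)\<close>\<close>

definition el_pi :: "nat \<Rightarrow> nat \<Rightarrow> daha_z"
  where "el_pi N l = el_X N 1 \<otimes>\<^bsub>daha_z_ring N l\<^esub>
    list_prod (daha_z_ring N l) (map (\<lambda>i. el_perm N (transpose i (i+1))) [1..<N])"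

definition el_pi_minus :: "nat \<Rightarrow> nat \<Rightarrow> daha_z"
  where "el_pi_minus N l =
    inv\<^bsub>daha_z_ring N l\<^esub> (el_pi N l) \<otimes>\<^bsub>daha_z_ring N l\<^esub> el_cyc N l"

definition cyclotomic_daha :: "nat \<Rightarrow> nat \<Rightarrow> daha_z ring"
  where "cyclotomic_daha N l = (daha_z_ring N l)\<lparr>carrier :=
    generate_ring (daha_z_ring N l)
      (daha_z_scalar N ` coeffs_z l \<union>
       {el_perm N (transpose i (i+1)) | i. i \<in> {1..<N}} \<union>
       {el_Y N i | i. i \<in> {1..N}} \<union>
       {el_pi N l, el_pi_minus N l})\<rparr>"

text \<open>\<open>D\<^sub>i = s\<^bsub>1i\<^esub> X\<^sub>1\<inverse> (y\<^sub>1 - z\<^sub>1) \<cdots> (y\<^sub>1 - z\<^sub>l) s\<^bsub>1i\<^esub>\<close>, where \<open>s\<^bsub>11\<^esub>\<close> is the identity.\<close>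

definition el_D :: "nat \<Rightarrow> nat \<Rightarrow> nat \<Rightarrow> daha_z"
  where "el_D N l i = list_prod (daha_z_ring N l)
    [el_perm N (transpose 1 i), inv\<^bsub>daha_z_ring N l\<^esub> (el_X N 1), el_cyc N l, el_perm N (transpose 1 i)]"

section \<open>The algebra given by the presentation\<close>

text \<open>Products over \<open>a \<le> i < b\<close> are ordered, hence products of lists.\<close>

definition cyclotomic_rels ::
    "nat \<Rightarrow> nat \<Rightarrow> 'a::ring_1 \<Rightarrow> 'a \<Rightarrow> (nat \<Rightarrow> 'a) \<Rightarrow> ((nat \<Rightarrow> nat) \<Rightarrow> 'a) \<Rightarrow>
      (nat \<Rightarrow> 'a) \<Rightarrow> (nat \<Rightarrow> 'a) \<Rightarrow> (nat \<Rightarrow> 'a) \<Rightarrow> ('a \<times> 'a) set"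
  where "cyclotomic_rels N l h k z T Y X D =
    (let J = h - k * (\<Sum>j \<in> {2..N}. T (transpose 1 j));
         A = (\<lambda>r. prod_list (map (\<lambda>i. Y 1 - z i + J) [1..<r]));
         B = (\<lambda>r. prod_list (map (\<lambda>i. Y 1 - z i) [r+1..<l+1]))
     in
       symmetric_group_rels N T \<union>
       hecke_rels N k T Y \<union>
       permuted_family_rels N T X \<union>
       {(commutator (Y i) (X 1), k * X 1 * T (transpose 1 i)) | i. i \<in> {2..N}} \<union>
       {(commutator (Y 1) (X 1), h * X 1 - k * (\<Sum>i \<in> {2..N}. X 1 * T (transpose 1 i)))} \<union>
       permuted_family_rels N T D \<union>
       {(commutator (Y j) (D 1), - k * T (transpose 1 j) * D 1) | j. j \<in> {2..N}} \<union>
       {(commutator (Y 1) (D 1), - h * D 1 + k * (\<Sum>i \<in> {2..N}. T (transpose 1 i) * D 1))} \<union>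
       {(commutator (D 1) (X 1), \<Sum>r \<in> {1..l}. A r * J * B r)} \<union>
       {(commutator (D 1) (X m), k * (\<Sum>r \<in> {1..l}. A r * T (transpose 1 m) * B r)) | m.
          m \<in> {2..N}} \<union>
       {(X 1 * D 1, prod_list (map (\<lambda>i. Y 1 - z i) [1..<l+1]))})"

datatype cyc_gen = CPerm "nat \<Rightarrow> nat" | CY nat | CX nat | CD nat

definition cyc_gens :: "nat \<Rightarrow> cyc_gen set"
  where "cyc_gens N = CPerm ` {p. p permutes {1..N}} \<union> CY ` {1..N} \<union> CX ` {1..N} \<union> CD ` {1..N}"

abbreviation cyc_free :: "nat \<Rightarrow> nat \<Rightarrow> (cyc_gen list \<Rightarrow>\<^sub>0 coeff_hkz) ring"
  where "cyc_free N l \<equiv> free_algebra (coeffs_z l) (cyc_gens N)"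

abbreviation cyc_relations ::
    "nat \<Rightarrow> nat \<Rightarrow> ((cyc_gen list \<Rightarrow>\<^sub>0 coeff_hkz) \<times> (cyc_gen list \<Rightarrow>\<^sub>0 coeff_hkz)) set"
  where "cyc_relations N l \<equiv>
    cyclotomic_rels N l (free_const (hk_const hbar_var)) (free_const (hk_const k_var))
      (\<lambda>i. free_const (z_var i)) (\<lambda>p. free_gen (CPerm p))
      (\<lambda>i. free_gen (CY i)) (\<lambda>i. free_gen (CX i)) (\<lambda>i. free_gen (CD i))"

definition cyc_presented :: "nat \<Rightarrow> nat \<Rightarrow> (cyc_gen list \<Rightarrow>\<^sub>0 coeff_hkz) set ring"
  where "cyc_presented N l = presented_algebra (cyc_free N l) (cyc_relations N l)"

definition cyc_class ::
    "nat \<Rightarrow> nat \<Rightarrow> (cyc_gen list \<Rightarrow>\<^sub>0 coeff_hkz) \<Rightarrow> (cyc_gen list \<Rightarrow>\<^sub>0 coeff_hkz) set"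
  where "cyc_class N l = presented_class (cyc_free N l) (cyc_relations N l)"

end

(* The relations are checked, and shown to be complete, in one faithful representation. Let Dunkl
   operators p_i act on a free module with basis x^a lambda^b w (w a permutation); then X_i, the
   permutations and y_i = X_i p_i - k sum_{r<i} s_{ir} satisfy the relations of the degenerate DAHA, and
   these together with D_i = X_i^{-1} prod_r (X_i p_i - z_r) satisfy the proposed relations. The only
   relation that needs an idea is [D_i, D_j] = 0: with s = s_{ij} and y' = X_j p_j - k s one has
   D_i s D_i = X_i^{-1} X_j^{-1} s P(y') P(y), P(y) = prod_r (y - z_r), which commutes with s.

   For completeness give y_i weight 1, D_i weight l and X_i, s weight 0. Modulo words of lower weight the
   defining relations let all letters commute (up to the action of the permutations), and X_i D_i may be
   replaced by y_i^l. The leading term of a word in the representation, for the degree in lambda, is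
   a monomial times a permutation which determines the resulting normal form, so an element of the free
   algebra that acts by zero lies in the ideal of relations. The case l = 0, where D_i = X_i^{-1}, is the
   degenerate DAHA itself. Hence both algebras embed into the same endomorphism ring, and it remains to
   compare generators. *)

theory Submission
  imports Defs
begin

section \<open>Scalar-linear operators on a module with a basis, made into a ring\<close>

section \<open>Linear endomorphisms of a free module\<close>

text \<open>The module is induced from the regular module of the crossed product of the polynomials
  in lambda with S_N. The variable lambda_i is a formal symbol for p_i, and the slot w keeps the
  images of a vector under different permutations independent; so leading terms have coefficient 1
  and the argument runs over any commutative ring. The divided differences send f \<otimes> v to (f
  - s f)/(x_i - x_j) \<otimes> s v; as x_i - x_j acts injectively, identities for them are tested
  after multiplying by it. The relations give spanning and the leading terms independence; both are
  proved for an abstract ideal, and used for l = 0 and for the given l. Substituting X_1^{-1} (y_1 -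
  z_1) ... (y_1 - z_l) for D_1, and its conjugate by s_{1i} for D_i, carries one representation to
  the other. Since both ideals are exact kernels, membership in one is equivalent to membership of
  the substituted element in the other. Hence the map is well defined and injective at once. The z_r
  are scalars of the representation but polynomial variables over the DAHA, so elements are split
  into components.\<close>

lift_definition vec_scale :: "'k::comm_ring_1 \<Rightarrow> ('m \<Rightarrow>\<^sub>0 'k) \<Rightarrow> ('m \<Rightarrow>\<^sub>0 'k)"
  is "\<lambda>c f m. c * f m"
  by (erule finite_subset[rotated]) auto

lemma lookup_vec_scale [simp]: "Poly_Mapping.lookup (vec_scale c f) m = c * Poly_Mapping.lookup f m"
  by transfer simp

lemma keys_vec_scale: "Poly_Mapping.keys (vec_scale c f) \<subseteq> Poly_Mapping.keys f"
  by (auto simp: in_keys_iff)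

lemma vec_scale_simps [simp]:
  "vec_scale c (x + y) = vec_scale c x + vec_scale c y"
  "vec_scale c (x - y) = vec_scale c x - vec_scale c y"
  "vec_scale c 0 = 0" "vec_scale 0 x = 0" "vec_scale 1 x = x" "vec_scale c (- x) = - vec_scale c x"
  "vec_scale c (vec_scale d x) = vec_scale (c * d) x"
  "vec_scale c (Poly_Mapping.single m a) = Poly_Mapping.single m (c * a)"
  by (auto intro!: poly_mapping_eqI simp: lookup_add lookup_minus algebra_simps lookup_single when_def)

lemma vec_scale_add_left: "vec_scale (c + d) x = vec_scale c x + vec_scale d x"
  by (auto intro!: poly_mapping_eqI simp: lookup_add algebra_simps)

lemma vec_scale_sum: "vec_scale c (\<Sum>i\<in>A. f i) = (\<Sum>i\<in>A. vec_scale c (f i))"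
  by (induct A rule: infinite_finite_induct) auto

lemma vec_expand:
  "(\<Sum>m\<in>Poly_Mapping.keys f. vec_scale (Poly_Mapping.lookup f m) (Poly_Mapping.single m 1)) = f"
  by (rule poly_mapping_eqI)
    (auto simp: lookup_sum lookup_single when_def in_keys_iff sum.delta' if_distrib cong: if_cong)

text \<open>A type rather than a carrier set: with the \<open>ring_1\<close> instance below, the
  relation sets, stated over a type of that class, can be interpreted by operators directly.\<close>

typedef (overloaded) ('m, 'k) endo =
  "{f :: ('m \<Rightarrow>\<^sub>0 'k::comm_ring_1) \<Rightarrow> ('m \<Rightarrow>\<^sub>0 'k).
     (\<forall>x y. f (x + y) = f x + f y) \<and> (\<forall>c x. f (vec_scale c x) = vec_scale c (f x))}"
  morphisms app Endo
  by (rule exI[of _ "\<lambda>x. x"]) simp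

setup_lifting type_definition_endo

lemma app_add: "app A (x + y) = app A x + app A y"
  using app[of A] by auto

lemma app_scale: "app A (vec_scale c x) = vec_scale c (app A x)"
  using app[of A] by auto

lemma app_0 [simp]: "app A 0 = 0"
  using app_add[of A 0 0] by simp

lemma app_minus: "app A (- x) = - app A x"
  using app_add[of A x "- x"] by (simp add: eq_neg_iff_add_eq_0 add.commute)

lemma app_diff: "app A (x - y) = app A x - app A y"
  using app_add[of A x "- y"] by (simp add: app_minus)

lemma app_sum: "app A (\<Sum>i\<in>I. f i) = (\<Sum>i\<in>I. app A (f i))"
  by (induct I rule: infinite_finite_induct) (auto simp: app_add)

instantiation endo :: (type, comm_ring_1) ring_1
begin

lift_definition zero_endo :: "('a, 'b) endo" is "\<lambda>x. 0" by simp
lift_definition one_endo :: "('a, 'b) endo" is "\<lambda>x. x" by simp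
lift_definition plus_endo :: "('a, 'b) endo \<Rightarrow> ('a, 'b) endo \<Rightarrow> ('a, 'b) endo"
  is "\<lambda>f g x. f x + g x" by simp
lift_definition minus_endo :: "('a, 'b) endo \<Rightarrow> ('a, 'b) endo \<Rightarrow> ('a, 'b) endo"
  is "\<lambda>f g x. f x - g x" by simp
lift_definition uminus_endo :: "('a, 'b) endo \<Rightarrow> ('a, 'b) endo"
  is "\<lambda>f x. - f x" by simp
lift_definition times_endo :: "('a, 'b) endo \<Rightarrow> ('a, 'b) endo \<Rightarrow> ('a, 'b) endo"
  is "\<lambda>f g x. f (g x)" by simp

instance
proof
  have "app (0::('a, 'b) endo) (Poly_Mapping.single undefined 1)
      \<noteq> app (1::('a, 'b) endo) (Poly_Mapping.single undefined 1)"
    by (simp add: zero_endo.rep_eq one_endo.rep_eq) (metis lookup_single_eq lookup_zero zero_neq_one)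
  then show "(0::('a, 'b) endo) \<noteq> 1" by metis
qed (transfer; auto)+

end

lemma app_simps:
  "app (A + B) x = app A x + app B x" "app (A - B) x = app A x - app B x"
  "app (- A) x = - app A x" "app (A * B) x = app A (app B x)" "app 0 x = 0" "app 1 x = x"
  by (transfer; simp)+

lemmas app_mult = app_simps(4)

lemma app_sum_endo: "app (\<Sum>i\<in>I. A i) x = (\<Sum>i\<in>I. app (A i) x)"
  by (induct I rule: infinite_finite_induct) (auto simp: app_simps)

lift_definition scalar_op :: "'k \<Rightarrow> ('m, 'k::comm_ring_1) endo" is vec_scale
  by (simp add: mult.commute)

lemma scalar_op_commute: "scalar_op c * A = A * scalar_op c"
  by transfer auto

lemma scalar_op_simps [simp]:
  "scalar_op (c + d) = scalar_op c + scalar_op d" "scalar_op (c * d) = scalar_op c * scalar_op d"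
  "scalar_op 0 = 0" "scalar_op 1 = 1"
  by (transfer; auto simp: vec_scale_add_left)+

lift_definition lin :: "('m \<Rightarrow> ('m \<Rightarrow>\<^sub>0 'k::comm_ring_1)) \<Rightarrow> ('m, 'k) endo"
  is "\<lambda>g f. \<Sum>m\<in>Poly_Mapping.keys f. vec_scale (Poly_Mapping.lookup f m) (g m)"
proof (safe, goal_cases)
  case (1 g x y)
  have ext: "(\<Sum>m\<in>Poly_Mapping.keys f. vec_scale (Poly_Mapping.lookup f m) (g m))
      = (\<Sum>m\<in>Poly_Mapping.keys x \<union> Poly_Mapping.keys y. vec_scale (Poly_Mapping.lookup f m) (g m))"
    if "Poly_Mapping.keys f \<subseteq> Poly_Mapping.keys x \<union> Poly_Mapping.keys y" for f
    by (rule sum.mono_neutral_left) (use that in \<open>auto simp: in_keys_iff\<close>)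
  show ?case
    unfolding ext[of "x + y", OF Poly_Mapping.keys_add] ext[of x, OF Un_upper1] ext[of y, OF Un_upper2]
    by (simp add: lookup_add vec_scale_add_left sum.distrib)
next
  case (2 g c x)
  have "(\<Sum>m\<in>Poly_Mapping.keys (vec_scale c x). vec_scale (Poly_Mapping.lookup (vec_scale c x) m) (g m))
      = (\<Sum>m\<in>Poly_Mapping.keys x. vec_scale (Poly_Mapping.lookup (vec_scale c x) m) (g m))"
    by (rule sum.mono_neutral_left) (use keys_vec_scale[of c x] in \<open>auto simp: in_keys_iff\<close>)
  then show ?case by (simp add: vec_scale_sum)
qed

lemma app_lin_single [simp]: "app (lin g) (Poly_Mapping.single m c) = vec_scale c (g m)"
  by transfer simp

lemma vec_eqI:
  assumes "\<And>m. app A (Poly_Mapping.single m 1) = app B (Poly_Mapping.single m 1)"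
  shows "app A f = app B f"
proof -
  have "app A f = app A (\<Sum>m\<in>Poly_Mapping.keys f. vec_scale (Poly_Mapping.lookup f m) (Poly_Mapping.single m 1))"
    by (simp only: vec_expand)
  also have "\<dots> = app B (\<Sum>m\<in>Poly_Mapping.keys f. vec_scale (Poly_Mapping.lookup f m) (Poly_Mapping.single m 1))"
    by (simp only: app_sum app_scale assms)
  finally show ?thesis by (simp only: vec_expand)
qed

lemma endo_eqI:
  assumes "\<And>m. app A (Poly_Mapping.single m 1) = app B (Poly_Mapping.single m 1)"
  shows "A = B"
  using vec_eqI[OF assms] by (simp add: app_inject[symmetric] fun_eq_iff)

text \<open>Operators carrying each basis vector to a multiple of a basis vector. All building
  blocks below except the divided differences are of this kind, so their identities reduce to
  identities between maps of indices.\<close>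

definition monomial_op :: "('m \<Rightarrow> 'm) \<Rightarrow> ('m \<Rightarrow> 'k) \<Rightarrow> ('m, 'k::comm_ring_1) endo"
  where "monomial_op \<phi> c = lin (\<lambda>m. Poly_Mapping.single (\<phi> m) (c m))"

lemma app_monomial_op [simp]:
  "app (monomial_op \<phi> c) (Poly_Mapping.single m a) = Poly_Mapping.single (\<phi> m) (a * c m)"
  by (simp add: monomial_op_def)

lemma monomial_op_mult:
  "monomial_op \<phi> c * monomial_op \<psi> d = monomial_op (\<phi> \<circ> \<psi>) (\<lambda>m. c (\<psi> m) * d m)"
  by (rule endo_eqI) (simp add: app_simps mult.commute)

abbreviation perm_op :: "('m \<Rightarrow> 'm) \<Rightarrow> ('m, 'k::comm_ring_1) endo"
  where "perm_op \<phi> \<equiv> monomial_op \<phi> (\<lambda>_. 1)"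

lemma lookup_perm_op:
  assumes "inj \<phi>"
  shows "Poly_Mapping.lookup (app (perm_op \<phi>) f) (\<phi> m) = Poly_Mapping.lookup f m"
proof -
  have "app (perm_op \<phi>) f = (\<Sum>m\<in>Poly_Mapping.keys f. Poly_Mapping.single (\<phi> m) (Poly_Mapping.lookup f m))"
    by (simp add: monomial_op_def lin.rep_eq)
  then show ?thesis
    using assms
    by (simp add: lookup_sum lookup_single when_def inj_eq sum.delta in_keys_iff)
qed

lemma keys_perm_op:
  assumes "inj \<phi>"
  shows "Poly_Mapping.keys (app (perm_op \<phi>) f) = \<phi> ` Poly_Mapping.keys f"
proof -
  have "app (perm_op \<phi>) f = (\<Sum>m\<in>Poly_Mapping.keys f. Poly_Mapping.single (\<phi> m) (Poly_Mapping.lookup f m))"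
    by (simp add: monomial_op_def lin.rep_eq)
  then have "Poly_Mapping.keys (app (perm_op \<phi>) f) \<subseteq> \<phi> ` Poly_Mapping.keys f"
    using keys_sum[of "\<lambda>m. Poly_Mapping.single (\<phi> m) (Poly_Mapping.lookup f m)" "Poly_Mapping.keys f"]
    by (auto split: if_splits)
  then show ?thesis
    using lookup_perm_op[OF assms, of f] by (auto simp: in_keys_iff)
qed

section \<open>Divided differences and Dunkl operators on Laurent polynomials with values in the
  regular module\<close>

section \<open>Dunkl operators\<close>

text \<open>
  The triple \<open>(a, b, w)\<close> stands for the basis vector \<open>x\<^sup>a \<lambda>\<^sup>b \<otimes> w\<close>; the last component only
  serves to tell apart the images of one vector under different permutations.
\<close>

type_synonym basis = "(nat \<Rightarrow> int) \<times> (nat \<Rightarrow> nat) \<times> (nat \<Rightarrow> nat)"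

definition shift_x :: "int \<Rightarrow> nat \<Rightarrow> basis \<Rightarrow> basis"
  where "shift_x n i = (\<lambda>(a, c). (a(i := a i + n), c))"

definition shift_lam :: "nat \<Rightarrow> nat \<Rightarrow> basis \<Rightarrow> basis"
  where "shift_lam n i = (\<lambda>(a, b, w). (a, b(i := b i + n), w))"

definition act :: "(nat \<Rightarrow> nat) \<Rightarrow> basis \<Rightarrow> basis"
  where "act p = (\<lambda>(a, b, w). (a \<circ> inv_into UNIV p, b \<circ> inv_into UNIV p, p \<circ> w))"

text \<open>Leaves x alone: f \<otimes> v goes to f \<otimes> s v, against s f \<otimes> s v for
  \<open>act\<close>. The difference of the two is the numerator of a divided difference.\<close>

definition act_lam :: "(nat \<Rightarrow> nat) \<Rightarrow> basis \<Rightarrow> basis"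
  where "act_lam p = (\<lambda>(a, b, w). (a, b \<circ> inv_into UNIV p, p \<circ> w))"

definition X_op :: "nat \<Rightarrow> (basis, 'k::comm_ring_1) endo"
  where "X_op i = perm_op (shift_x 1 i)"

definition Xinv_op :: "nat \<Rightarrow> (basis, 'k::comm_ring_1) endo"
  where "Xinv_op i = perm_op (shift_x (- 1) i)"

definition Lam_op :: "nat \<Rightarrow> (basis, 'k::comm_ring_1) endo"
  where "Lam_op i = perm_op (shift_lam 1 i)"

text \<open>The Euler operator x_i d/dx_i, so that \<open>Xinv_op i * Euler_op i\<close> is the
  derivative d/dx_i.\<close>

definition Euler_op :: "nat \<Rightarrow> (basis, 'k::comm_ring_1) endo"
  where "Euler_op i = monomial_op (\<lambda>m. m) (\<lambda>m. of_int (fst m i))"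

definition T_op :: "(nat \<Rightarrow> nat) \<Rightarrow> (basis, 'k::comm_ring_1) endo"
  where "T_op p = perm_op (act p)"

definition V_op :: "(nat \<Rightarrow> nat) \<Rightarrow> (basis, 'k::comm_ring_1) endo"
  where "V_op p = perm_op (act_lam p)"

lemmas op_defs = X_op_def Xinv_op_def Lam_op_def Euler_op_def T_op_def V_op_def
lemmas shift_defs = shift_x_def shift_lam_def act_def act_lam_def

lemma comp_inv_upd:
  assumes "bij p"
  shows "f(i := v) \<circ> inv_into UNIV p = (f \<circ> inv_into UNIV p)(p i := v)"
  using assms by (auto simp: fun_eq_iff bij_is_inj bij_is_surj surj_f_inv_f)

lemma inv_inv_app: "bij p \<Longrightarrow> inv_into UNIV p (p i) = i"
  by (simp add: bij_is_inj)

lemma inj_shift_x: "inj (shift_x n i)"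
  by (rule inj_on_inverseI[of _ "shift_x (- n) i"]) (auto simp: shift_x_def)

lemma X_op_commute: "X_op i * X_op j = X_op j * X_op i"
  by (cases "i = j"; rule endo_eqI) (auto simp: op_defs shift_defs app_simps fun_upd_twist split: prod.splits)

lemma X_op_inverse: "X_op i * Xinv_op i = 1" "Xinv_op i * X_op i = 1"
  by (rule endo_eqI; auto simp: op_defs shift_defs app_simps split: prod.splits)+

lemma T_op_id: "T_op id = 1"
  by (rule endo_eqI) (auto simp: op_defs shift_defs app_simps split: prod.splits)

lemma T_op_mult: "bij p \<Longrightarrow> bij q \<Longrightarrow> T_op p * T_op q = T_op (p \<circ> q)"
  by (rule endo_eqI) (auto simp: op_defs shift_defs app_simps o_inv_distrib o_assoc split: prod.splits)

lemma T_op_X: "bij p \<Longrightarrow> T_op p * X_op i = X_op (p i) * T_op p"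
  by (rule endo_eqI) (auto simp: op_defs shift_defs app_simps comp_inv_upd inv_inv_app split: prod.splits)

lemma T_op_Xinv: "bij p \<Longrightarrow> T_op p * Xinv_op i = Xinv_op (p i) * T_op p"
  by (rule endo_eqI) (auto simp: op_defs shift_defs app_simps comp_inv_upd inv_inv_app split: prod.splits)

lemma T_op_Lam: "bij p \<Longrightarrow> T_op p * Lam_op i = Lam_op (p i) * T_op p"
  by (rule endo_eqI) (auto simp: op_defs shift_defs app_simps comp_inv_upd inv_inv_app split: prod.splits)

lemma T_op_Euler: "bij p \<Longrightarrow> T_op p * Euler_op i = Euler_op (p i) * T_op p"
  by (rule endo_eqI) (auto simp: op_defs shift_defs app_simps inv_inv_app split: prod.splits)

lemma T_op_V:
  assumes "bij p" "bij s"
  shows "T_op p * V_op s = V_op (p \<circ> s \<circ> inv_into UNIV p) * T_op p"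
proof -
  have i: "inv_into UNIV (p \<circ> s \<circ> inv_into UNIV p) = p \<circ> inv_into UNIV s \<circ> inv_into UNIV p"
    using assms by (simp add: o_inv_distrib bij_comp bij_imp_bij_inv inv_inv_eq o_assoc)
  have "act p \<circ> act_lam s = act_lam (p \<circ> s \<circ> inv_into UNIV p) \<circ> act p"
    using assms(1) by (auto simp: fun_eq_iff act_def act_lam_def i inv_inv_app split: prod.splits)
  then show ?thesis by (simp add: T_op_def V_op_def monomial_op_mult)
qed

lemma Lam_op_X: "Lam_op i * X_op j = X_op j * Lam_op i"
  by (rule endo_eqI) (auto simp: op_defs shift_defs app_simps split: prod.splits)

lemma V_op_X: "V_op s * X_op j = X_op j * V_op s"
  by (rule endo_eqI) (auto simp: op_defs shift_defs app_simps split: prod.splits)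

lemma Euler_op_X:
  "Xinv_op i * Euler_op i * X_op j - X_op j * (Xinv_op i * Euler_op i) = (if i = j then 1 else 0)"
  by (rule endo_eqI)
    (auto simp: op_defs shift_defs app_simps single_diff[symmetric] fun_upd_twist split: prod.splits)

text \<open>In the support of f take a vector with the largest exponent of x_i. Its image under
  \<open>X_op i\<close> must also be an image under \<open>X_op j\<close>, whose source has an
  exponent of x_i larger by one. Only supports are compared, so zero divisors among the coefficients
  do no harm.\<close>

lemma X_op_diff_inject:
  assumes "i \<noteq> j" "app (X_op i - X_op j) f = 0"
  shows "f = (0 :: basis \<Rightarrow>\<^sub>0 'k::comm_ring_1)"
proof (rule ccontr)
  assume "f \<noteq> 0"
  then have ne: "Poly_Mapping.keys f \<noteq> {}" by simp
  define n where "n = Max ((\<lambda>m. fst m i) ` Poly_Mapping.keys f)"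
  have "n \<in> (\<lambda>m. fst m i) ` Poly_Mapping.keys f"
    unfolding n_def by (rule Max_in) (use ne in auto)
  then obtain m where m: "m \<in> Poly_Mapping.keys f" "fst m i = n" by auto
  have "app (X_op i) f = app (X_op j) f" using assms by (simp add: app_simps)
  then have "shift_x 1 i ` Poly_Mapping.keys f = shift_x 1 j ` Poly_Mapping.keys f"
    by (metis X_op_def keys_perm_op inj_shift_x)
  then obtain m' where m': "m' \<in> Poly_Mapping.keys f" "shift_x 1 i m = shift_x 1 j m'"
    using m(1) by blast
  then have "fst m' i = n + 1"
    using m(2) \<open>i \<noteq> j\<close> by (auto simp: shift_x_def fun_eq_iff split: prod.splits)
      (metis)
  moreover have "fst m' i \<le> n"
    unfolding n_def by (rule Max_ge) (use m' in auto)
  ultimately show False by simp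
qed

text \<open>Left cancellation turns each identity for divided differences into one for
  \<open>V_op\<close> and \<open>T_op\<close>.\<close>

lemma X_op_diff_cancel:
  assumes "i \<noteq> j" "(X_op i - X_op j) * A = (X_op i - X_op j) * B"
  shows "A = B"
proof (rule endo_eqI)
  fix m
  have "app (X_op i - X_op j) (app (A - B) (Poly_Mapping.single m 1))
      = app ((X_op i - X_op j) * A - (X_op i - X_op j) * B) (Poly_Mapping.single m 1)"
    unfolding app_mult[symmetric] by (simp only: right_diff_distrib)
  also have "\<dots> = 0" by (simp only: assms(2) diff_self app_simps(5))
  finally have "app (A - B) (Poly_Mapping.single m 1) = 0"
    by (rule X_op_diff_inject[OF assms(1)])
  then show "app A (Poly_Mapping.single m 1) = app B (Poly_Mapping.single m 1)"
    by (simp add: app_simps(2))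
qed

text \<open>Divisibility of x^a - s x^a by x_i - x_j, by induction on the difference of the two
  exponents; if that is negative, the monomials are exchanged and the sign changes. The clause on
  \<open>snd\<close> keeps track that lambda and w are untouched, which later bounds the lambda
  degree.\<close>

lemma divided_difference_exists:
  assumes "i \<noteq> j"
  shows "\<exists>g. app (X_op i - X_op j) g =
      Poly_Mapping.single (a, c) (1::'k::comm_ring_1) - Poly_Mapping.single (a \<circ> transpose i j, c) 1 \<and>
    (\<forall>m\<in>Poly_Mapping.keys g. snd m = c)"
proof -
  have *: "\<exists>g. app (X_op i - X_op j) g =
      Poly_Mapping.single (a, c) (1::'k) - Poly_Mapping.single (a \<circ> transpose i j, c) 1 \<and>
    (\<forall>m\<in>Poly_Mapping.keys g. snd m = c)" if "a i = a j + int n" for a n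
    using that
  proof (induction n arbitrary: a)
    case 0
    then have "a \<circ> transpose i j = a" by (auto simp: fun_eq_iff transpose_def)
    then show ?case by (intro exI[of _ 0]) simp
  next
    case (Suc n)
    define a' where "a' = a(i := a i - 1)"
    have "a' i = a' j + int n" using Suc.prems assms by (simp add: a'_def)
    from Suc.IH[OF this] obtain g where
      g: "app (X_op i - X_op j) g =
        Poly_Mapping.single (a', c) (1::'k) - Poly_Mapping.single (a' \<circ> transpose i j, c) 1"
      and gc: "\<forall>m\<in>Poly_Mapping.keys g. snd m = c" by blast
    \<comment> \<open>With g the quotient for a' = a - e_i: x_i (x^{a'} - x^{s a'}) + (x_i - x_j)
      x^{s a'} = x^a - x_j x^{s a'}, and x_j x^{s a'} = x^{s a}.\<close>
    let ?g = "app (X_op i) g + Poly_Mapping.single (a' \<circ> transpose i j, c) 1"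
    have 1: "shift_x 1 i (a', c) = (a, c)" by (auto simp: shift_x_def a'_def)
    have 2: "shift_x 1 j (a' \<circ> transpose i j, c) = (a \<circ> transpose i j, c)"
      using assms by (auto simp: shift_x_def a'_def fun_eq_iff transpose_def)
    have "app (X_op i - X_op j) (app (X_op i) g) = app (X_op i) (app (X_op i - X_op j) g)"
      unfolding app_mult[symmetric] by (simp add: left_diff_distrib right_diff_distrib X_op_commute)
    then have "app (X_op i - X_op j) ?g =
        Poly_Mapping.single (a, c) 1 - Poly_Mapping.single (a \<circ> transpose i j, c) 1"
      by (simp add: app_add g app_diff) (simp add: X_op_def app_simps 1 2)
    moreover have "\<forall>m\<in>Poly_Mapping.keys ?g. snd m = c"
    proof
      fix m assume "m \<in> Poly_Mapping.keys ?g"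
      then have "m \<in> shift_x 1 i ` Poly_Mapping.keys g \<or> m = (a' \<circ> transpose i j, c)"
        using Poly_Mapping.keys_add[of "app (X_op i) g" "Poly_Mapping.single (a' \<circ> transpose i j, c) 1"]
        by (auto simp: X_op_def keys_perm_op inj_shift_x)
      then show "snd m = c" using gc by (auto simp: shift_x_def split: prod.splits)
    qed
    ultimately show ?case by blast
  qed
  show ?thesis
  proof (cases "a j \<le> a i")
    case True
    then show ?thesis by (intro *[of a "nat (a i - a j)"]) simp
  next
    case False
    obtain g where g: "app (X_op i - X_op j) g =
        Poly_Mapping.single (a \<circ> transpose i j, c) (1::'k) - Poly_Mapping.single (a, c) 1"
      and gc: "\<forall>m\<in>Poly_Mapping.keys g. snd m = c"
      using *[of "a \<circ> transpose i j" "nat (a j - a i)"] False by (auto simp: o_assoc[symmetric])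
    show ?thesis by (rule exI[of _ "- g"]) (use g gc in \<open>simp add: app_minus\<close>)
  qed
qed

text \<open>For i \<noteq> j the choice is unambiguous: by injectivity of
  \<open>X_op i - X_op j\<close> the first condition admits at most one g. The second condition
  makes the lambda and w components of g available.\<close>

definition divided_difference :: "nat \<Rightarrow> nat \<Rightarrow> (basis, 'k::comm_ring_1) endo"
  where "divided_difference i j = lin (\<lambda>m. SOME g.
    app (X_op i - X_op j) g =
      app (V_op (transpose i j) - T_op (transpose i j)) (Poly_Mapping.single m 1) \<and>
    (\<forall>m'\<in>Poly_Mapping.keys g. snd m' = snd (act (transpose i j) m)))"

lemma divided_difference_single:
  assumes "i \<noteq> j"
  shows "app (X_op i - X_op j) (app (divided_difference i j) (Poly_Mapping.single m (1::'k::comm_ring_1))) =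
      app (V_op (transpose i j) - T_op (transpose i j)) (Poly_Mapping.single m 1)" (is ?A)
    and "\<forall>m'\<in>Poly_Mapping.keys (app (divided_difference i j) (Poly_Mapping.single m (1::'k))).
      snd m' = snd (act (transpose i j) m)" (is ?B)
proof -
  obtain a b w where m: "m = (a, b, w)" by (cases m)
  have "\<exists>g. app (X_op i - X_op j) g =
      app (V_op (transpose i j) - T_op (transpose i j)) (Poly_Mapping.single m (1::'k)) \<and>
    (\<forall>m'\<in>Poly_Mapping.keys g. snd m' = snd (act (transpose i j) m))"
  proof -
    have "app (V_op (transpose i j) - T_op (transpose i j)) (Poly_Mapping.single m (1::'k))
        = Poly_Mapping.single (a, snd (act (transpose i j) m)) 1
          - Poly_Mapping.single (a \<circ> transpose i j, snd (act (transpose i j) m)) 1"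
      by (simp add: m act_def act_lam_def V_op_def T_op_def app_simps)
    then show ?thesis by (simp only: divided_difference_exists[OF assms])
  qed
  from someI_ex[OF this] show ?A ?B
    unfolding divided_difference_def app_lin_single vec_scale_simps(5) by (rule conjunct1, rule conjunct2)
qed

lemma divided_difference_X:
  assumes "i \<noteq> j"
  shows "(X_op i - X_op j) * divided_difference i j = V_op (transpose i j) - T_op (transpose i j)"
  by (rule endo_eqI) (simp add: app_mult divided_difference_single[OF assms])

text \<open>After multiplication by x_i - x_j the left side is the commutator of
  \<open>V_op s - T_op s\<close> with X_m. Here V commutes with X_m while T turns it into X_{s m},
  so (X_m - X_{s m}) T remains, and X_m - X_{s m} is x_i - x_j, its negative or 0.\<close>

lemma divided_difference_commutator:
  assumes "i \<noteq> j"
  shows "divided_difference i j * X_op m - X_op m * divided_difference i j =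
    (if m = i then T_op (transpose i j) else if m = j then - T_op (transpose i j) else 0)"
    (is "?L = ?R")
proof (rule X_op_diff_cancel[OF assms])
  let ?s = "transpose i j" and ?d = "divided_difference i j"
  have "(X_op i - X_op j) * ?L
      = ((X_op i - X_op j) * ?d) * X_op m - X_op m * ((X_op i - X_op j) * ?d)"
    by (simp add: right_diff_distrib left_diff_distrib X_op_commute mult.assoc[symmetric])
  also have "\<dots> = (X_op m - X_op (?s m)) * T_op ?s"
    unfolding divided_difference_X[OF assms]
    by (simp add: right_diff_distrib left_diff_distrib T_op_X V_op_X)
  also have "\<dots> = (X_op i - X_op j) * ?R"
    using assms by (auto simp: transpose_def left_diff_distrib right_diff_distrib)
  finally show "(X_op i - X_op j) * ?L = (X_op i - X_op j) * ?R" .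
qed

lemma transpose_conj: "bij p \<Longrightarrow> p \<circ> transpose i j = transpose (p i) (p j) \<circ> p"
  by (auto simp: fun_eq_iff transpose_def bij_is_inj inj_eq)

lemma T_op_divided_difference:
  assumes "i \<noteq> j" "bij p"
  shows "T_op p * divided_difference i j = divided_difference (p i) (p j) * T_op p"
proof -
  have ne: "p i \<noteq> p j" using assms by (simp add: bij_is_inj inj_eq)
  have "p \<circ> inv_into UNIV p = id"
    using assms(2) bij_is_surj surj_iff by blast
  then have c: "p \<circ> transpose i j \<circ> inv_into UNIV p = transpose (p i) (p j)"
    using assms(2) by (simp add: transpose_conj o_assoc[symmetric])
  have V: "T_op p * V_op (transpose i j) = V_op (transpose (p i) (p j)) * T_op p"
    using T_op_V[OF assms(2), of "transpose i j"] by (simp add: c)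
  have T: "T_op p * T_op (transpose i j) = T_op (transpose (p i) (p j)) * T_op p"
    using assms(2) by (simp add: T_op_mult transpose_conj)
  show ?thesis
  proof (rule X_op_diff_cancel[OF ne])
    have "(X_op (p i) - X_op (p j)) * (T_op p * divided_difference i j)
        = T_op p * ((X_op i - X_op j) * divided_difference i j)"
      by (simp add: right_diff_distrib left_diff_distrib mult.assoc[symmetric] T_op_X[OF assms(2)])
    also have "\<dots> = (V_op (transpose (p i) (p j)) - T_op (transpose (p i) (p j))) * T_op p"
      unfolding divided_difference_X[OF assms(1)]
      by (simp add: right_diff_distrib left_diff_distrib V T)
    finally show "(X_op (p i) - X_op (p j)) * (T_op p * divided_difference i j)
        = (X_op (p i) - X_op (p j)) * (divided_difference (p i) (p j) * T_op p)"
      by (simp add: mult.assoc[symmetric] divided_difference_X[OF ne])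
  qed
qed

text \<open>If neither variable occurs, s fixes the monomial and the numerator vanishes.\<close>

lemma divided_difference_vanish:
  assumes "i \<noteq> j" "fst m i = 0" "fst m j = 0"
  shows "app (divided_difference i j) (Poly_Mapping.single m (1::'k::comm_ring_1)) = 0"
proof (rule X_op_diff_inject[OF assms(1)])
  have "act_lam (transpose i j) m = act (transpose i j) m"
    using assms by (cases m) (auto simp: act_def act_lam_def fun_eq_iff transpose_def)
  then show "app (X_op i - X_op j) (app (divided_difference i j) (Poly_Mapping.single m (1::'k))) = 0"
    unfolding divided_difference_single(1)[OF assms(1)] by (simp add: app_simps V_op_def T_op_def)
qed

text \<open>The action of p_i on the induced module: lambda_i on the inducing vectors, corrected by
  the derivative and the divided differences on the Laurent factor.\<close>

definition dunkl_op :: "nat \<Rightarrow> 'k \<Rightarrow> 'k \<Rightarrow> nat \<Rightarrow> (basis, 'k::comm_ring_1) endo"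
  where "dunkl_op N h k i = Lam_op i + scalar_op h * (Xinv_op i * Euler_op i)
    - scalar_op k * (\<Sum>r\<in>{1..N}-{i}. divided_difference i r)"

lemma commutator_scalar: "scalar_op c * A * B - B * (scalar_op c * A) = scalar_op c * (A * B - B * A)"
proof -
  have "B * (scalar_op c * A) = scalar_op c * (B * A)"
    by (metis mult.assoc scalar_op_commute)
  then show ?thesis by (simp add: right_diff_distrib mult.assoc)
qed

lemma commutator_sum: "sum f I * B - B * sum f I = (\<Sum>i\<in>I. f i * B - B * (f i :: 'a::ring_1))"
  by (simp add: sum_distrib_left sum_distrib_right sum_subtractf)

text \<open>The first summand commutes with x_j and the derivative contributes h on the diagonal.
  The divided differences contribute one transposition for each r on the diagonal, but only the one
  with r = j off it.\<close>

lemma dunkl_op_X: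
  fixes h k :: "'a::comm_ring_1"
  assumes "i \<in> {1..N}" "j \<in> {1..N}"
  shows "dunkl_op N h k i * X_op j - X_op j * dunkl_op N h k i =
    (if i = j then scalar_op h - scalar_op k * (\<Sum>r\<in>{1..N}-{i}. T_op (transpose i r))
     else scalar_op k * T_op (transpose i j))"
proof -
  have "dunkl_op N h k i * X_op j - X_op j * dunkl_op N h k i
     = (Lam_op i * X_op j - X_op j * Lam_op i)
     + (scalar_op h * (Xinv_op i * Euler_op i) * X_op j - X_op j * (scalar_op h * (Xinv_op i * Euler_op i)))
     - (scalar_op k * (\<Sum>r\<in>{1..N}-{i}. divided_difference i r) * X_op j
        - X_op j * (scalar_op k * (\<Sum>r\<in>{1..N}-{i}. divided_difference i r)))"
    by (simp add: dunkl_op_def algebra_simps)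
  also have "\<dots> = scalar_op h * (if i = j then 1 else 0)
     - scalar_op k * (\<Sum>r\<in>{1..N}-{i}. if j = i then T_op (transpose i r)
         else if j = r then - T_op (transpose i r) else 0)"
  proof -
    have "(\<Sum>r\<in>{1..N}-{i}. divided_difference i r * X_op j - X_op j * divided_difference i r)
        = (\<Sum>r\<in>{1..N}-{i}. if j = i then T_op (transpose i r)
             else if j = r then - T_op (transpose i r) else (0 :: (basis, 'a) endo))"
      by (rule sum.cong[OF refl], rule divided_difference_commutator) auto
    then show ?thesis
      unfolding commutator_scalar commutator_sum Euler_op_X Lam_op_X by simp
  qed
  also have "\<dots> = (if i = j then scalar_op h - scalar_op k * (\<Sum>r\<in>{1..N}-{i}. T_op (transpose i r))
     else scalar_op k * T_op (transpose i j))"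
    using assms by (auto simp: sum.delta)
  finally show ?thesis .
qed

lemma T_op_dunkl:
  fixes h k :: "'a::comm_ring_1"
  assumes "p permutes {1..N}" "i \<in> {1..N}"
  shows "T_op p * dunkl_op N h k i = dunkl_op N h k (p i) * T_op p"
proof -
  have bij: "bij p" using assms(1) by (rule permutes_bij)
  have img: "p ` ({1..N} - {i}) = {1..N} - {p i}"
    using permutes_image[OF assms(1)] bij by (simp add: image_set_diff bij_is_inj)
  have sc: "T_op p * (scalar_op c * B) = scalar_op c * (T_op p * B)" for c and B :: "(basis, 'a) endo"
    by (simp only: mult.assoc[symmetric] scalar_op_commute[of _ "T_op p", symmetric])
  have "(\<Sum>r\<in>{1..N}-{p i}. divided_difference (p i) r :: (basis, 'a) endo) = (\<Sum>r\<in>{1..N}-{i}. divided_difference (p i) (p r))"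
    by (rule sum.reindex_cong[OF inj_on_subset[OF bij_is_inj[OF bij] subset_UNIV] img[symmetric] refl])
  moreover have "T_op p * (\<Sum>r\<in>{1..N}-{i}. divided_difference i r :: (basis, 'a) endo)
      = (\<Sum>r\<in>{1..N}-{i}. divided_difference (p i) (p r)) * T_op p"
    unfolding sum_distrib_left sum_distrib_right
    by (rule sum.cong[OF refl], rule T_op_divided_difference[OF _ bij]) auto
  moreover have "T_op p * (Xinv_op i * Euler_op i :: (basis, 'a) endo) = Xinv_op (p i) * Euler_op (p i) * T_op p"
    by (simp only: mult.assoc[symmetric] T_op_Xinv[OF bij]) (simp only: mult.assoc T_op_Euler[OF bij])
  ultimately show ?thesis
    by (simp add: dunkl_op_def distrib_left distrib_right right_diff_distrib left_diff_distrib sc mult.assoc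
        T_op_Lam[OF bij])
qed

lemma dunkl_op_x_free:
  assumes "\<forall>r\<in>{1..N}. fst m r = 0" "i \<in> {1..N}"
  shows "app (dunkl_op N h k i) (Poly_Mapping.single m (1::'k::comm_ring_1))
    = Poly_Mapping.single (shift_lam 1 i m) 1"
proof -
  have "app (divided_difference i r) (Poly_Mapping.single m (1::'k)) = 0" if "r \<in> {1..N} - {i}" for r
    by (rule divided_difference_vanish) (use that assms in auto)
  then show ?thesis
    using assms by (simp add: dunkl_op_def app_simps app_sum_endo Lam_op_def Euler_op_def)
qed

text \<open>Each basis vector arises from one without x_1, ..., x_N by applying the X_j and their
  inverses, through which C passes. The induction is on the total size of these exponents.\<close>

lemma commutes_X_imp_zero:
  assumes comm: "\<And>j. j \<in> {1..N} \<Longrightarrow> C * X_op j = X_op j * C"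
    and free: "\<And>m. \<forall>r\<in>{1..N}. fst m r = 0 \<Longrightarrow> app C (Poly_Mapping.single m 1) = 0"
  shows "C = (0 :: (basis, 'k::comm_ring_1) endo)"
proof (rule endo_eqI)
  have commi: "C * Xinv_op j = Xinv_op j * C" if "j \<in> {1..N}" for j
  proof -
    have "Xinv_op j * C = Xinv_op j * (C * X_op j) * Xinv_op j"
      by (simp add: mult.assoc X_op_inverse)
    also have "\<dots> = C * Xinv_op j"
      by (simp add: comm[OF that] mult.assoc[symmetric] X_op_inverse)
    finally show ?thesis by simp
  qed
  fix m
  have "app C (Poly_Mapping.single m 1) = 0"
  proof (induction "\<Sum>r\<in>{1..N}. nat \<bar>fst m r\<bar>" arbitrary: m rule: less_induct)
    case less
    show ?case
    proof (cases "\<forall>r\<in>{1..N}. fst m r = 0")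
      case True
      then show ?thesis by (rule free)
    next
      case False
      then obtain r where r: "r \<in> {1..N}" "fst m r \<noteq> 0" by blast
      \<comment> \<open>The sign of a nonzero exponent: m' is one step closer to exponent zero in
        x_r, and X_r or its inverse leads back to m.\<close>
      define e where "e = (if fst m r > 0 then 1 else - 1 :: int)"
      define m' where "m' = shift_x (- e) r m"
      have "(\<Sum>r\<in>{1..N}. nat \<bar>fst m' r\<bar>) < (\<Sum>r\<in>{1..N}. nat \<bar>fst m r\<bar>)"
        by (rule sum_strict_mono_ex1)
          (use r in \<open>auto simp: m'_def shift_x_def e_def split: prod.splits intro!: bexI[of _ r]\<close>)
      from less[OF this] have 0: "app C (Poly_Mapping.single m' 1) = 0" .
      have m: "m = shift_x e r m'" by (cases m) (simp add: m'_def shift_x_def)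
      have "\<exists>A :: (basis, 'k) endo. C * A = A * C \<and> Poly_Mapping.single m 1 = app A (Poly_Mapping.single m' 1)"
      proof (cases "e = 1")
        case True
        then show ?thesis using comm[OF r(1)] by (intro exI[of _ "X_op r"]) (simp add: X_op_def m)
      next
        case False
        then have "e = - 1" by (simp add: e_def split: if_splits)
        then show ?thesis using commi[OF r(1)] by (intro exI[of _ "Xinv_op r"]) (simp add: Xinv_op_def m)
      qed
      then obtain A where A: "C * A = A * C" "Poly_Mapping.single m 1 = app A (Poly_Mapping.single m' 1)"
        by blast
      have "app C (Poly_Mapping.single m 1) = app (C * A) (Poly_Mapping.single m' 1)"
        by (simp only: A(2) app_mult)
      also have "\<dots> = 0" by (simp only: A(1) app_mult 0 app_0)
      finally show ?thesis .
    qed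
  qed
  then show "app C (Poly_Mapping.single m 1) = app 0 (Poly_Mapping.single m 1)"
    by (simp add: app_simps(5))
qed

section \<open>Cross relations of X and P, and why the commutators of the P_i commute with X\<close>

section \<open>Rational Cherednik algebras\<close>

lemma transpose_permutes: "i \<in> A \<Longrightarrow> j \<in> A \<Longrightarrow> transpose i j permutes A"
  by (rule permutes_swap_id)

text \<open>Commutation of the P_i is no axiom here: \<open>commutator_P_X\<close> derives from the
  other relations that their commutators commute with every X_m, which is the input for proving it
  for the Dunkl operators.\<close>

locale rational_cherednik =
  fixes N :: nat and h k :: "'a::ring_1"
    and T :: "(nat \<Rightarrow> nat) \<Rightarrow> 'a" and X P :: "nat \<Rightarrow> 'a"
  assumes h_central: "a * h = h * a" and k_central: "a * k = k * a"
    and T_id: "T id = 1"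
    and T_mult: "p permutes {1..N} \<Longrightarrow> q permutes {1..N} \<Longrightarrow> T p * T q = T (p \<circ> q)"
    and T_X: "p permutes {1..N} \<Longrightarrow> i \<in> {1..N} \<Longrightarrow> T p * X i = X (p i) * T p"
    and T_P: "p permutes {1..N} \<Longrightarrow> i \<in> {1..N} \<Longrightarrow> T p * P i = P (p i) * T p"
    and X_commute: "i \<in> {1..N} \<Longrightarrow> j \<in> {1..N} \<Longrightarrow> X i * X j = X j * X i"
    and P_X_same: "i \<in> {1..N} \<Longrightarrow>
      P i * X i = X i * P i + h - k * (\<Sum>r\<in>{1..N}-{i}. T (transpose i r))"
    and P_X_diff: "i \<in> {1..N} \<Longrightarrow> j \<in> {1..N} \<Longrightarrow> i \<noteq> j \<Longrightarrow>
      P i * X j = X j * P i + k * T (transpose i j)"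
begin

lemma k_left: "a * (k * b) = k * (a * b)"
  by (metis k_central mult.assoc)

lemma T_transpose:
  assumes "p permutes {1..N}" "i \<in> {1..N}" "j \<in> {1..N}"
  shows "T p * T (transpose i j) = T (transpose (p i) (p j)) * T p"
  using assms permutes_in_image[OF assms(1)]
  by (simp add: T_mult transpose_permutes transpose_conj permutes_bij)

lemma T_transpose_sq: "i \<in> {1..N} \<Longrightarrow> j \<in> {1..N} \<Longrightarrow> T (transpose i j) * T (transpose i j) = 1"
  by (simp add: T_mult transpose_permutes T_id)

text \<open>Among the transpositions s_{ir} only s_{ij} moves F_j. The family F is a parameter
  because the statement is applied to P, X and U.\<close>

lemma commutator_T_sum:
  assumes F: "\<And>p i. p permutes {1..N} \<Longrightarrow> i \<in> {1..N} \<Longrightarrow> T p * F i = F (p i) * T p"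
    and "i \<in> {1..N}" "j \<in> {1..N}" "A \<subseteq> {1..N}" "i \<noteq> j" "i \<notin> A"
  shows "(\<Sum>r\<in>A. T (transpose i r)) * F j =
    F j * (\<Sum>r\<in>A. T (transpose i r)) + (if j \<in> A then (F i - F j) * T (transpose i j) else 0)"
proof -
  have fin: "finite A" using assms(4) finite_subset by blast
  have "T (transpose i r) * F j = F j * T (transpose i r) +
      (if r = j then (F i - F j) * T (transpose i j) else 0)" if "r \<in> A" for r
  proof -
    have "T (transpose i r) * F j = F (transpose i r j) * T (transpose i r)"
      by (rule F) (use that assms in \<open>auto intro!: transpose_permutes\<close>)
    then show ?thesis
      using that assms by (auto simp: transpose_def algebra_simps)
  qed
  then have "(\<Sum>r\<in>A. T (transpose i r)) * F j = (\<Sum>r\<in>A. F j * T (transpose i r) +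
      (if r = j then (F i - F j) * T (transpose i j) else 0))"
    unfolding sum_distrib_right by (rule sum.cong[OF refl])
  then show ?thesis
    using fin by (simp add: sum.distrib sum_distrib_left sum.delta)
qed

text \<open>The Jacobi identity [[A,B],x] = [A,[B,x]] - [B,[A,x]], with a = [A,x] and b =
  [B,x].\<close>

lemma double_commutator:
  assumes "A * x = x * A + a" "B * x = x * B + b"
  shows "(A * B - B * A) * x = x * (A * B - B * A) + (A * b - b * A) - (B * a - a * (B :: 'a))"
proof -
  have "A * B * x = (x * A + a) * B + A * b" "B * A * x = (x * B + b) * A + B * a"
    by (simp_all add: mult.assoc assms distrib_left) (simp_all add: assms flip: mult.assoc)
  then show ?thesis by (simp add: algebra_simps)
qed

text \<open>By Jacobi. For m = i the terms [P_i, k s_{ij}] and [P_j, h - k S], with S the sum of the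
  s_{ir}, both equal k (P_i - P_j) s_{ij}; for m = j exchange i and j; otherwise s_{jm} commutes
  with P_i and s_{im} with P_j.\<close>

lemma commutator_P_X:
  assumes ij: "i \<in> {1..N}" "j \<in> {1..N}" "i \<noteq> j" and m: "m \<in> {1..N}"
  shows "(P i * P j - P j * P i) * X m = X m * (P i * P j - P j * P i)"
proof -
  have aux: "(P i * P j - P j * P i) * X i = X i * (P i * P j - P j * P i)"
    if ij: "i \<in> {1..N}" "j \<in> {1..N}" "i \<noteq> j" for i j
  proof -
    define S where "S = (\<Sum>r\<in>{1..N}-{i}. T (transpose i r))"
    let ?t = "T (transpose i j)"
    have t: "?t * P i = P j * ?t" "?t * P j = P i * ?t"
      using ij by (simp_all add: T_P transpose_permutes)
    have S: "S * P j = P j * S + (P i - P j) * ?t"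
      unfolding S_def by (subst commutator_T_sum[where F = P]) (use ij T_P in auto)
    have "P i * X i = X i * P i + (h - k * S)" using P_X_same[OF ij(1)] by (simp add: S_def)
    moreover have "P j * X i = X i * P j + k * ?t"
      using P_X_diff[OF ij(2,1)] ij(3) by (simp add: transpose_commute)
    ultimately have "(P i * P j - P j * P i) * X i = X i * (P i * P j - P j * P i)
       + (P i * (k * ?t) - k * ?t * P i) - (P j * (h - k * S) - (h - k * S) * P j)"
      by (rule double_commutator)
    also have "P i * (k * ?t) - k * ?t * P i = k * ((P i - P j) * ?t)"
      by (simp add: k_left mult.assoc t left_diff_distrib right_diff_distrib)
    also have "P j * (h - k * S) - (h - k * S) * P j = k * ((P i - P j) * ?t)"
      by (simp add: left_diff_distrib right_diff_distrib h_central k_left mult.assoc S distrib_left)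
    finally show ?thesis by simp
  qed
  consider "m = i" | "m = j" | "m \<noteq> i" "m \<noteq> j" by blast
  then show ?thesis
  proof cases
    case 1
    then show ?thesis using aux[OF ij] by simp
  next
    case 2
    have "(P i * P j - P j * P i) = - (P j * P i - P i * P j)" by simp
    then show ?thesis using aux[OF ij(2,1)] ij(3) 2 by (simp only: minus_mult_left[symmetric] mult_minus_right)
  next
    case 3
    have "(P i * P j - P j * P i) * X m = X m * (P i * P j - P j * P i)
       + (P i * (k * T (transpose j m)) - k * T (transpose j m) * P i)
       - (P j * (k * T (transpose i m)) - k * T (transpose i m) * P j)"
      by (rule double_commutator) (use 3 ij m in \<open>auto intro!: P_X_diff\<close>)
    moreover have "T (transpose j m) * P i = P i * T (transpose j m)"
      "T (transpose i m) * P j = P j * T (transpose i m)"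
      using 3 ij m by (simp_all add: T_P transpose_permutes transpose_def)
    ultimately show ?thesis by (simp add: k_left mult.assoc)
  qed
qed

end

lemma rational_cherednik_dunkl:
  fixes h k :: "'k::comm_ring_1"
  shows "rational_cherednik N (scalar_op h) (scalar_op k) T_op X_op (dunkl_op N h k)"
proof
  fix p :: "nat \<Rightarrow> nat" and i j assume p: "p permutes {1..N}"
  have "bij p" by (rule permutes_bij[OF p])
  then show "T_op p * X_op i = X_op (p i) * T_op p" by (rule T_op_X)
  { fix q :: "nat \<Rightarrow> nat" assume "q permutes {1..N}"
    then show "T_op p * T_op q = T_op (p \<circ> q)"
      using \<open>bij p\<close> by (simp add: T_op_mult permutes_bij) }
next
  fix i assume i: "i \<in> {1..N}"
  show "dunkl_op N h k i * X_op i = X_op i * dunkl_op N h k i + scalar_op h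
      - scalar_op k * (\<Sum>r\<in>{1..N}-{i}. T_op (transpose i r))"
    using dunkl_op_X[OF i i, of h k] by (simp add: algebra_simps)
  fix j assume j: "j \<in> {1..N}" "i \<noteq> j"
  show "dunkl_op N h k i * X_op j = X_op j * dunkl_op N h k i + scalar_op k * T_op (transpose i j)"
    using dunkl_op_X[OF i j(1), of h k] j(2) by (simp add: algebra_simps)
qed (auto simp: scalar_op_commute T_op_id T_op_dunkl X_op_commute)

text \<open>The commutator commutes with all \<open>X_op m\<close> and kills the vectors without \<open>x\<close>, hence vanishes.\<close>

lemma dunkl_op_commute:
  assumes "i \<in> {1..N}" "j \<in> {1..N}"
  shows "dunkl_op N h k i * dunkl_op N h k j = dunkl_op N h k j * dunkl_op N h (k::'k::comm_ring_1) i"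
proof (cases "i = j")
  case False
  interpret rational_cherednik N "scalar_op h" "scalar_op k" T_op X_op "dunkl_op N h k"
    by (rule rational_cherednik_dunkl)
  have "dunkl_op N h k i * dunkl_op N h k j - dunkl_op N h k j * dunkl_op N h k i = 0"
  proof (rule commutes_X_imp_zero)
    fix m :: basis assume m: "\<forall>r\<in>{1..N}. fst m r = 0"
    have free: "\<forall>r\<in>{1..N}. fst (shift_lam 1 i m) r = 0" for i
      using m by (cases m) (simp add: shift_lam_def)
    have "shift_lam 1 i (shift_lam 1 j m) = shift_lam 1 j (shift_lam 1 i m)"
      using False by (cases m) (simp add: shift_lam_def fun_upd_twist)
    then show "app (dunkl_op N h k i * dunkl_op N h k j - dunkl_op N h k j * dunkl_op N h k i)
        (Poly_Mapping.single m 1) = 0"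
      by (simp only: app_simps dunkl_op_x_free[OF m assms(1)] dunkl_op_x_free[OF m assms(2)]
          dunkl_op_x_free[OF free assms(1)] dunkl_op_x_free[OF free assms(2)] diff_self)
  qed (rule commutator_P_X[OF assms False])
  then show ?thesis by simp
qed simp

section \<open>Commuting elements Y_i, the elements D_i, and their relations\<close>

section \<open>The trigonometric and cyclotomic relations\<close>

lemma prod_list_intertwine:
  fixes f g :: "'b \<Rightarrow> 'a::monoid_mult"
  assumes "\<And>r. r \<in> set rs \<Longrightarrow> t * f r = g r * t"
  shows "t * prod_list (map f rs) = prod_list (map g rs) * t"
  using assms
proof (induction rs)
  case (Cons r rs)
  have "t * (f r * prod_list (map f rs)) = g r * (t * prod_list (map f rs))"
    using Cons.prems[of r] by (simp flip: mult.assoc)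
  then show ?case using Cons by (simp add: mult.assoc)
qed simp

lemma prod_list_commuting_mult:
  fixes f g :: "'b \<Rightarrow> 'a::monoid_mult"
  assumes "\<And>r s. g s * f r = f r * g s"
  shows "prod_list (map f rs) * prod_list (map g rs) = prod_list (map (\<lambda>r. f r * g r) rs)"
proof (induction rs)
  case (Cons r rs)
  have "prod_list (map f rs) * g r = g r * prod_list (map f rs)"
    using prod_list_intertwine[of rs "g r" f f] assms by simp
  then have "f r * prod_list (map f rs) * (g r * prod_list (map g rs))
      = f r * g r * (prod_list (map f rs) * prod_list (map g rs))"
    by (metis mult.assoc)
  then show ?case using Cons by simp
qed simp

text \<open>A product of factors that commute with \<open>x\<close> up to \<open>x1 * q\<close> is expanded by the Leibniz rule.\<close>

lemma leibniz_prod_list: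
  fixes b :: "nat \<Rightarrow> 'a::ring_1"
  assumes "\<And>r. b r * x1 = x1 * (b r + j)" "\<And>r. b r * x = x * b r + x1 * q"
  shows "prod_list (map b [1..<l+1]) * x = x * prod_list (map b [1..<l+1]) +
    x1 * (\<Sum>r\<in>{1..l}. prod_list (map (\<lambda>i. b i + j) [1..<r]) * q * prod_list (map b [r+1..<l+1]))"
proof (induction l)
  case (Suc l)
  let ?P = "prod_list (map b [1..<l+1])"
  let ?A = "\<lambda>r. prod_list (map (\<lambda>i. b i + j) [1..<r])"
  have x1: "?P * x1 = x1 * ?A (l + 1)"
    by (rule prod_list_intertwine[symmetric]) (simp add: assms(1))
  \<comment> \<open>Peel off the last factor. Its error x1 * q stands to the right of the first l
    factors, and moving x1 to the front replaces every b by b + j.\<close>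
  have "prod_list (map b [1..<Suc l+1]) * x = ?P * (b (l+1) * x)"
    by (simp add: mult.assoc)
  also have "\<dots> = (?P * x) * b (l+1) + ?P * x1 * q"
    by (simp add: assms(2) distrib_left mult.assoc)
  also have "\<dots> = x * (?P * b (l+1)) + x1 * ((\<Sum>r\<in>{1..l}. ?A r * q * prod_list (map b [r+1..<l+1])) * b (l+1)
      + ?A (l+1) * q)"
    unfolding Suc x1 by (simp only: distrib_left distrib_right mult.assoc add.assoc)
  also have "(\<Sum>r\<in>{1..l}. ?A r * q * prod_list (map b [r+1..<l+1])) * b (l+1)
      = (\<Sum>r\<in>{1..l}. ?A r * q * prod_list (map b [r+1..<Suc l+1]))"
    by (simp add: sum_distrib_right mult.assoc)
  finally show ?case by simp
qed simp

locale cherednik = rational_cherednik N h k T X P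
  for N :: nat and h k :: "'a::ring_1" and T X P +
  fixes Xinv z :: "nat \<Rightarrow> 'a" and l :: nat
  assumes P_commute: "i \<in> {1..N} \<Longrightarrow> j \<in> {1..N} \<Longrightarrow> P i * P j = P j * P i"
    and X_Xinv: "X i * Xinv i = 1" and Xinv_X: "Xinv i * X i = 1"
    and z_central: "a * z r = z r * a"
begin

text \<open>The U_i are permuted by S_N but need not commute; the Y_i commute but are not simply
  permuted. The correction \<open>JM i\<close> is the Jucys-Murphy element. D is built from U, which
  makes its equivariance immediate; for i = 1 the elements U and Y agree
  (\<open>Y_1\<close>).\<close>

definition U :: "nat \<Rightarrow> 'a" where "U i = X i * P i"
definition JM :: "nat \<Rightarrow> 'a" where "JM i = (\<Sum>r\<in>{1..<i}. T (transpose i r))"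
definition Y :: "nat \<Rightarrow> 'a" where "Y i = U i - k * JM i"
definition cyc :: "'a \<Rightarrow> 'a" where "cyc y = prod_list (map (\<lambda>r. y - z r) [1..<l+1])"
definition D :: "nat \<Rightarrow> 'a" where "D i = Xinv i * cyc (U i)"

text \<open>As a and b are arbitrary, this one rule transports the relations of X with S_N, X, U and
  Y to the inverse.\<close>

lemma Xinv_conj:
  assumes "a * X i = X j * b"
  shows "b * Xinv i = Xinv j * a"
proof -
  have "b * Xinv i = Xinv j * (X j * b) * Xinv i" by (simp add: Xinv_X flip: mult.assoc)
  also have "\<dots> = Xinv j * a * (X i * Xinv i)" by (simp add: assms[symmetric] mult.assoc)
  finally show ?thesis by (simp add: X_Xinv)
qed

lemma T_Xinv: "p permutes {1..N} \<Longrightarrow> i \<in> {1..N} \<Longrightarrow> T p * Xinv i = Xinv (p i) * T p"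
  using Xinv_conj[OF T_X] .

lemma X_Xinv_commute: "i \<in> {1..N} \<Longrightarrow> j \<in> {1..N} \<Longrightarrow> X i * Xinv j = Xinv j * X i"
  using Xinv_conj[OF X_commute] by simp

lemma Xinv_commute: "i \<in> {1..N} \<Longrightarrow> j \<in> {1..N} \<Longrightarrow> Xinv i * Xinv j = Xinv j * Xinv i"
  using Xinv_conj[OF X_Xinv_commute[symmetric]] by simp

lemma T_U: "p permutes {1..N} \<Longrightarrow> i \<in> {1..N} \<Longrightarrow> T p * U i = U (p i) * T p"
  by (simp add: U_def T_X flip: mult.assoc) (simp add: T_P mult.assoc)

lemma U_X_same:
  assumes "i \<in> {1..N}"
  shows "U i * X i = X i * U i + h * X i - k * (X i * (\<Sum>r\<in>{1..N}-{i}. T (transpose i r)))"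
  unfolding U_def mult.assoc P_X_same[OF assms] distrib_left right_diff_distrib
  by (simp add: k_left h_central mult.assoc)

lemma U_X_diff:
  assumes "i \<in> {1..N}" "j \<in> {1..N}" "i \<noteq> j"
  shows "U i * X j = X j * U i + k * (X i * T (transpose i j))"
  unfolding U_def mult.assoc P_X_diff[OF assms] distrib_left
  by (simp add: k_left) (simp add: X_commute[OF assms(1,2)] flip: mult.assoc)

text \<open>Moving X_j to the left gives U_i U_j = X_j X_i P_i P_j + k U_i s_{ij}, and likewise with
  i and j exchanged; the leading terms agree because the X and the P commute.\<close>

lemma U_commutator:
  assumes "i \<in> {1..N}" "j \<in> {1..N}" "i \<noteq> j"
  shows "U i * U j = U j * U i + k * ((U i - U j) * T (transpose i j))"
proof -
  let ?t = "T (transpose i j)"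
  have t: "?t * P j = P i * ?t" "?t * P i = P j * ?t"
    using assms by (simp_all add: T_P transpose_permutes)
  have "U i * U j = U i * X j * P j" by (simp add: U_def[of j] mult.assoc)
  also have "\<dots> = X j * (X i * (P i * P j)) + k * (X i * (P i * ?t))"
    by (simp add: U_X_diff[OF assms] distrib_right mult.assoc t) (simp add: U_def mult.assoc)
  finally have 1: "U i * U j = X j * (X i * (P i * P j)) + k * (U i * ?t)" by (simp add: U_def mult.assoc)
  have "U j * U i = U j * X i * P i" by (simp add: U_def[of i] mult.assoc)
  also have "\<dots> = X i * (X j * (P j * P i)) + k * (X j * (P j * ?t))"
    using assms(3) by (simp add: U_X_diff[OF assms(2,1)] distrib_right mult.assoc t transpose_commute[of j i])
      (simp add: U_def mult.assoc)
  finally have 2: "U j * U i = X i * (X j * (P j * P i)) + k * (U j * ?t)" by (simp add: U_def mult.assoc)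
  have "X j * (X i * (P i * P j)) = X i * (X j * (P j * P i))"
    unfolding mult.assoc[symmetric] X_commute[OF assms(2,1)] by (simp add: mult.assoc P_commute[OF assms(1,2)])
  then show ?thesis unfolding 1 2 by (simp add: algebra_simps)
qed

lemma JM_commutator:
  assumes F: "\<And>p i. p permutes {1..N} \<Longrightarrow> i \<in> {1..N} \<Longrightarrow> T p * F i = F (p i) * T p"
    and "i \<in> {1..N}" "j \<in> {1..N}" "i \<noteq> j"
  shows "JM i * F j = F j * JM i + (if j < i then (F i - F j) * T (transpose i j) else 0)"
  unfolding JM_def by (subst commutator_T_sum[OF F]) (use assms(2-) in auto)

text \<open>Each s_{ir} X_i equals X_r s_{ir}. The term \<open>X i * JM i\<close> is added and
  subtracted so that the commutator can be read off.\<close>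

lemma JM_commutator_same:
  assumes "i \<in> {1..N}"
  shows "JM i * X i = X i * JM i + (\<Sum>r\<in>{1..<i}. X r * T (transpose i r)) - X i * JM i"
proof -
  have "JM i * X i = (\<Sum>r\<in>{1..<i}. X r * T (transpose i r))"
    unfolding JM_def sum_distrib_right
    by (rule sum.cong) (use assms in \<open>auto simp: T_X transpose_permutes\<close>)
  then show ?thesis by simp
qed

lemma T_JM:
  assumes p: "p permutes {1..N}" "j \<in> {1..N}" "p j = j" "p ` {1..<j} = {1..<j}"
  shows "T p * JM j = JM j * T p"
proof -
  have "T p * JM j = (\<Sum>r\<in>{1..<j}. T (transpose j (p r)) * T p)"
    unfolding JM_def sum_distrib_left by (rule sum.cong) (use p in \<open>auto simp: T_transpose\<close>)
  also have "\<dots> = (\<Sum>r\<in>{1..<j}. T (transpose j r) * T p)"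
    by (rule sum.reindex_cong[symmetric, OF inj_on_subset[OF permutes_inj[OF p(1)] subset_UNIV] p(4)[symmetric] refl])
  finally show ?thesis by (simp add: JM_def sum_distrib_right)
qed

text \<open>For i < j every transposition occurring in JM_i fixes j and permutes the indices below
  j, hence commutes with JM_j.\<close>

lemma JM_commute:
  assumes "i \<in> {1..N}" "j \<in> {1..N}" "i < j"
  shows "JM i * JM j = JM j * JM i"
proof -
  have "T (transpose i r) * JM j = JM j * T (transpose i r)" if "r \<in> {1..<i}" for r
    by (rule T_JM) (use assms that in \<open>auto intro!: transpose_permutes permutes_image\<close>)
  then show ?thesis
    unfolding JM_def[of i] sum_distrib_left sum_distrib_right by (rule sum.cong[OF refl])
qed

text \<open>JM_i commutes with U_j and with JM_j, while [JM_j, U_i] = (U_j - U_i) s_{ij}, times k,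
  cancels [U_i, U_j]. This is the reason for the Jucys-Murphy correction.\<close>

lemma Y_commute_less:
  assumes "i \<in> {1..N}" "j \<in> {1..N}" "i < j"
  shows "Y i * Y j = Y j * Y i"
proof -
  let ?t = "T (transpose i j)"
  have 1: "JM j * U i - U i * JM j = (U j - U i) * ?t"
    using JM_commutator[of U j i] T_U assms by (simp add: transpose_commute)
  have 2: "JM i * U j - U j * JM i = 0"
    using JM_commutator[of U i j] T_U assms by simp
  have 3: "U i * U j - U j * U i = k * ((U i - U j) * ?t)"
    using U_commutator[of i j] assms by simp
  have 4: "JM i * JM j - JM j * JM i = 0"
    using JM_commute[OF assms] by simp
  have "Y i * Y j - Y j * Y i = (U i * U j - U j * U i) + k * (JM j * U i - U i * JM j)
      - k * (JM i * U j - U j * JM i) + k * (k * (JM i * JM j - JM j * JM i))"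
    by (simp add: Y_def left_diff_distrib right_diff_distrib mult.assoc
        k_left[of "U i"] k_left[of "U j"] k_left[of "JM i"] k_left[of "JM j"])
  also have "\<dots> = 0"
    unfolding 1 2 3 4 by (simp add: left_diff_distrib right_diff_distrib)
  finally show ?thesis by simp
qed

lemma Y_commute: "i \<in> {1..N} \<Longrightarrow> j \<in> {1..N} \<Longrightarrow> Y i * Y j = Y j * Y i"
  using Y_commute_less[of i j] Y_commute_less[of j i] by (cases i j rule: linorder_cases) auto

lemma commutator_Y_X_less:
  assumes "i \<in> {1..N}" "j \<in> {1..N}" "i < j"
  shows "commutator (Y i) (X j) = k * X i * T (transpose i j)"
  using JM_commutator[of X i j, OF T_X] U_X_diff[of i j] assms
  by (simp add: Y_def left_diff_distrib right_diff_distrib k_left mult.assoc)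

text \<open>The term k X_i s_{ij} coming from U_i is diminished by k (X_i - X_j) s_{ij} from JM_i,
  which contains s_{ij} because j < i. Hence the asymmetry between the two cases.\<close>

lemma commutator_Y_X_greater:
  assumes "i \<in> {1..N}" "j \<in> {1..N}" "j < i"
  shows "commutator (Y i) (X j) = k * X j * T (transpose i j)"
  using JM_commutator[of X i j, OF T_X] U_X_diff[of i j] assms
  by (simp add: Y_def left_diff_distrib right_diff_distrib k_left mult.assoc distrib_left)

lemma commutator_Y_X_same:
  assumes "i \<in> {1..N}"
  shows "commutator (Y i) (X i) = h * X i - k * (\<Sum>r \<in> {1..<i}. X r * T (transpose i r))
               - k * (\<Sum>r \<in> {i<..N}. X i * T (transpose i r))"
proof -
  have *: "{1..N} - {i} = {1..<i} \<union> {i<..N}" using assms by auto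
  have "(\<Sum>r\<in>{1..N}-{i}. T (transpose i r)) = JM i + (\<Sum>r\<in>{i<..N}. T (transpose i r))"
    unfolding JM_def * by (rule sum.union_disjoint) auto
  then show ?thesis
    using JM_commutator_same[OF assms] U_X_same[OF assms]
    by (simp add: Y_def left_diff_distrib right_diff_distrib k_left mult.assoc distrib_left sum_distrib_left)
qed

text \<open>Conjugating JM_i by s_i gives JM_{i+1} without its last term s_i; that term, multiplied
  by s_i, produces the constant k.\<close>

lemma T_Y_simple:
  assumes "i \<in> {1..<N}"
  shows "T (transpose i (i+1)) * Y i = Y (i+1) * T (transpose i (i+1)) + k"
proof -
  let ?s = "transpose i (i+1)"
  have s: "?s permutes {1..N}" by (rule transpose_permutes) (use assms in auto)
  have "T ?s * JM i = (\<Sum>r\<in>{1..<i}. T (transpose (i+1) r)) * T ?s"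
    unfolding JM_def sum_distrib_left sum_distrib_right
    by (rule sum.cong) (use assms s in \<open>auto simp: T_transpose\<close>)
  moreover have "JM (i+1) = (\<Sum>r\<in>{1..<i}. T (transpose (i+1) r)) + T ?s"
    using assms by (simp add: JM_def transpose_commute[of "Suc i" i])
  moreover have "T ?s * U i = U (i+1) * T ?s" using s assms by (simp add: T_U)
  moreover have "T ?s * T ?s = 1" by (rule T_transpose_sq) (use assms in auto)
  ultimately show ?thesis
    by (simp add: Y_def right_diff_distrib left_diff_distrib distrib_right distrib_left k_left mult.assoc)
qed

text \<open>Either j < i and s_i fixes all indices below j, or j > i + 1 and s_i permutes them; in
  both cases JM_j commutes with s_i.\<close>

lemma T_Y_simple_other:
  assumes "i \<in> {1..<N}" "j \<in> {1..N}" "j \<noteq> i" "j \<noteq> i+1"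
  shows "T (transpose i (i+1)) * Y j = Y j * T (transpose i (i+1))"
proof -
  let ?s = "transpose i (i+1)"
  have s: "?s permutes {1..N}" by (rule transpose_permutes) (use assms in auto)
  have "?s ` {1..<j} = {1..<j}"
  proof (cases "j < i")
    case True
    then have "?s r = r" if "r \<in> {1..<j}" for r using that by simp
    then show ?thesis by simp
  next
    case False
    then show ?thesis using assms by (intro permutes_image transpose_permutes) auto
  qed
  then have "T ?s * JM j = JM j * T ?s" using s assms by (intro T_JM) auto
  moreover have "T ?s * U j = U j * T ?s" using s assms by (simp add: T_U)
  ultimately show ?thesis by (simp add: Y_def right_diff_distrib left_diff_distrib k_left mult.assoc)
qed

lemma Y_1: "Y 1 = U 1"
  by (simp add: Y_def JM_def)

lemma sym_rels_hold: "(a, b) \<in> symmetric_group_rels N T \<Longrightarrow> a = b"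
  using T_id T_mult by (auto simp: symmetric_group_rels_def)

lemma hecke_rels_hold: "(a, b) \<in> hecke_rels N k T Y \<Longrightarrow> a = b"
  using T_Y_simple T_Y_simple_other Y_commute by (auto simp: hecke_rels_def)

lemma X_rels_hold: "(a, b) \<in> permuted_family_rels N T X \<Longrightarrow> a = b"
  using T_X X_commute by (auto simp: permuted_family_rels_def)

lemma daha_rels_hold: "(a, b) \<in> daha_rels N h k T X Xinv Y \<Longrightarrow> a = b"
  unfolding daha_rels_def
  using sym_rels_hold hecke_rels_hold X_rels_hold X_Xinv Xinv_X commutator_Y_X_same
    commutator_Y_X_less commutator_Y_X_greater
  by (elim UnE) blast+

lemma T_cyc: "p permutes {1..N} \<Longrightarrow> i \<in> {1..N} \<Longrightarrow> T p * cyc (U i) = cyc (U (p i)) * T p"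
  unfolding cyc_def by (rule prod_list_intertwine) (simp add: T_U right_diff_distrib left_diff_distrib z_central)

lemma T_D: "p permutes {1..N} \<Longrightarrow> i \<in> {1..N} \<Longrightarrow> T p * D i = D (p i) * T p"
  by (simp add: D_def T_Xinv flip: mult.assoc) (simp add: T_cyc mult.assoc)

lemma D_commute:
  assumes ij: "i \<in> {1..N}" "j \<in> {1..N}" "i \<noteq> j"
  shows "D i * D j = D j * D i"
proof -
  define s where "s = T (transpose i j)"
  define y' where "y' = U j - k * s"
  have p: "transpose i j permutes {1..N}" using ij by (simp add: transpose_permutes)
  have ss: "s * s = 1" unfolding s_def using ij by (intro T_transpose_sq)
  have sU: "s * U i = U j * s" "s * U j = U i * s"
    using T_U[OF p ij(1)] T_U[OF p ij(2)] by (simp_all add: s_def)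
  have sX: "s * Xinv i = Xinv j * s" "s * Xinv j = Xinv i * s"
    using T_Xinv[OF p ij(1)] T_Xinv[OF p ij(2)] by (simp_all add: s_def)
  have sD: "s * D i = D j * s" "s * D j = D i * s"
    using T_D[OF p ij(1)] T_D[OF p ij(2)] by (simp_all add: s_def)
  \<comment> \<open>The correction k s in y' is chosen to compensate [U_i, U_j].\<close>
  have yy: "U i * y' = y' * U i"
    using U_commutator[OF ij]
    by (simp add: y'_def right_diff_distrib left_diff_distrib k_left mult.assoc sU s_def[symmetric])
  \<comment> \<open>Moving U_i past X_j^{-1} s turns it into y', so a product over the z_r can be
    converted factor by factor.\<close>
  have U_Xinv: "U i * (Xinv j * s) = Xinv j * s * y'"
  proof -
    have "U i * X j = X j * (U i) + k * (X i * s)" using U_X_diff[OF ij] by (simp add: s_def)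
    also have "X i * s = s * X j" using T_X[OF p ij(2)] by (simp add: s_def)
    finally have "(U i - k * s) * X j = X j * U i"
      by (simp add: left_diff_distrib mult.assoc)
    then have "U i * Xinv j = Xinv j * (U i - k * s)" by (rule Xinv_conj)
    then have "U i * (Xinv j * s) = Xinv j * ((U i - k * s) * s)" by (simp flip: mult.assoc)
    also have "(U i - k * s) * s = s * y'"
      by (simp add: y'_def left_diff_distrib right_diff_distrib mult.assoc ss sU k_left)
    finally show ?thesis by (simp add: mult.assoc)
  qed
  have cyc_Xinv: "cyc (U i) * (Xinv j * s) = Xinv j * s * cyc y'"
    unfolding cyc_def
    by (rule prod_list_intertwine[symmetric])
      (simp add: right_diff_distrib left_diff_distrib U_Xinv z_central)
  \<comment> \<open>The elements s, y' and U_i satisfy the degenerate Hecke relations of rank two.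
    Thus s commutes with y' + U_i and with y' U_i, hence with (y' - z)(U_i - z) for central
    z.\<close>
  have comm: "s * (cyc y' * cyc (U i)) = cyc y' * cyc (U i) * s"
  proof -
    have "s * U i = y' * s + k" by (simp add: y'_def left_diff_distrib mult.assoc ss sU)
    moreover have "s * y' = U i * s - k" by (simp add: y'_def right_diff_distrib k_left ss sU)
    ultimately have s': "s * ((y' - z r) * (U i - z r)) = (y' - z r) * (U i - z r) * s" for r
    proof -
      assume 1: "s * U i = y' * s + k" and 2: "s * y' = U i * s - k"
      have zl: "s * (z r * b) = z r * (s * b)" for b by (metis z_central mult.assoc)
      have gen: "s * (a - z r * b + z r * z r) = (a - z r * b + z r * z r) * s"
        if "s * a = a * s" "s * b = b * s" for a b
        using that by (simp add: distrib_left distrib_right left_diff_distrib right_diff_distrib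
            zl z_central[of s r] mult.assoc)
      have "s * (y' * U i) = (s * y') * U i" by (simp add: mult.assoc)
      also have "\<dots> = U i * (s * U i) - k * U i" by (simp add: 2 left_diff_distrib mult.assoc)
      also have "\<dots> = U i * y' * s" by (simp add: 1 distrib_left k_central mult.assoc)
      finally have 3: "s * (y' * U i) = y' * U i * s" by (simp add: yy)
      have "(y' - z r) * (U i - z r) = y' * U i - z r * (y' + U i) + z r * z r"
        by (simp add: left_diff_distrib right_diff_distrib distrib_left
            z_central[of y' r] z_central[of "U i" r])
      moreover have "s * (y' + U i) = (y' + U i) * s"
        by (simp add: distrib_left distrib_right 1 2)
      ultimately show ?thesis using gen[OF 3] by simp
    qed
    have "(U i - z s) * (y' - z r) = (y' - z r) * (U i - z s)" for r s
      by (simp add: left_diff_distrib right_diff_distrib yy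
          z_central[of y' s] z_central[of "U i" r] z_central[of "z s" r])
    then have "cyc y' * cyc (U i) = prod_list (map (\<lambda>r. (y' - z r) * (U i - z r)) [1..<l+1])"
      unfolding cyc_def by (rule prod_list_commuting_mult)
    then show ?thesis by (simp only: prod_list_intertwine[OF s'])
  qed
  have "D i * (s * D i) = Xinv i * (cyc (U i) * (Xinv j * s) * cyc (U i))"
    using sX by (simp add: D_def flip: mult.assoc)
  also have "\<dots> = Xinv i * Xinv j * (s * (cyc y' * cyc (U i)))"
    by (simp add: cyc_Xinv mult.assoc)
  finally have 1: "D i * (s * D i) = Xinv i * Xinv j * (s * (cyc y' * cyc (U i)))" .
  have ss': "s * (s * b) = b" for b by (simp add: ss flip: mult.assoc)
  have 2: "s * (Xinv i * Xinv j) = Xinv i * Xinv j * s"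
  proof -
    have "s * (Xinv i * Xinv j) = s * Xinv i * Xinv j" by (simp only: mult.assoc)
    also have "\<dots> = Xinv j * (s * Xinv j)" by (simp only: sX mult.assoc)
    also have "\<dots> = Xinv j * Xinv i * s" by (simp only: sX mult.assoc)
    finally show ?thesis by (simp only: Xinv_commute[OF ij(1,2)])
  qed
  \<comment> \<open>Since s s = 1 and s D_i = D_j s, the two sides of s (D_i s D_i) = (D_i s D_i) s
    are D_j D_i and D_i D_j.\<close>
  have "s * (D i * (s * D i)) = s * (Xinv i * Xinv j) * (s * (cyc y' * cyc (U i)))"
    unfolding 1 by (simp only: mult.assoc)
  also have "\<dots> = Xinv i * Xinv j * (s * (cyc y' * cyc (U i) * s))"
    by (simp only: 2 mult.assoc comm[unfolded mult.assoc, symmetric])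
  also have "\<dots> = D i * (s * D i) * s"
    unfolding 1 by (simp only: mult.assoc)
  finally have "s * (D i * (s * D i)) = D i * (s * D i) * s" .
  moreover have "s * (D i * (s * D i)) = s * D i * (s * D i)" by (simp only: mult.assoc)
  then have "s * (D i * (s * D i)) = D j * D i" by (simp only: sD(1) mult.assoc ss') (simp only: sD(1)[symmetric] ss')
  moreover have "D i * (s * D i) * s = D i * (D j * (s * s))" by (simp only: sD(1) mult.assoc)
  ultimately show ?thesis by (simp add: ss)
qed

text \<open>From Y_j X_1 = X_1 (Y_j + q) one gets (Y_j + q) X_1^{-1} = X_1^{-1} Y_j, and Y_j passes
  through the polynomial in U_1 = Y_1. The cases j = 1 and j > 1 differ only in q.\<close>

lemma commutator_Y_D:
  assumes "Y j * X 1 = X 1 * Y j + X 1 * q" "Y j * Y 1 = Y 1 * Y j"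
  shows "commutator (Y j) (D 1) = - q * D 1"
proof -
  have "Y j * X 1 = X 1 * (Y j + q)" using assms(1) by (simp add: distrib_left)
  from Xinv_conj[OF this] have Yi: "Y j * Xinv 1 = Xinv 1 * Y j - q * Xinv 1"
    by (simp add: distrib_right algebra_simps)
  have "Y j * U 1 = U 1 * Y j" using assms(2) by (simp only: Y_1)
  then have Yc: "Y j * cyc (U 1) = cyc (U 1) * Y j"
    unfolding cyc_def
    by (intro prod_list_intertwine) (simp add: left_diff_distrib right_diff_distrib z_central)
  have "Y j * D 1 = Y j * Xinv 1 * cyc (U 1)" by (simp only: D_def mult.assoc)
  also have "\<dots> = Xinv 1 * (Y j * cyc (U 1)) - q * (Xinv 1 * cyc (U 1))"
    by (simp only: Yi left_diff_distrib mult.assoc)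
  also have "\<dots> = D 1 * Y j - q * D 1" by (simp only: Yc D_def mult.assoc)
  finally show ?thesis by simp
qed

lemma commutator_Y_D_other:
  assumes "j \<in> {2..N}"
  shows "commutator (Y j) (D 1) = - k * T (transpose 1 j) * D 1"
proof -
  have "commutator (Y j) (D 1) = - (k * T (transpose 1 j)) * D 1"
  proof (rule commutator_Y_D)
    show "Y j * X 1 = X 1 * Y j + X 1 * (k * T (transpose 1 j))"
      using commutator_Y_X_greater[of j 1] assms
      by (simp add: k_left transpose_commute mult.assoc algebra_simps)
    show "Y j * Y 1 = Y 1 * Y j" using assms by (intro Y_commute) auto
  qed
  then show ?thesis by simp
qed

lemma Y_1_X_1:
  assumes "N \<ge> 1"
  shows "Y 1 * X 1 = X 1 * Y 1 + X 1 * (h - k * (\<Sum>j\<in>{2..N}. T (transpose 1 j)))"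
proof -
  have "{1<..N} = {2..N}" by auto
  then show ?thesis
    using commutator_Y_X_same[of 1] assms
    by (simp add: right_diff_distrib k_left h_central sum_distrib_left algebra_simps)
qed

lemma commutator_Y_D_1:
  assumes "N \<ge> 1"
  shows "commutator (Y 1) (D 1) = - h * D 1 + k * (\<Sum>i\<in>{2..N}. T (transpose 1 i) * D 1)"
  by (subst commutator_Y_D[OF Y_1_X_1[OF assms] refl])
    (simp add: left_diff_distrib sum_distrib_right mult.assoc)

text \<open>X_m is moved through the product over the z_r by \<open>leibniz_prod_list\<close>; the
  X_1 in front of the resulting error cancels against the X_1^{-1} of D_1. For m = 1 one takes q =
  J, for m > 1 q = k s_{1m}.\<close>

lemma commutator_D_X:
  assumes "N \<ge> 1" "m \<in> {1..N}" and q: "Y 1 * X m = X m * Y 1 + X 1 * q"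
    and J: "J = h - k * (\<Sum>j\<in>{2..N}. T (transpose 1 j))"
  shows "commutator (D 1) (X m) = (\<Sum>r\<in>{1..l}. prod_list (map (\<lambda>i. Y 1 - z i + J) [1..<r]) * q *
    prod_list (map (\<lambda>i. Y 1 - z i) [r+1..<l+1]))" (is "_ = ?S")
proof -
  have "cyc (Y 1) * X m = X m * cyc (Y 1) + X 1 * ?S"
    unfolding cyc_def
  proof (rule leibniz_prod_list)
    fix r
    show "(Y 1 - z r) * X 1 = X 1 * (Y 1 - z r + J)"
      using Y_1_X_1[OF assms(1)]
      by (simp add: J left_diff_distrib right_diff_distrib distrib_left z_central[of "X 1" r] z_central[of "X (Suc 0)" r])
    show "(Y 1 - z r) * X m = X m * (Y 1 - z r) + X 1 * q"
      using q by (simp add: left_diff_distrib right_diff_distrib z_central[of "X m" r])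
  qed
  then have "D 1 * X m = Xinv 1 * X m * cyc (Y 1) + Xinv 1 * X 1 * ?S"
    by (simp only: D_def Y_1[symmetric] mult.assoc distrib_left)
  also have "Xinv 1 * X m = X m * Xinv 1"
    using assms by (intro X_Xinv_commute[symmetric]) auto
  finally show ?thesis by (simp only: D_def Y_1[symmetric] mult.assoc Xinv_X) simp
qed

lemma cyclotomic_rels_hold:
  assumes "N \<ge> 1" "(a, b) \<in> cyclotomic_rels N l h k z T Y X D"
  shows "a = b"
proof -
  have 1: "1 \<in> {1..N}" using assms(1) by simp
  have D_rels: "a = b" if "(a, b) \<in> permuted_family_rels N T D" for a b
  proof -
    have "D i * D j = D j * D i" if "i \<in> {1..N}" "j \<in> {1..N}" for i j
      using D_commute[OF that] by (cases "i = j") auto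
    then show ?thesis using that T_D by (auto simp: permuted_family_rels_def)
  qed
  have X_other: "commutator (Y i) (X 1) = k * X 1 * T (transpose 1 i)" if "i \<in> {2..N}" for i
    using commutator_Y_X_greater[of i 1] that by (simp add: transpose_commute)
  have X_1: "commutator (Y 1) (X 1) = h * X 1 - k * (\<Sum>i\<in>{2..N}. X 1 * T (transpose 1 i))"
  proof -
    have "{1<..N} = {2..N}" by auto
    then show ?thesis using commutator_Y_X_same[OF 1] by simp
  qed
  define J where "J = h - k * (\<Sum>j\<in>{2..N}. T (transpose 1 j))"
  let ?A = "\<lambda>r. prod_list (map (\<lambda>i. Y 1 - z i + J) [1..<r])"
  let ?B = "\<lambda>r. prod_list (map (\<lambda>i. Y 1 - z i) [r+1..<l+1])"
  have DX_1: "commutator (D 1) (X 1) = (\<Sum>r\<in>{1..l}. ?A r * J * ?B r)"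
    by (rule commutator_D_X[OF assms(1) 1 _ J_def]) (unfold J_def, rule Y_1_X_1[OF assms(1)])
  have DX: "commutator (D 1) (X m) = k * (\<Sum>r\<in>{1..l}. ?A r * T (transpose 1 m) * ?B r)"
    if m: "m \<in> {2..N}" for m
  proof -
    have "commutator (D 1) (X m) = (\<Sum>r\<in>{1..l}. ?A r * (k * T (transpose 1 m)) * ?B r)"
    proof (rule commutator_D_X[OF assms(1) _ _ J_def])
      show "Y 1 * X m = X m * Y 1 + X 1 * (k * T (transpose 1 m))"
        using commutator_Y_X_less[of 1 m] m by (simp add: k_left mult.assoc algebra_simps)
    qed (use m in auto)
    then show ?thesis by (simp add: k_left mult.assoc sum_distrib_left)
  qed
  have XD: "X 1 * D 1 = prod_list (map (\<lambda>i. Y 1 - z i) [1..<l+1])"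
    unfolding D_def Y_1[symmetric] mult.assoc[symmetric] X_Xinv cyc_def by simp
  show ?thesis
    using assms(2) sym_rels_hold hecke_rels_hold X_rels_hold D_rels X_other X_1 commutator_Y_D_other
      commutator_Y_D_1[OF assms(1)] DX_1 DX XD
    unfolding cyclotomic_rels_def Let_def J_def[symmetric]
    by (elim UnE) blast+
qed

end

section \<open>Leading terms of operators for the degree in lambda\<close>

section \<open>Symbols\<close>

definition lam_deg :: "nat \<Rightarrow> basis \<Rightarrow> nat"
  where "lam_deg N m = (\<Sum>i\<in>{1..N}. fst (snd m) i)"

definition low :: "nat \<Rightarrow> nat \<Rightarrow> (basis \<Rightarrow>\<^sub>0 'k::comm_ring_1) \<Rightarrow> bool"
  where "low N n f \<longleftrightarrow> (\<forall>m\<in>Poly_Mapping.keys f. lam_deg N m < n)"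

lemma low_0 [simp]: "low N n 0"
  by (simp add: low_def)

lemma low_add: "low N n f \<Longrightarrow> low N n g \<Longrightarrow> low N n (f + g)"
  using Poly_Mapping.keys_add[of f g] by (auto simp: low_def)

lemma low_uminus: "low N n f \<Longrightarrow> low N n (- f)"
  by (simp add: low_def in_keys_iff)

lemma low_scale: "low N n f \<Longrightarrow> low N n (vec_scale c f)"
  using keys_vec_scale[of c f] by (auto simp: low_def)

lemma low_sum: "(\<And>i. i \<in> I \<Longrightarrow> low N n (f i)) \<Longrightarrow> low N n (\<Sum>i\<in>I. f i)"
  by (induct I rule: infinite_finite_induct) (auto intro: low_add)

lemma low_single: "lam_deg N m < n \<Longrightarrow> low N n (Poly_Mapping.single m c)"
  by (auto simp: low_def)

lemma low_mono: "low N n f \<Longrightarrow> n \<le> n' \<Longrightarrow> low N n' f"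
  by (auto simp: low_def)

lemma app_expand:
  "app A f = (\<Sum>m\<in>Poly_Mapping.keys f. vec_scale (Poly_Mapping.lookup f m) (app A (Poly_Mapping.single m 1)))"
  using app_sum[of A "\<lambda>m. vec_scale (Poly_Mapping.lookup f m) (Poly_Mapping.single m 1)" "Poly_Mapping.keys f"]
  by (simp only: vec_expand app_scale)

text \<open>The bound is strict: order at most d is \<open>lower_order N A (Suc d)\<close>, and an
  operator that does not raise the lambda degree has \<open>Suc 0\<close>.\<close>

definition lower_order :: "nat \<Rightarrow> (basis, 'k::comm_ring_1) endo \<Rightarrow> nat \<Rightarrow> bool"
  where "lower_order N A d \<longleftrightarrow> (\<forall>m. low N (lam_deg N m + d) (app A (Poly_Mapping.single m 1)))"

text \<open>The leading term on a basis vector must be a basis vector with coefficient 1, so that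
  symbols are maps of indices and compose under products.\<close>

definition has_symbol :: "nat \<Rightarrow> (basis, 'k::comm_ring_1) endo \<Rightarrow> (basis \<Rightarrow> basis) \<Rightarrow> nat \<Rightarrow> bool"
  where "has_symbol N A \<phi> d \<longleftrightarrow> (\<forall>m. lam_deg N (\<phi> m) = lam_deg N m + d \<and>
    low N (lam_deg N m + d) (app A (Poly_Mapping.single m 1) - Poly_Mapping.single (\<phi> m) 1))"

lemma lower_orderD: "lower_order N A d \<Longrightarrow> low N (lam_deg N m + d) (app A (Poly_Mapping.single m 1))"
  unfolding lower_order_def by (erule allE)

lemma has_symbolD:
  assumes "has_symbol N A \<phi> d"
  shows "lam_deg N (\<phi> m) = lam_deg N m + d"
    and "low N (lam_deg N m + d) (app A (Poly_Mapping.single m 1) - Poly_Mapping.single (\<phi> m) 1)"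
  using assms unfolding has_symbol_def by (metis)+

lemma lower_order_app:
  assumes "lower_order N A (Suc d)" "low N n f"
  shows "low N (n + d) (app A f)"
proof -
  have "low N (n + d) (app A (Poly_Mapping.single m 1))" if "m \<in> Poly_Mapping.keys f" for m
  proof (rule low_mono)
    show "low N (lam_deg N m + Suc d) (app A (Poly_Mapping.single m 1))"
      using assms(1) by (simp only: lower_order_def)
    have "lam_deg N m < n" using assms(2) that by (simp only: low_def)
    then show "lam_deg N m + Suc d \<le> n + d" by simp
  qed
  then show ?thesis
    unfolding app_expand[of A f] by (auto intro!: low_sum low_scale)
qed

lemma lower_order_sum: "(\<And>i. i \<in> I \<Longrightarrow> lower_order N (A i) d) \<Longrightarrow> lower_order N (\<Sum>i\<in>I. A i) d"
  unfolding lower_order_def app_sum_endo by (intro allI low_sum) blast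

lemma lower_order_scalar: "lower_order N (scalar_op c) (Suc 0)"
  by (auto simp: lower_order_def scalar_op.rep_eq intro: low_single)

text \<open>Order at most d times order below e is order below d + e, whence \<open>Suc\<close> on
  one factor only.\<close>

lemma lower_order_mult:
  assumes "lower_order N A (Suc d)" "lower_order N B e"
  shows "lower_order N (A * B) (d + e)"
  unfolding lower_order_def
proof
  fix m
  have "low N (lam_deg N m + e + d) (app A (app B (Poly_Mapping.single m 1)))"
    by (rule lower_order_app[OF assms(1)]) (rule lower_orderD[OF assms(2)])
  then show "low N (lam_deg N m + (d + e)) (app (A * B) (Poly_Mapping.single m 1))"
    by (simp add: app_simps ac_simps)
qed

lemma has_symbol_lower:
  assumes "has_symbol N A \<phi> d"
  shows "lower_order N A (Suc d)"
  unfolding lower_order_def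
proof
  fix m
  have "low N (lam_deg N m + Suc d) (app A (Poly_Mapping.single m 1) - Poly_Mapping.single (\<phi> m) 1)"
    using has_symbolD(2)[OF assms] by (rule low_mono) simp
  moreover have "low N (lam_deg N m + Suc d) (Poly_Mapping.single (\<phi> m) (1::'a))"
    using has_symbolD(1)[OF assms, of m] by (intro low_single) simp
  ultimately show "low N (lam_deg N m + Suc d) (app A (Poly_Mapping.single m 1))"
    using low_add by fastforce
qed

lemma has_symbol_add_lower:
  assumes "has_symbol N A \<phi> d" "lower_order N B d"
  shows "has_symbol N (A + B) \<phi> d"
  unfolding has_symbol_def
proof (intro allI conjI)
  fix m
  show "lam_deg N (\<phi> m) = lam_deg N m + d" by (rule has_symbolD(1)[OF assms(1)])
  from low_add[OF has_symbolD(2)[OF assms(1)] lower_orderD[OF assms(2)], of m]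
  show "low N (lam_deg N m + d) (app (A + B) (Poly_Mapping.single m 1) - Poly_Mapping.single (\<phi> m) 1)"
    by (simp add: app_simps algebra_simps)
qed

lemma has_symbol_diff_lower:
  assumes "has_symbol N A \<phi> d" "lower_order N B d"
  shows "has_symbol N (A - B) \<phi> d"
proof -
  have "lower_order N (- B) d"
    unfolding lower_order_def by (simp only: app_simps low_uminus[OF lower_orderD[OF assms(2)]] simp_thms)
  from has_symbol_add_lower[OF assms(1) this] show ?thesis by simp
qed

lemma has_symbol_mult:
  assumes A: "has_symbol N A \<phi> d" and B: "has_symbol N B \<psi> e"
  shows "has_symbol N (A * B) (\<phi> \<circ> \<psi>) (d + e)"
  unfolding has_symbol_def
proof (intro allI conjI)
  fix m
  let ?b = "app B (Poly_Mapping.single m 1) - Poly_Mapping.single (\<psi> m) 1"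
  show deg: "lam_deg N ((\<phi> \<circ> \<psi>) m) = lam_deg N m + (d + e)"
    by (simp add: has_symbolD(1)[OF A] has_symbolD(1)[OF B])
  have "low N (lam_deg N m + e + d) (app A ?b)"
    by (rule lower_order_app[OF has_symbol_lower[OF A] has_symbolD(2)[OF B]])
  moreover have "low N (lam_deg N m + e + d)
      (app A (Poly_Mapping.single (\<psi> m) 1) - Poly_Mapping.single (\<phi> (\<psi> m)) 1)"
    using has_symbolD(2)[OF A, of "\<psi> m"] by (simp only: has_symbolD(1)[OF B])
  ultimately have "low N (lam_deg N m + e + d)
      (app A ?b + (app A (Poly_Mapping.single (\<psi> m) 1) - Poly_Mapping.single (\<phi> (\<psi> m)) 1))"
    by (rule low_add)
  then show "low N (lam_deg N m + (d + e))
      (app (A * B) (Poly_Mapping.single m 1) - Poly_Mapping.single ((\<phi> \<circ> \<psi>) m) 1)"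
    by (simp add: app_simps app_diff ac_simps)
qed

lemma has_symbol_1: "has_symbol N 1 id 0"
  by (simp add: has_symbol_def app_simps)

lemma has_symbol_perm_op:
  assumes "\<And>m. lam_deg N (\<phi> m) = lam_deg N m + d"
  shows "has_symbol N (perm_op \<phi>) \<phi> d"
  using assms by (simp add: has_symbol_def)

text \<open>A simultaneous shift in x_i and lambda_i, the form of the leading terms of U_i and
  D_i.\<close>

definition shift :: "int \<Rightarrow> nat \<Rightarrow> nat \<Rightarrow> basis \<Rightarrow> basis"
  where "shift e n i = (\<lambda>(a, b, w). (a(i := a i + e), b(i := b i + n), w))"

lemma shift_comp: "shift e n i \<circ> shift e' n' i = shift (e + e') (n + n') i"
  by (auto simp: fun_eq_iff shift_def)

lemma shift_eqs: "shift_x e i = shift e 0 i" "shift_lam n i = shift 0 n i"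
  by (auto simp: fun_eq_iff shift_def shift_x_def shift_lam_def)

lemma lam_deg_shift: "i \<in> {1..N} \<Longrightarrow> lam_deg N (shift e n i m) = lam_deg N m + n"
proof (cases m)
  case (fields a b w)
  assume "i \<in> {1..N}"
  then have "(\<Sum>j\<in>{1..N}. (b(i := b i + n)) j) = (\<Sum>j\<in>{1..N}. b j + (if j = i then n else 0))"
    by (intro sum.cong) auto
  then show ?thesis
    using \<open>i \<in> {1..N}\<close> fields by (simp add: lam_deg_def shift_def sum.distrib sum.delta)
qed

lemma lam_deg_act: "p permutes {1..N} \<Longrightarrow> lam_deg N (act p m) = lam_deg N m"
proof (cases m)
  case (fields a b w)
  assume "p permutes {1..N}"
  then have "inv_into UNIV p permutes {1..N}" by (rule permutes_inv)
  from sum.permute[OF this, of b] show ?thesis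
    by (simp add: fields lam_deg_def act_def)
qed

text \<open>By the second clause of its definition a divided difference changes lambda and w only by
  a permutation, so it keeps the lambda degree.\<close>

lemma lower_order_divided_difference:
  assumes "i \<in> {1..N}" "j \<in> {1..N}" "i \<noteq> j"
  shows "lower_order N (divided_difference i j) (Suc 0)"
  unfolding lower_order_def low_def
proof (intro allI ballI)
  fix m m' assume "m' \<in> Poly_Mapping.keys (app (divided_difference i j) (Poly_Mapping.single m (1::'a)))"
  then have "lam_deg N m' = lam_deg N (act (transpose i j) m)"
    using divided_difference_single(2)[OF assms(3), of m, where 'k='a] by (simp add: lam_deg_def)
  then show "lam_deg N m' < lam_deg N m + Suc 0"
    using assms by (simp add: lam_deg_act transpose_permutes)
qed

lemma has_symbol_X: "i \<in> {1..N} \<Longrightarrow> has_symbol N (X_op i) (shift 1 0 i) 0"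
  unfolding X_op_def shift_eqs by (rule has_symbol_perm_op) (simp add: lam_deg_shift)

lemma has_symbol_Xinv: "i \<in> {1..N} \<Longrightarrow> has_symbol N (Xinv_op i) (shift (- 1) 0 i) 0"
  unfolding Xinv_op_def shift_eqs by (rule has_symbol_perm_op) (simp add: lam_deg_shift)

lemma has_symbol_T: "p permutes {1..N} \<Longrightarrow> has_symbol N (T_op p) (act p) 0"
  unfolding T_op_def by (rule has_symbol_perm_op) (simp add: lam_deg_act)

text \<open>Only lambda_i raises the lambda degree; the derivative and the divided differences
  preserve it.\<close>

lemma has_symbol_dunkl:
  assumes i: "i \<in> {1..N}"
  shows "has_symbol N (dunkl_op N h k i) (shift 0 1 i) 1"
  unfolding dunkl_op_def
proof (intro has_symbol_add_lower has_symbol_diff_lower)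
  show "has_symbol N (Lam_op i) (shift 0 1 i) 1"
    unfolding Lam_op_def shift_eqs by (rule has_symbol_perm_op) (use i in \<open>simp add: lam_deg_shift\<close>)
  have scale: "lower_order N (scalar_op c * A) 1" if "lower_order N A 1" for c and A :: "(basis, 'a) endo"
    using lower_order_mult[OF lower_order_scalar that] by simp
  have "lower_order N (Euler_op i) 1"
    by (auto simp: lower_order_def Euler_op_def intro: low_single)
  then show "lower_order N (scalar_op h * (Xinv_op i * Euler_op i)) 1"
    using lower_order_mult[OF has_symbol_lower[OF has_symbol_Xinv[OF i]]] by (intro scale) simp
  show "lower_order N (scalar_op k * (\<Sum>r\<in>{1..N} - {i}. divided_difference i r)) 1"
    by (intro scale lower_order_sum) (use i lower_order_divided_difference[of i N] in auto)
qed

locale cherednik_rep =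
  fixes N :: nat and h k :: "'k::comm_ring_1" and z :: "nat \<Rightarrow> 'k" and l :: nat
begin

sublocale cherednik N "scalar_op h" "scalar_op k" T_op X_op "dunkl_op N h k" Xinv_op
  "\<lambda>r. scalar_op (z r)" l
proof (intro cherednik.intro rational_cherednik_dunkl cherednik_axioms.intro)
qed (auto simp: dunkl_op_commute X_op_inverse scalar_op_commute)

lemma has_symbol_U:
  assumes "i \<in> {1..N}"
  shows "has_symbol N (U i) (shift 1 1 i) 1"
  using has_symbol_mult[OF has_symbol_X has_symbol_dunkl, OF assms assms, of h k]
  by (simp add: U_def shift_comp)

lemma has_symbol_Y:
  assumes i: "i \<in> {1..N}"
  shows "has_symbol N (Y i) (shift 1 1 i) 1"
  unfolding Y_def
proof (rule has_symbol_diff_lower[OF has_symbol_U[OF i]])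
  have "lower_order N (T_op (transpose i r) :: (basis, 'k) endo) 1" if "r \<in> {1..<i}" for r
    using has_symbol_lower[OF has_symbol_T[OF transpose_permutes, of i N r]] that i by simp
  then show "lower_order N (scalar_op k * JM i) 1"
    unfolding JM_def using lower_order_mult[OF lower_order_scalar lower_order_sum] by (metis (no_types, lifting) add_0)
qed

lemma has_symbol_prod_list:
  assumes "\<And>r. has_symbol N (A r) (shift e n i) d"
  shows "has_symbol N (prod_list (map A rs)) (shift (int (length rs) * e) (length rs * n) i) (length rs * d)"
proof (induction rs)
  case Nil
  have "shift 0 0 i = id" by (auto simp: fun_eq_iff shift_def)
  with has_symbol_1[of N] show ?case by (simp add: id_def)
next
  case (Cons r rs)
  from has_symbol_mult[OF assms[of r] this] show ?case by (simp add: shift_comp algebra_simps)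
qed

text \<open>Each of the l factors contributes x_i lambda_i, and X_i^{-1} removes one x_i. The
  exponent l - 1 is an integer, negative for l = 0.\<close>

lemma has_symbol_D:
  assumes i: "i \<in> {1..N}"
  shows "has_symbol N (D i) (shift (int l - 1) l i) l"
proof -
  have "has_symbol N (U i - scalar_op (z r)) (shift 1 1 i) 1" for r
    using lower_order_scalar by (intro has_symbol_diff_lower has_symbol_U i) simp
  then have "has_symbol N (D i) (shift (- 1) 0 i \<circ>
      shift (int (length [1..<l+1]) * 1) (length [1..<l+1] * 1) i) (0 + length [1..<l+1] * 1)"
    unfolding D_def cyc_def by (intro has_symbol_mult has_symbol_Xinv i has_symbol_prod_list)
  then show ?thesis unfolding shift_comp length_upt by simp
qed

end

section \<open>Free algebras over a subring of scalars: evaluation, carriers and ideals\<close>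

section \<open>Free algebras\<close>

lemma pm_expand: "(\<Sum>w\<in>Poly_Mapping.keys f. Poly_Mapping.single w (Poly_Mapping.lookup f w)) = f"
  by (rule poly_mapping_eqI)
    (auto simp: lookup_sum lookup_single when_def in_keys_iff sum.delta')

lemma mult_expand:
  fixes f g :: "'m::monoid_add \<Rightarrow>\<^sub>0 'k::ring_1"
  shows "f * g = (\<Sum>u\<in>Poly_Mapping.keys f. \<Sum>v\<in>Poly_Mapping.keys g.
    Poly_Mapping.single (u + v) (Poly_Mapping.lookup f u * Poly_Mapping.lookup g v))"
proof -
  have "f * g = (\<Sum>u\<in>Poly_Mapping.keys f. Poly_Mapping.single u (Poly_Mapping.lookup f u))
      * (\<Sum>v\<in>Poly_Mapping.keys g. Poly_Mapping.single v (Poly_Mapping.lookup g v))"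
    by (simp only: pm_expand)
  then show ?thesis by (simp only: sum_product mult_single)
qed

lemma single_Cons: "Poly_Mapping.single (g # w) 1 = free_gen g * Poly_Mapping.single w (1 :: 'k::comm_ring_1)"
  by (simp add: free_gen_def mult_single plus_list_def)

lemma single_append: "Poly_Mapping.single (u @ w) 1 = Poly_Mapping.single u 1 * Poly_Mapping.single w (1 :: 'k::comm_ring_1)"
  by (simp add: mult_single plus_list_def)

lemma single_Nil_one [simp]: "Poly_Mapping.single [] (1 :: 'k::comm_ring_1) = 1"
  by (metis single_one zero_list_def)

lemma free_const_mult_single: "free_const c * Poly_Mapping.single w a = Poly_Mapping.single w (c * a)"
  by (simp add: free_const_def mult_single plus_list_def)

lemma free_const_commute: "free_const c * f = f * free_const (c :: 'k::comm_ring_1)"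
proof -
  have "free_const c * (\<Sum>w\<in>Poly_Mapping.keys f. Poly_Mapping.single w (Poly_Mapping.lookup f w))
      = (\<Sum>w\<in>Poly_Mapping.keys f. Poly_Mapping.single w (Poly_Mapping.lookup f w)) * free_const c"
    by (simp add: sum_distrib_left sum_distrib_right free_const_def mult_single plus_list_def mult.commute)
  then show ?thesis by (simp only: pm_expand)
qed

lemma free_const_simps:
  "free_const (c + d) = free_const c + free_const d" "free_const (c * d) = free_const c * free_const d"
  "free_const 1 = 1"
  by (simp_all add: free_const_def single_add mult_single plus_list_def)

text \<open>The universal property of the free algebra: letters go to arbitrary elements, scalars
  through a central map. It serves for operators, for substitutions and for the expansion in
  monomials of z.\<close>

locale alg_hom =
  fixes c :: "'k::comm_ring_1 \<Rightarrow> 'a::ring_1" and g :: "'g \<Rightarrow> 'a"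
  assumes c_add: "c (x + y) = c x + c y" and c_mult: "c (x * y) = c x * c y" and c_1: "c 1 = 1"
    and c_central: "c x * a = a * c x"
begin

definition ev :: "('g list \<Rightarrow>\<^sub>0 'k) \<Rightarrow> 'a"
  where "ev f = (\<Sum>w\<in>Poly_Mapping.keys f. c (Poly_Mapping.lookup f w) * prod_list (map g w))"

lemma c_0: "c 0 = 0"
  using c_add[of 0 0] by simp

lemma ev_superset:
  assumes "finite A" "Poly_Mapping.keys f \<subseteq> A"
  shows "ev f = (\<Sum>w\<in>A. c (Poly_Mapping.lookup f w) * prod_list (map g w))"
  unfolding ev_def by (rule sum.mono_neutral_left) (use assms in \<open>auto simp: in_keys_iff c_0\<close>)

lemma ev_add: "ev (x + y) = ev x + ev y"
proof -
  let ?A = "Poly_Mapping.keys x \<union> Poly_Mapping.keys y"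
  have "ev f = (\<Sum>w\<in>?A. c (Poly_Mapping.lookup f w) * prod_list (map g w))" if "f \<in> {x, y, x + y}" for f
    by (rule ev_superset) (use that Poly_Mapping.keys_add[of x y] in auto)
  then show ?thesis by (simp add: lookup_add c_add distrib_right sum.distrib)
qed

lemma ev_0 [simp]: "ev 0 = 0"
  by (simp add: ev_def)

lemma ev_uminus: "ev (- x) = - ev x"
  using ev_add[of x "- x"] by (simp add: eq_neg_iff_add_eq_0 add.commute)

lemma ev_diff: "ev (x - y) = ev x - ev y"
  using ev_add[of x "- y"] by (simp add: ev_uminus)

lemma ev_sum: "ev (\<Sum>i\<in>I. f i) = (\<Sum>i\<in>I. ev (f i))"
  by (induct I rule: infinite_finite_induct) (auto simp: ev_add)

lemma ev_single: "ev (Poly_Mapping.single w x) = c x * prod_list (map g w)"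
  by (cases "x = 0") (auto simp: ev_def c_0)

lemma ev_mult: "ev (x * y) = ev x * ev y"
proof -
  have "ev (x * y) = (\<Sum>u\<in>Poly_Mapping.keys x. \<Sum>v\<in>Poly_Mapping.keys y.
    c (Poly_Mapping.lookup x u) * prod_list (map g u) * (c (Poly_Mapping.lookup y v) * prod_list (map g v)))"
    unfolding mult_expand[of x y] ev_sum ev_single
    by (intro sum.cong refl)
      (simp add: plus_list_def c_mult, metis c_central mult.assoc)
  then show ?thesis by (simp only: ev_def sum_product)
qed

lemma ev_const: "ev (free_const x) = c x"
  by (simp add: free_const_def ev_single)

lemma ev_gen: "ev (free_gen a) = g a"
  by (simp add: free_gen_def ev_single c_1)

lemma ev_1: "ev 1 = 1"
  using ev_const[of 1] by (simp add: free_const_simps c_1)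

lemma ev_prod_list: "ev (prod_list (map f rs)) = prod_list (map (\<lambda>r. ev (f r)) rs)"
  by (induct rs) (simp_all add: ev_1 ev_mult)

end

text \<open>K is a subring of the type of scalars because \<open>coeffs_z l\<close> admits only z_1,
  ..., z_l, while the type has a variable for every natural number.\<close>

locale free_alg =
  fixes K :: "'k::comm_ring_1 set" and G :: "'g set"
  assumes K_0: "0 \<in> K" and K_1: "1 \<in> K" and K_add: "x \<in> K \<Longrightarrow> y \<in> K \<Longrightarrow> x + y \<in> K"
    and K_mult: "x \<in> K \<Longrightarrow> y \<in> K \<Longrightarrow> x * y \<in> K" and K_uminus: "x \<in> K \<Longrightarrow> - x \<in> K"
begin

abbreviation F where "F \<equiv> free_algebra K G"
abbreviation C where "C \<equiv> carrier F"

lemma C_iff: "f \<in> C \<longleftrightarrow> (\<forall>w \<in> Poly_Mapping.keys f. set w \<subseteq> G) \<and> (\<forall>w. Poly_Mapping.lookup f w \<in> K)"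
  by (simp add: free_algebra_def)

lemma C_ops [simp]: "mult F = (*)" "one F = 1" "zero F = 0" "add F = (+)"
  by (simp_all add: free_algebra_def)

lemma C_0: "0 \<in> C"
  by (simp add: C_iff K_0)

lemma C_add: "x \<in> C \<Longrightarrow> y \<in> C \<Longrightarrow> x + y \<in> C"
  using Poly_Mapping.keys_add[of x y] unfolding C_iff lookup_add by (meson K_add UnE subsetD)

lemma C_uminus: "x \<in> C \<Longrightarrow> - x \<in> C"
  by (auto simp: C_iff K_uminus in_keys_iff)

lemma C_diff: "x \<in> C \<Longrightarrow> y \<in> C \<Longrightarrow> x - y \<in> C"
  using C_add[of x "- y"] C_uminus by simp

lemma C_sum: "(\<And>i. i \<in> I \<Longrightarrow> f i \<in> C) \<Longrightarrow> (\<Sum>i\<in>I. f i) \<in> C"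
  by (induct I rule: infinite_finite_induct) (auto intro: C_0 C_add)

lemma C_single: "set w \<subseteq> G \<Longrightarrow> c \<in> K \<Longrightarrow> Poly_Mapping.single w c \<in> C"
  by (auto simp: C_iff lookup_single when_def K_0)

lemma C_gen: "g \<in> G \<Longrightarrow> free_gen g \<in> C"
  by (simp add: free_gen_def C_single K_1)

lemma C_const: "c \<in> K \<Longrightarrow> free_const c \<in> C"
  by (simp add: free_const_def C_single)

lemma C_1: "1 \<in> C"
  using C_const[OF K_1] by (simp add: free_const_simps)

lemma C_mult: "x \<in> C \<Longrightarrow> y \<in> C \<Longrightarrow> x * y \<in> C"
  unfolding mult_expand[of x y]
  by (intro C_sum C_single) (simp_all add: plus_list_def C_iff K_mult)

lemma C_prod_list: "(\<And>x. x \<in> set xs \<Longrightarrow> x \<in> C) \<Longrightarrow> prod_list xs \<in> C"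
  by (induct xs) (auto intro: C_1 C_mult)

lemma ring_F: "ring F"
proof (rule ringI)
  show "abelian_group F"
  proof (rule abelian_groupI)
    fix x assume "x \<in> C"
    then show "\<exists>y\<in>C. y \<oplus>\<^bsub>F\<^esub> x = \<zero>\<^bsub>F\<^esub>" by (intro bexI[of _ "- x"]) (auto intro: C_uminus)
  qed (auto intro: C_add C_0 simp: add.assoc add.commute)
  show "Group.monoid F" by (rule monoidI) (auto intro: C_mult C_1 simp: mult.assoc)
qed (auto simp: distrib_left distrib_right)

lemma F_a_inv:
  assumes "x \<in> C"
  shows "\<ominus>\<^bsub>F\<^esub> x = - x"
proof -
  interpret ring F by (rule ring_F)
  show ?thesis using minus_equality[of "- x" x] assms C_uminus by simp
qed

end

locale free_alg_ideal = free_alg K G for K :: "'k::comm_ring_1 set" and G :: "'g set" +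
  fixes I :: "('g list \<Rightarrow>\<^sub>0 'k) set"
  assumes ideal_I: "ideal I (free_algebra K G)"
begin

lemma I_C: "x \<in> I \<Longrightarrow> x \<in> C"
  using ideal.Icarr[OF ideal_I] by simp

lemma I_0: "0 \<in> I"
  using additive_subgroup.zero_closed[OF ideal.axioms(1)[OF ideal_I]] by simp

lemma I_add: "x \<in> I \<Longrightarrow> y \<in> I \<Longrightarrow> x + y \<in> I"
  using additive_subgroup.a_closed[OF ideal.axioms(1)[OF ideal_I]] by simp

lemma I_lmult: "x \<in> C \<Longrightarrow> y \<in> I \<Longrightarrow> x * y \<in> I"
  using ideal.I_l_closed[OF ideal_I] by simp

lemma I_rmult: "x \<in> C \<Longrightarrow> y \<in> I \<Longrightarrow> y * x \<in> I"
  using ideal.I_r_closed[OF ideal_I] by simp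

lemma I_uminus: "x \<in> I \<Longrightarrow> - x \<in> I"
  using I_lmult[of "- 1" x] C_uminus[OF C_1] by simp

lemma I_diff: "x \<in> I \<Longrightarrow> y \<in> I \<Longrightarrow> x - y \<in> I"
  using I_add[of x "- y"] I_uminus by simp

lemma I_sum: "(\<And>i. i \<in> A \<Longrightarrow> f i \<in> I) \<Longrightarrow> (\<Sum>i\<in>A. f i) \<in> I"
  by (induct A rule: infinite_finite_induct) (auto intro: I_0 I_add)

end

section \<open>The weight filtration modulo an ideal\<close>

section \<open>Filtered words\<close>

locale weighted_words = free_alg_ideal K G I
  for K :: "'k::comm_ring_1 set" and G :: "'g set" and I +
  fixes wt :: "'g \<Rightarrow> nat"
begin

definition weight :: "'g list \<Rightarrow> nat" where "weight w = sum_list (map wt w)"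

lemma weight_simps [simp]: "weight [] = 0" "weight (x # w) = wt x + weight w" "weight (u @ w) = weight u + weight w"
  by (simp_all add: weight_def)

definition below :: "nat \<Rightarrow> ('g list \<Rightarrow>\<^sub>0 'k) set"
  where "below n = {f \<in> C. \<forall>w\<in>Poly_Mapping.keys f. weight w < n}"

text \<open>The filtration of the quotient by I, pulled back to the free algebra. With the strict
  bound \<open>filt 0\<close> is I itself, where the descent in \<open>ev_kernel\<close>
  ends.\<close>

definition filt :: "nat \<Rightarrow> ('g list \<Rightarrow>\<^sub>0 'k) set"
  where "filt n = {f. \<exists>g\<in>below n. f - g \<in> I}"

lemma filtI: "g \<in> below n \<Longrightarrow> f - g \<in> I \<Longrightarrow> f \<in> filt n"
  unfolding filt_def by blast

lemma below_C: "f \<in> below n \<Longrightarrow> f \<in> C"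
  by (simp add: below_def)

lemma below_0: "0 \<in> below n"
  by (simp add: below_def C_0)

lemma below_add: "f \<in> below n \<Longrightarrow> g \<in> below n \<Longrightarrow> f + g \<in> below n"
  using Poly_Mapping.keys_add[of f g] by (auto simp: below_def C_add)

lemma below_uminus: "f \<in> below n \<Longrightarrow> - f \<in> below n"
  by (auto simp: below_def C_uminus in_keys_iff)

lemma below_diff: "f \<in> below n \<Longrightarrow> g \<in> below n \<Longrightarrow> f - g \<in> below n"
  using below_add[of f n "- g"] below_uminus by simp

lemma below_sum: "(\<And>i. i \<in> A \<Longrightarrow> f i \<in> below n) \<Longrightarrow> (\<Sum>i\<in>A. f i) \<in> below n"
  by (induct A rule: infinite_finite_induct) (auto intro: below_0 below_add)

lemma below_mono: "f \<in> below n \<Longrightarrow> n \<le> n' \<Longrightarrow> f \<in> below n'"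
  by (auto simp: below_def)

lemma below_single: "set w \<subseteq> G \<Longrightarrow> c \<in> K \<Longrightarrow> weight w < n \<Longrightarrow> Poly_Mapping.single w c \<in> below n"
  by (auto simp: below_def C_single)

text \<open>Both bounds are strict, so the weight of a product stays at least two below a + b; hence
  \<open>Suc n\<close>.\<close>

lemma below_mult:
  assumes "f \<in> below a" "g \<in> below b" "a + b \<le> Suc n"
  shows "f * g \<in> below n"
  unfolding mult_expand[of f g]
proof (intro below_sum below_single)
  fix u v assume uv: "u \<in> Poly_Mapping.keys f" "v \<in> Poly_Mapping.keys g"
  then show "set (u + v) \<subseteq> G" using assms by (simp add: below_def C_iff plus_list_def)
  show "Poly_Mapping.lookup f u * Poly_Mapping.lookup g v \<in> K"
    using assms by (auto simp: below_def C_iff intro: K_mult)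
  have "weight u < a" "weight v < b" using uv assms by (auto simp: below_def)
  then show "weight (u + v) < n" using assms(3) by (simp add: plus_list_def)
qed

lemma below_const: "c \<in> K \<Longrightarrow> free_const c \<in> below (Suc n)"
  by (simp add: free_const_def below_single)

lemma below_gen: "g \<in> G \<Longrightarrow> wt g < n \<Longrightarrow> free_gen g \<in> below n"
  by (simp add: free_gen_def below_single K_1)

lemma below_prod_list:
  "(\<And>i. i \<in> set xs \<Longrightarrow> f i \<in> below 2) \<Longrightarrow> prod_list (map f xs) \<in> below (Suc (length xs))"
proof (induction xs)
  case Nil
  then show ?case using below_const[OF K_1, of 0] by (simp add: free_const_simps)
next
  case (Cons x xs)
  then show ?case using below_mult[of "f x" 2 "prod_list (map f xs)" "Suc (length xs)"] by simp
qed

lemma filt_I: "f \<in> below n \<Longrightarrow> f - g \<in> I \<Longrightarrow> g \<in> filt n"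
  unfolding filt_def by (rule CollectI, rule bexI[of _ f]) (use I_uminus[of "f - g"] in auto)

lemma below_filt: "f \<in> below n \<Longrightarrow> f \<in> filt n"
  by (rule filt_I) (auto simp: I_0)

lemma I_filt: "f \<in> I \<Longrightarrow> f \<in> filt n"
  by (rule filt_I[OF below_0]) (simp add: I_uminus)

lemma filt_zero_iff: "f \<in> filt 0 \<longleftrightarrow> f \<in> I"
proof -
  have "g = 0" if "g \<in> below 0" for g using that by (simp add: below_def)
  then show ?thesis by (auto simp: filt_def intro: I_filt[unfolded filt_def, of _ 0, simplified])
      (use below_0 in force)
qed

lemma filt_add:
  assumes "f \<in> filt n" "g \<in> filt n"
  shows "f + g \<in> filt n"
proof -
  obtain f' g' where "f' \<in> below n" "g' \<in> below n" and I: "f - f' \<in> I" "g - g' \<in> I"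
    using assms by (auto simp: filt_def)
  moreover have "f + g - (f' + g') \<in> I" using I_add[OF I] by (simp add: algebra_simps)
  ultimately show ?thesis by (intro filtI[of "f' + g'"] below_add)
qed

lemma filt_uminus: "f \<in> filt n \<Longrightarrow> - f \<in> filt n"
proof -
  assume "f \<in> filt n"
  then obtain f' where "f' \<in> below n" and I: "f - f' \<in> I" by (auto simp: filt_def)
  moreover have "- f - (- f') \<in> I" using I_uminus[OF I] by simp
  ultimately show ?thesis by (intro filtI[of "- f'"] below_uminus)
qed

lemma filt_sum: "(\<And>i. i \<in> A \<Longrightarrow> f i \<in> filt n) \<Longrightarrow> (\<Sum>i\<in>A. f i) \<in> filt n"
  by (induct A rule: infinite_finite_induct) (auto intro: below_filt below_0 filt_add)

lemma filt_lmult: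
  assumes "x \<in> below (Suc a)" "f \<in> filt n"
  shows "x * f \<in> filt (a + n)"
proof -
  obtain f' where f': "f' \<in> below n" and I: "f - f' \<in> I" using assms by (auto simp: filt_def)
  have "x * f - x * f' \<in> I" using I_lmult[OF below_C[OF assms(1)] I] by (simp add: right_diff_distrib)
  moreover have "x * f' \<in> below (a + n)" by (rule below_mult[OF assms(1) f']) simp
  ultimately show ?thesis by (rule filtI[rotated])
qed

lemma filt_rmult:
  assumes "x \<in> below (Suc a)" "f \<in> filt n"
  shows "f * x \<in> filt (n + a)"
proof -
  obtain f' where f': "f' \<in> below n" and I: "f - f' \<in> I" using assms by (auto simp: filt_def)
  have "f * x - f' * x \<in> I" using I_rmult[OF below_C[OF assms(1)] I] by (simp add: left_diff_distrib)
  moreover have "f' * x \<in> below (n + a)" by (rule below_mult[OF f' assms(1)]) simp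
  ultimately show ?thesis by (rule filtI[rotated])
qed

text \<open>The two words have equal weight and the same image in the associated graded algebra of
  the quotient by I.\<close>

definition weq :: "'g list \<Rightarrow> 'g list \<Rightarrow> bool" (infix "\<approx>" 50)
  where "u \<approx> v \<longleftrightarrow> set u \<subseteq> G \<and> set v \<subseteq> G \<and> weight u = weight v \<and>
    Poly_Mapping.single u 1 - Poly_Mapping.single v 1 \<in> filt (weight u)"

lemma weq_refl: "set u \<subseteq> G \<Longrightarrow> u \<approx> u"
  by (simp add: weq_def below_filt below_0)

lemma weq_sym: "u \<approx> v \<Longrightarrow> v \<approx> u"
  using filt_uminus[of "Poly_Mapping.single u 1 - Poly_Mapping.single v 1" "weight u"] by (auto simp: weq_def)

lemma weq_trans [trans]: "u \<approx> v \<Longrightarrow> v \<approx> w \<Longrightarrow> u \<approx> w"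
  using filt_add[of "Poly_Mapping.single u 1 - Poly_Mapping.single v 1" "weight u"
      "Poly_Mapping.single v 1 - Poly_Mapping.single w 1"] by (auto simp: weq_def)

lemma below_word: "set w \<subseteq> G \<Longrightarrow> Poly_Mapping.single w 1 \<in> below (Suc (weight w))"
  by (rule below_single) (auto simp: K_1)

text \<open>A congruence, since u v - u' v' = u (v - v') + (u - u') v'.\<close>

lemma weq_append:
  assumes "u \<approx> u'" "v \<approx> v'"
  shows "u @ v \<approx> u' @ v'"
proof -
  let ?w = "\<lambda>w. Poly_Mapping.single w (1 :: 'k)"
  have "?w u * (?w v - ?w v') + (?w u - ?w u') * ?w v' \<in> filt (weight u + weight v)"
  proof (rule filt_add)
    show "?w u * (?w v - ?w v') \<in> filt (weight u + weight v)"
      using assms by (intro filt_lmult below_word) (auto simp: weq_def)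
    show "(?w u - ?w u') * ?w v' \<in> filt (weight u + weight v)"
      using assms filt_rmult[OF below_word[of v'], of "?w u - ?w u'" "weight u"] by (auto simp: weq_def)
  qed
  then show ?thesis
    using assms by (auto simp: weq_def single_append algebra_simps)
qed

lemma weq_append1: "u \<approx> u' \<Longrightarrow> set v \<subseteq> G \<Longrightarrow> u @ v \<approx> u' @ v"
  by (rule weq_append[OF _ weq_refl])

lemma weq_append2: "v \<approx> v' \<Longrightarrow> set u \<subseteq> G \<Longrightarrow> u @ v \<approx> u @ v'"
  by (rule weq_append[OF weq_refl])

end

section \<open>Normal forms in the associated graded algebra\<close>

section \<open>Normal forms of words up to lower weight\<close>

text \<open>Serves because the relations between permutations and the Y_j are imposed for adjacent
  transpositions only.\<close>

lemma permutes_adjacent_induct [consumes 1, case_names id comp adj]: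
  fixes N :: nat
  assumes "p permutes {1..N}" "P id"
    and step: "\<And>p q. p permutes {1..N} \<Longrightarrow> q permutes {1..N} \<Longrightarrow> P p \<Longrightarrow> P q \<Longrightarrow> P (p \<circ> q)"
    and adj: "\<And>i. i \<in> {1..<N} \<Longrightarrow> P (transpose i (i+1))"
  shows "P p"
proof -
  have less: "P (transpose a (a + Suc d))" if "a \<ge> 1" "a + Suc d \<le> N" for a d
    using that
  proof (induction d)
    case 0
    then show ?case using adj[of a] by simp
  next
    case (Suc d)
    let ?t = "transpose (a + Suc d) (a + Suc (Suc d))"
    let ?u = "transpose a (a + Suc d)"
    have t: "?t permutes {1..N}" "?u permutes {1..N}"
      using Suc.prems by (auto intro!: transpose_permutes)
    have "P ?t" using adj[of "a + Suc d"] Suc.prems by simp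
    moreover have "P ?u" using Suc by simp
    \<comment> \<open>The transposition of a and a + d + 2 is the conjugate of that of a and a + d +
      1 by an adjacent one.\<close>
    ultimately have "P (?t \<circ> (?u \<circ> ?t))" using t by (intro step permutes_compose)
    moreover have "?t \<circ> (?u \<circ> ?t) = transpose a (a + Suc (Suc d))"
      by (auto simp: fun_eq_iff transpose_def)
    ultimately show ?case by simp
  qed
  have tr: "P (transpose a b)" if "a \<in> {1..N}" "b \<in> {1..N}" "a \<noteq> b" for a b
  proof (cases "a < b")
    case True
    then show ?thesis using less[of a "b - Suc a"] that by simp
  next
    case False
    then show ?thesis using less[of b "a - Suc b"] that by (simp add: transpose_commute)
  qed
  show ?thesis
    using assms(1) finite_atLeastAtMost
  proof (induction rule: permutes_induct)
    case (swap a b p)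
    then show ?case by (intro step transpose_permutes tr)
  qed (rule assms(2))
qed

fun cyc_wt :: "nat \<Rightarrow> cyc_gen \<Rightarrow> nat" where
  "cyc_wt l (CPerm p) = 0" | "cyc_wt l (CY i) = 1" | "cyc_wt l (CX i) = 0" | "cyc_wt l (CD i) = l"

fun cyc_sym :: "nat \<Rightarrow> cyc_gen \<Rightarrow> basis \<Rightarrow> basis" where
  "cyc_sym l (CPerm p) = act p"
| "cyc_sym l (CY i) = shift 1 1 i"
| "cyc_sym l (CX i) = shift 1 0 i"
| "cyc_sym l (CD i) = shift (int l - 1) l i"

fun move :: "(nat \<Rightarrow> nat) \<Rightarrow> cyc_gen \<Rightarrow> cyc_gen" where
  "move p (CPerm q) = CPerm q" | "move p (CY i) = CY (p i)" | "move p (CX i) = CX (p i)" | "move p (CD i) = CD (p i)"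

definition word_sym :: "nat \<Rightarrow> cyc_gen list \<Rightarrow> basis \<Rightarrow> basis"
  where "word_sym l w = foldr (\<lambda>g f. cyc_sym l g \<circ> f) w id"

lemma word_sym_simps [simp]:
  "word_sym l [] = id" "word_sym l (g # w) = cyc_sym l g \<circ> word_sym l w"
  by (simp_all add: word_sym_def)

definition perm_free :: "nat \<Rightarrow> cyc_gen set"
  where "perm_free N = CY ` {1..N} \<union> CX ` {1..N} \<union> CD ` {1..N}"

definition reduced :: "cyc_gen list \<Rightarrow> bool"
  where "reduced w \<longleftrightarrow> (\<forall>i. \<not> (CX i \<in> set w \<and> CD i \<in> set w))"

text \<open>Without permutations the symbols are commuting shifts, so only the number of occurrences
  of each letter counts. The permutation at the end acts before all letters, on a vector without x
  and lambda, and is stored in the third component.\<close>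

lemma word_sym_perm_free:
  assumes "set b \<subseteq> perm_free N"
  shows "word_sym l (b @ [CPerm p]) (\<lambda>_. 0, \<lambda>_. 0, id) =
    (\<lambda>i. int (count_list b (CY i)) + int (count_list b (CX i)) + (int l - 1) * int (count_list b (CD i)),
     \<lambda>i. count_list b (CY i) + l * count_list b (CD i), p)"
  using assms
proof (induction b)
  case Nil
  then show ?case by (simp add: act_def fun_eq_iff)
next
  case (Cons g b)
  then show ?case by (cases g) (auto simp: perm_free_def shift_def fun_eq_iff algebra_simps)
qed

text \<open>The exponent of lambda_i is n_Y + l n_D and that of x_i is n_Y + n_X + (l - 1) n_D,
  where n counts letters of index i. Their difference gives n_X - n_D; in a reduced word one of
  these two is 0, so both are known, and then so is n_Y.\<close>

lemma reduced_word_sym_inject: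
  assumes "set b \<subseteq> perm_free N" "set b' \<subseteq> perm_free N" "reduced b" "reduced b'"
    and eq: "word_sym l (b @ [CPerm p]) (\<lambda>_. 0, \<lambda>_. 0, id) = word_sym l (b' @ [CPerm p']) (\<lambda>_. 0, \<lambda>_. 0, id)"
  shows "p = p' \<and> mset b = mset b'"
proof -
  let ?c = count_list
  have eqs: "int (?c b (CY i)) + int (?c b (CX i)) + (int l - 1) * int (?c b (CD i)) =
      int (?c b' (CY i)) + int (?c b' (CX i)) + (int l - 1) * int (?c b' (CD i))"
    "?c b (CY i) + l * ?c b (CD i) = ?c b' (CY i) + l * ?c b' (CD i)" and p: "p = p'" for i
    using eq unfolding word_sym_perm_free[OF assms(1)] word_sym_perm_free[OF assms(2)]
    by (auto simp: fun_eq_iff)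
  have cnt: "?c b (CX i) = ?c b' (CX i) \<and> ?c b (CD i) = ?c b' (CD i) \<and> ?c b (CY i) = ?c b' (CY i)" for i
  proof -
    have "int (?c b (CY i)) + int l * int (?c b (CD i)) = int (?c b' (CY i)) + int l * int (?c b' (CD i))"
      using eqs(2)[of i] by (metis of_nat_add of_nat_mult)
    then have "int (?c b (CX i)) - int (?c b (CD i)) = int (?c b' (CX i)) - int (?c b' (CD i))"
      using eqs(1)[of i] by (simp add: left_diff_distrib)
    moreover have "?c b (CX i) = 0 \<or> ?c b (CD i) = 0" "?c b' (CX i) = 0 \<or> ?c b' (CD i) = 0"
      using assms(3,4) by (auto simp: reduced_def count_list_0_iff)
    ultimately have "?c b (CX i) = ?c b' (CX i) \<and> ?c b (CD i) = ?c b' (CD i)" by linarith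
    then show ?thesis using eqs(2)[of i] by simp
  qed
  have "count (mset b) g = count (mset b') g" for g
  proof (cases g)
    case (CPerm q)
    then have "g \<notin> set b" "g \<notin> set b'" using assms(1,2) by (auto simp: perm_free_def)
    then show ?thesis by (simp add: count_eq_zero_iff[THEN iffD2])
  qed (use cnt in \<open>auto simp: count_mset count_list_eq_length_filter eq_commute\<close>)
  then show ?thesis using p by (simp add: multiset_eq_iff)
qed

lemma perm_free_iff:
  "CPerm p \<in> perm_free N \<longleftrightarrow> False" "CY i \<in> perm_free N \<longleftrightarrow> i \<in> {1..N}"
  "CX i \<in> perm_free N \<longleftrightarrow> i \<in> {1..N}" "CD i \<in> perm_free N \<longleftrightarrow> i \<in> {1..N}"
  unfolding perm_free_def by blast+

lemma map_move_perm_free: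
  assumes "p permutes {1..N}" "set u \<subseteq> perm_free N"
  shows "set (map (move p) u) \<subseteq> perm_free N"
proof -
  have "move p g \<in> perm_free N" if "g \<in> perm_free N" for g
    using that by (cases g) (simp_all only: move.simps perm_free_iff permutes_in_image[OF assms(1)])
  then show ?thesis using assms(2) by auto
qed

text \<open>The leading parts of the defining relations. As in the presentation, permutations meet
  the Y_j only through adjacent transpositions, and letters of different kinds commute only with one
  index equal to 1; \<open>weq_perm_CY\<close> and \<open>weq_move\<close> supply the other
  cases.\<close>

locale cyc_words = weighted_words K "cyc_gens N" I "cyc_wt l"
  for K :: "'k::comm_ring_1 set" and N I l +
  assumes N_pos: "1 \<le> N"
    and weq_id: "weq [CPerm id] []"
    and weq_perm: "p permutes {1..N} \<Longrightarrow> q permutes {1..N} \<Longrightarrow> weq [CPerm p, CPerm q] [CPerm (p \<circ> q)]"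
    and weq_perm_Y: "i \<in> {1..<N} \<Longrightarrow> j \<in> {1..N} \<Longrightarrow>
      weq [CPerm (transpose i (i+1)), CY j] [CY (transpose i (i+1) j), CPerm (transpose i (i+1))]"
    and weq_perm_X: "p permutes {1..N} \<Longrightarrow> i \<in> {1..N} \<Longrightarrow> weq [CPerm p, CX i] [CX (p i), CPerm p]"
    and weq_perm_D: "p permutes {1..N} \<Longrightarrow> i \<in> {1..N} \<Longrightarrow> weq [CPerm p, CD i] [CD (p i), CPerm p]"
    and weq_Y_Y: "i \<in> {1..N} \<Longrightarrow> j \<in> {1..N} \<Longrightarrow> weq [CY i, CY j] [CY j, CY i]"
    and weq_X_X: "i \<in> {1..N} \<Longrightarrow> j \<in> {1..N} \<Longrightarrow> weq [CX i, CX j] [CX j, CX i]"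
    and weq_D_D: "i \<in> {1..N} \<Longrightarrow> j \<in> {1..N} \<Longrightarrow> weq [CD i, CD j] [CD j, CD i]"
    and weq_Y_X: "i \<in> {1..N} \<Longrightarrow> weq [CY i, CX 1] [CX 1, CY i]"
    and weq_Y_D: "i \<in> {1..N} \<Longrightarrow> weq [CY i, CD 1] [CD 1, CY i]"
    and weq_D_X: "i \<in> {1..N} \<Longrightarrow> weq [CD 1, CX i] [CX i, CD 1]"
    and weq_X_D: "weq [CX 1, CD 1] (replicate l (CY 1))"
begin

notation weq (infix "\<approx>" 50)

lemma perm_free_gens: "perm_free N \<subseteq> cyc_gens N"
  by (auto simp: perm_free_def cyc_gens_def)

lemma CPerm_gens: "p permutes {1..N} \<Longrightarrow> CPerm p \<in> cyc_gens N"
  by (simp add: cyc_gens_def)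

lemma perm_free_set: "set u \<subseteq> perm_free N \<Longrightarrow> set u \<subseteq> cyc_gens N"
  using perm_free_gens by blast

lemma weq_perm_CY:
  assumes "p permutes {1..N}" "j \<in> {1..N}"
  shows "[CPerm p, CY j] \<approx> [CY (p j), CPerm p]"
proof -
  have "\<forall>j\<in>{1..N}. [CPerm p, CY j] \<approx> [CY (p j), CPerm p]"
    using assms(1)
  proof (induction rule: permutes_adjacent_induct)
    case id
    have "[CPerm id] @ [CY j] \<approx> [CY j] @ [CPerm id]" if "j \<in> {1..N}" for j
    proof -
      have g: "set [CY j] \<subseteq> cyc_gens N" using that by (auto simp: cyc_gens_def)
      have "[CPerm id] @ [CY j] \<approx> [] @ [CY j]" by (rule weq_append1[OF weq_id g])
      also have "[] @ [CY j] \<approx> [CY j] @ [CPerm id]"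
        using weq_sym[OF weq_append2[OF weq_id g]] by simp
      finally show ?thesis .
    qed
    then show ?case unfolding append_Cons append_Nil id_apply by blast
  next
    case (comp p q)
    show ?case
    proof
      fix j assume j: "j \<in> {1..N}"
      have qj: "q j \<in> {1..N}" and pqj: "p (q j) \<in> {1..N}"
        using j comp(1,2) by (simp_all only: permutes_in_image)
      have g: "set [CY j] \<subseteq> cyc_gens N" "set [CY (p (q j))] \<subseteq> cyc_gens N"
        "set [CPerm p] \<subseteq> cyc_gens N" "set [CPerm q] \<subseteq> cyc_gens N"
        using j pqj comp by (auto simp: cyc_gens_def)
      have "[CPerm (p \<circ> q)] @ [CY j] \<approx> [CPerm p, CPerm q] @ [CY j]"
        by (rule weq_append1[OF weq_sym[OF weq_perm] g(1)]) (use comp in auto)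
      also have "[CPerm p, CPerm q] @ [CY j] = [CPerm p] @ [CPerm q, CY j]" by simp
      also have "\<dots> \<approx> [CPerm p] @ [CY (q j), CPerm q]"
        by (rule weq_append2[OF _ g(3)]) (use comp j in auto)
      also have "\<dots> = [CPerm p, CY (q j)] @ [CPerm q]" by simp
      also have "\<dots> \<approx> [CY (p (q j)), CPerm p] @ [CPerm q]"
        by (rule weq_append1[OF _ g(4)]) (use comp qj in auto)
      also have "\<dots> = [CY (p (q j))] @ [CPerm p, CPerm q]" by simp
      also have "\<dots> \<approx> [CY (p (q j))] @ [CPerm (p \<circ> q)]"
        by (rule weq_append2[OF weq_perm g(2)]) (use comp in auto)
      finally show "[CPerm (p \<circ> q), CY j] \<approx> [CY ((p \<circ> q) j), CPerm (p \<circ> q)]"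
        unfolding append_Cons append_Nil o_apply .
    qed
  next
    case (adj i)
    then show ?case using weq_perm_Y by blast
  qed
  then show ?thesis using assms(2) by blast
qed

lemma weq_perm_gen:
  assumes "p permutes {1..N}" "g \<in> perm_free N"
  shows "[CPerm p, g] \<approx> [move p g, CPerm p]"
  using assms(2) weq_perm_CY[OF assms(1)] weq_perm_X[OF assms(1)] weq_perm_D[OF assms(1)]
  by (auto simp: perm_free_def)

lemma weq_perm_word:
  assumes p: "p permutes {1..N}" and "set u \<subseteq> perm_free N"
  shows "[CPerm p] @ u \<approx> map (move p) u @ [CPerm p]"
  using assms(2)
proof (induction u)
  case Nil
  then show ?case using weq_refl[of "[CPerm p]"] CPerm_gens[OF p] by simp
next
  case (Cons g u)
  have gu: "g \<in> perm_free N" "set u \<subseteq> perm_free N" using Cons.prems by auto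
  have mg: "set [move p g] \<subseteq> cyc_gens N"
    using map_move_perm_free[OF p, of "[g]"] gu perm_free_gens by auto
  have "[CPerm p, g] @ u \<approx> [move p g, CPerm p] @ u"
    by (rule weq_append1[OF weq_perm_gen[OF p gu(1)] perm_free_set[OF gu(2)]])
  also have "\<dots> = [move p g] @ ([CPerm p] @ u)" by simp
  also have "\<dots> \<approx> [move p g] @ (map (move p) u @ [CPerm p])"
    by (rule weq_append2[OF Cons.IH[OF gu(2)] mg])
  finally show ?case by simp
qed

lemma weq_perm_cancel:
  assumes "p permutes {1..N}"
  shows "[CPerm p, CPerm (inv_into UNIV p)] \<approx> []"
proof -
  have "[CPerm p, CPerm (inv_into UNIV p)] \<approx> [CPerm (p \<circ> inv_into UNIV p)]"
    by (rule weq_perm[OF assms permutes_inv[OF assms]])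
  also have "p \<circ> inv_into UNIV p = id" by (rule permutes_inv_o(1)[OF assms])
  also note weq_id
  finally show ?thesis .
qed

text \<open>The word p u p^{-1} is congruent to \<open>map (move p) u\<close>, and congruence
  survives multiplication on both sides.\<close>

lemma weq_move:
  assumes p: "p permutes {1..N}" and uv: "set u \<subseteq> perm_free N" "set v \<subseteq> perm_free N" "u \<approx> v"
  shows "map (move p) u \<approx> map (move p) v"
proof -
  let ?p' = "inv_into UNIV p"
  have cp: "set [CPerm p] \<subseteq> cyc_gens N" "set [CPerm ?p'] \<subseteq> cyc_gens N"
    using p permutes_inv[OF p] by (auto intro: CPerm_gens)
  have move: "map (move p) u \<approx> [CPerm p] @ u @ [CPerm ?p']" if "set u \<subseteq> perm_free N" for u
  proof -
    have "map (move p) u @ [] \<approx> map (move p) u @ [CPerm p, CPerm ?p']"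
      by (rule weq_append2[OF weq_sym[OF weq_perm_cancel[OF p]] perm_free_set[OF map_move_perm_free[OF p that]]])
    also have "\<dots> = (map (move p) u @ [CPerm p]) @ [CPerm ?p']" by simp
    also have "\<dots> \<approx> ([CPerm p] @ u) @ [CPerm ?p']"
      by (rule weq_append1[OF weq_sym[OF weq_perm_word[OF p that]] cp(2)])
    finally show ?thesis by simp
  qed
  have "[CPerm p] @ u @ [CPerm ?p'] \<approx> [CPerm p] @ v @ [CPerm ?p']"
    by (intro weq_append2[OF _ cp(1)] weq_append1[OF uv(3) cp(2)])
  with move[OF uv(1)] weq_sym[OF move[OF uv(2)]] show ?thesis by (blast intro: weq_trans)
qed

lemma transpose_1:
  assumes "i \<in> {1..N}"
  shows "transpose 1 i permutes {1..N}" and "j \<in> {1..N} \<Longrightarrow> transpose 1 i j \<in> {1..N}"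
proof -
  show p: "transpose 1 i permutes {1..N}" using assms N_pos by (intro transpose_permutes) auto
  show "j \<in> {1..N} \<Longrightarrow> transpose 1 i j \<in> {1..N}" by (simp only: permutes_in_image[OF p])
qed

lemma weq_commute:
  assumes "g \<in> perm_free N" "g' \<in> perm_free N"
  shows "[g, g'] \<approx> [g', g]"
proof -
  have pf: "CY i \<in> perm_free N" "CX i \<in> perm_free N" "CD i \<in> perm_free N" if "i \<in> {1..N}" for i
    using that by (auto simp: perm_free_def)
  have 1: "1 \<in> {1..N}" using N_pos by simp
  \<comment> \<open>Conjugation by t = (1 j) carries the relation between Y_{t i} and X_1 to the one
    between Y_i and X_j; the next two are alike.\<close>
  have YX: "[CY i, CX j] \<approx> [CX j, CY i]" if "i \<in> {1..N}" "j \<in> {1..N}" for i j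
    using weq_move[OF transpose_1(1)[OF that(2)] _ _ weq_Y_X[OF transpose_1(2)[OF that(2,1)]]]
      pf[OF transpose_1(2)[OF that(2,1)]] pf[OF 1] by simp
  have YD: "[CY i, CD j] \<approx> [CD j, CY i]" if "i \<in> {1..N}" "j \<in> {1..N}" for i j
    using weq_move[OF transpose_1(1)[OF that(2)] _ _ weq_Y_D[OF transpose_1(2)[OF that(2,1)]]]
      pf[OF transpose_1(2)[OF that(2,1)]] pf[OF 1] by simp
  have DX: "[CD j, CX i] \<approx> [CX i, CD j]" if "i \<in> {1..N}" "j \<in> {1..N}" for i j
    using weq_move[OF transpose_1(1)[OF that(2)] _ _ weq_D_X[OF transpose_1(2)[OF that(2,1)]]]
      pf[OF transpose_1(2)[OF that(2,1)]] pf[OF 1] by simp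
  from assms consider i j where "i \<in> {1..N}" "j \<in> {1..N}" "g \<in> {CY i, CX i, CD i}" "g' \<in> {CY j, CX j, CD j}"
    unfolding perm_free_def by blast
  then show ?thesis
  proof cases
    case (1 i j)
    note [intro] = YX[OF 1(1,2)] YX[OF 1(2,1)] YD[OF 1(1,2)] YD[OF 1(2,1)] DX[OF 1(1,2)] DX[OF 1(2,1)]
      weq_Y_Y[OF 1(1,2)] weq_X_X[OF 1(1,2)] weq_D_D[OF 1(1,2)]
      weq_sym[OF YX[OF 1(1,2)]] weq_sym[OF YX[OF 1(2,1)]] weq_sym[OF YD[OF 1(1,2)]]
      weq_sym[OF YD[OF 1(2,1)]] weq_sym[OF DX[OF 1(1,2)]] weq_sym[OF DX[OF 1(2,1)]]
    show ?thesis using 1(3,4) by blast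
  qed
qed

lemma weq_Cons_move:
  assumes "g \<in> perm_free N" "set u \<subseteq> perm_free N"
  shows "g # u \<approx> u @ [g]"
  using assms(2)
proof (induction u)
  case Nil
  then show ?case using weq_refl[of "[g]"] assms(1) perm_free_gens by auto
next
  case (Cons a u)
  have au: "a \<in> perm_free N" "set u \<subseteq> perm_free N" using Cons.prems by auto
  have "[g, a] @ u \<approx> [a, g] @ u"
    by (rule weq_append1[OF weq_commute[OF assms(1) au(1)] perm_free_set[OF au(2)]])
  also have "\<dots> = [a] @ (g # u)" by simp
  also have "\<dots> \<approx> [a] @ (u @ [g])"
    by (rule weq_append2[OF Cons.IH[OF au(2)]]) (use au(1) perm_free_gens in auto)
  finally show ?case by simp
qed

lemma weq_mset:
  assumes "mset u = mset v" "set u \<subseteq> perm_free N"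
  shows "u \<approx> v"
  using assms
proof (induction u arbitrary: v)
  case Nil
  then show ?case using weq_refl[of "[]"] by simp
next
  case (Cons g u)
  then have "g \<in> set v" by (metis list.set_intros(1) set_mset_mset)
  then obtain v1 v2 where v: "v = v1 @ g # v2" by (meson split_list)
  have sv: "set v = set (g # u)" using Cons.prems(1) by (metis set_mset_mset)
  have g: "g \<in> perm_free N" and u: "set u \<subseteq> perm_free N" using Cons.prems(2) by auto
  have v12: "set v1 \<subseteq> perm_free N" "set v2 \<subseteq> perm_free N" using sv v Cons.prems(2) by auto
  have "mset u = mset (v1 @ v2)" using Cons.prems(1) v by simp
  from Cons.IH[OF this u] have "[g] @ u \<approx> [g] @ (v1 @ v2)"
    by (rule weq_append2) (use g perm_free_gens in auto)
  also have "\<dots> = (g # v1) @ v2" by simp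
  also have "\<dots> \<approx> (v1 @ [g]) @ v2"
    by (rule weq_append1[OF weq_Cons_move[OF g v12(1)] perm_free_set[OF v12(2)]])
  finally show ?case by (simp add: v)
qed

lemma weq_perm_last:
  assumes "set w \<subseteq> cyc_gens N"
  shows "\<exists>a p. set a \<subseteq> perm_free N \<and> p permutes {1..N} \<and> w \<approx> a @ [CPerm p]"
  using assms
proof (induction w)
  case Nil
  have "set [] \<subseteq> perm_free N \<and> id permutes {1..N} \<and> [] \<approx> [] @ [CPerm id]"
    unfolding append_Nil using weq_sym[OF weq_id] permutes_id by (intro conjI) simp_all
  then show ?case by blast
next
  case (Cons g w)
  then obtain a p where a: "set a \<subseteq> perm_free N" and p: "p permutes {1..N}" and w: "w \<approx> a @ [CPerm p]"
    by auto
  have gw: "[g] @ w \<approx> [g] @ (a @ [CPerm p])"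
    by (rule weq_append2[OF w]) (use Cons.prems in auto)
  show ?case
  proof (cases "g \<in> perm_free N")
    case True
    then show ?thesis using gw a p by (intro exI[of _ "g # a"] exI[of _ p]) auto
  next
    case False
    then obtain q where g: "g = CPerm q" and q: "q permutes {1..N}"
      using Cons.prems by (auto simp: perm_free_def cyc_gens_def)
    have ma: "set (map (move q) a) \<subseteq> perm_free N" by (rule map_move_perm_free[OF q a])
    note gw
    also have "[g] @ (a @ [CPerm p]) = ([CPerm q] @ a) @ [CPerm p]" using g by simp
    also have "\<dots> \<approx> (map (move q) a @ [CPerm q]) @ [CPerm p]"
      by (rule weq_append1[OF weq_perm_word[OF q a]]) (use CPerm_gens[OF p] in auto)
    also have "\<dots> = map (move q) a @ [CPerm q, CPerm p]" by simp
    also have "\<dots> \<approx> map (move q) a @ [CPerm (q \<circ> p)]"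
      by (rule weq_append2[OF weq_perm[OF q p] perm_free_set[OF ma]])
    finally have "g # w \<approx> map (move q) a @ [CPerm (q \<circ> p)]"
      unfolding append_Cons append_Nil .
    then show ?thesis using ma permutes_compose[OF p q] by blast
  qed
qed

lemma weq_X_D_any:
  assumes "i \<in> {1..N}"
  shows "[CX i, CD i] \<approx> replicate l (CY i)"
proof -
  have "map (move (transpose 1 i)) [CX 1, CD 1] \<approx> map (move (transpose 1 i)) (replicate l (CY 1))"
    by (rule weq_move[OF transpose_1(1)[OF assms] _ _ weq_X_D])
      (use N_pos in \<open>auto simp: perm_free_iff set_replicate_conv_if\<close>)
  then show ?thesis by (simp add: map_replicate)
qed

text \<open>Reordering brings X_i and D_i together, and their product becomes the l-th power of Y_i.
  The measure is the number of letters X: the weight does not change, and the length grows once l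
  exceeds 2.\<close>

lemma weq_reduced:
  assumes "set a \<subseteq> perm_free N"
  shows "\<exists>b. set b \<subseteq> perm_free N \<and> reduced b \<and> a \<approx> b"
  using assms
proof (induction "length (filter (\<lambda>g. g \<in> range CX) a)" arbitrary: a rule: less_induct)
  case less
  show ?case
  proof (cases "reduced a")
    case True
    then show ?thesis using less.prems weq_refl[OF perm_free_set[OF less.prems]] by blast
  next
    case False
    then obtain i where i: "CX i \<in> set a" "CD i \<in> set a" by (auto simp: reduced_def)
    define r where "r = remove1 (CD i) (remove1 (CX i) a)"
    have *: "CX i \<in># mset a" "CD i \<in># mset a - {#CX i#}"
      using i by (auto simp: in_diff_count count_eq_zero_iff)
    have "mset a = mset ([CX i, CD i] @ r)"
      unfolding r_def append_Cons append_Nil mset.simps mset_remove1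
      by (simp only: insert_DiffM[OF *(2)] insert_DiffM[OF *(1)])
    then have "a \<approx> [CX i, CD i] @ r" using less.prems by (intro weq_mset)
    also have r: "set r \<subseteq> perm_free N"
      using less.prems by (auto simp: r_def dest!: set_remove1_subset[THEN subsetD])
    have iN: "i \<in> {1..N}" using i(1) less.prems by (auto simp: perm_free_def)
    have "[CX i, CD i] @ r \<approx> replicate l (CY i) @ r"
      by (rule weq_append1[OF weq_X_D_any[OF iN] perm_free_set[OF r]])
    finally have 1: "a \<approx> replicate l (CY i) @ r" .
    have s: "set (replicate l (CY i) @ r) \<subseteq> perm_free N"
      using r iN by (auto simp: perm_free_def)
    have "mset (filter (\<lambda>g. g \<in> range CX) a) = mset (filter (\<lambda>g. g \<in> range CX) ([CX i, CD i] @ r))"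
      using \<open>mset a = _\<close> by (simp only: mset_filter)
    then have len: "length (filter (\<lambda>g. g \<in> range CX) a) = length (filter (\<lambda>g. g \<in> range CX) ([CX i, CD i] @ r))"
      by (rule mset_eq_length)
    have "length (filter (\<lambda>g. g \<in> range CX) (replicate l (CY i) @ r)) < length (filter (\<lambda>g. g \<in> range CX) a)"
      unfolding len by (auto simp: image_iff)
    from less.hyps[OF this s] 1 show ?thesis by (blast intro: weq_trans)
  qed
qed

lemma weq_normal_form:
  assumes "set w \<subseteq> cyc_gens N"
  shows "\<exists>b p. set b \<subseteq> perm_free N \<and> reduced b \<and> p permutes {1..N} \<and> w \<approx> b @ [CPerm p]"
proof -
  obtain a p where a: "set a \<subseteq> perm_free N" and p: "p permutes {1..N}" and w: "w \<approx> a @ [CPerm p]"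
    using weq_perm_last[OF assms] by blast
  obtain b where b: "set b \<subseteq> perm_free N" "reduced b" "a \<approx> b" using weq_reduced[OF a] by blast
  have "a @ [CPerm p] \<approx> b @ [CPerm p]"
    by (rule weq_append1[OF b(3)]) (use CPerm_gens[OF p] in auto)
  then show ?thesis using weq_trans[OF w] b p by blast
qed

end

section \<open>The kernel of the representation is the ideal\<close>

section \<open>Faithfulness of the representation by Dunkl operators\<close>

context cherednik_rep
begin

fun op_gen :: "cyc_gen \<Rightarrow> (basis, 'k) endo" where
  "op_gen (CPerm p) = T_op p" | "op_gen (CY i) = Y i" | "op_gen (CX i) = X_op i" | "op_gen (CD i) = D i"

sublocale alg_hom scalar_op op_gen
  by standard (simp, simp, simp, rule scalar_op_commute)

lemma has_symbol_gen: "g \<in> cyc_gens N \<Longrightarrow> has_symbol N (op_gen g) (cyc_sym l g) (cyc_wt l g)"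
  by (auto simp: cyc_gens_def intro: has_symbol_T[simplified] has_symbol_Y[simplified]
      has_symbol_D[simplified] has_symbol_X[simplified])

lemma has_symbol_word:
  assumes "set w \<subseteq> cyc_gens N"
  shows "has_symbol N (prod_list (map op_gen w)) (word_sym l w) (sum_list (map (cyc_wt l) w))"
  using assms
proof (induction w)
  case Nil
  have "has_symbol N 1 id 0" by (rule has_symbol_1)
  then show ?case by (simp only: list.map prod_list.Nil word_sym_simps sum_list.Nil)
next
  case (Cons g w)
  then have "has_symbol N (op_gen g * prod_list (map op_gen w)) (cyc_sym l g \<circ> word_sym l w)
      (cyc_wt l g + sum_list (map (cyc_wt l) w))"
    by (intro has_symbol_mult has_symbol_gen) auto
  then show ?case by (simp only: list.map prod_list.Cons word_sym_simps sum_list.Cons)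
qed

end

text \<open>Words are evaluated on this one vector. Starting from the identity, the third component
  of the leading term is the product of the permutations in the word.\<close>

definition base :: basis where "base = (\<lambda>_. 0, \<lambda>_. 0, id)"

lemma lam_deg_base [simp]: "lam_deg N base = 0"
  by (simp add: lam_deg_def base_def)

lemma lookup_low: "low N n f \<Longrightarrow> n \<le> lam_deg N m \<Longrightarrow> Poly_Mapping.lookup f m = 0"
  unfolding low_def by (metis in_keys_iff linorder_not_less)

text \<open>Two things are known about I: the leading relations hold modulo I up to lower weight,
  and I acts by zero. Hence the argument applies to the DAHA, with l = 0, and to the presented
  algebra.\<close>

locale cyc_rep_words = cyc_words K N I l + cherednik_rep N h k z l
  for K :: "'k::comm_ring_1 set" and N I l and h k :: 'k and z +
  assumes ev_I: "f \<in> I \<Longrightarrow> ev f = 0"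
begin

notation weq (infix "\<approx>" 50)

definition word_end :: "cyc_gen list \<Rightarrow> basis" where "word_end w = word_sym l w base"

lemma word_symbol:
  assumes "set w \<subseteq> cyc_gens N"
  shows "lam_deg N (word_end w) = weight w"
    and "low N (weight w) (app (prod_list (map op_gen w)) (Poly_Mapping.single base 1)
      - Poly_Mapping.single (word_end w) 1)"
  using has_symbolD[OF has_symbol_word[OF assms], of base] by (simp_all add: word_end_def weight_def)

text \<open>In degrees from the weight of w upwards only the leading term is visible.\<close>

lemma lookup_word:
  assumes "set w \<subseteq> cyc_gens N" "weight w \<le> lam_deg N m"
  shows "Poly_Mapping.lookup (app (prod_list (map op_gen w)) (Poly_Mapping.single base 1)) m
    = (if word_end w = m then 1 else 0)"
proof -
  have "Poly_Mapping.lookup (app (prod_list (map op_gen w)) (Poly_Mapping.single base 1)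
      - Poly_Mapping.single (word_end w) 1) m = 0"
    by (rule lookup_low[OF word_symbol(2)[OF assms(1)] assms(2)])
  then show ?thesis by (simp add: lookup_minus lookup_single when_def)
qed

lemma lookup_ev:
  "Poly_Mapping.lookup (app (ev f) v) m = (\<Sum>w\<in>Poly_Mapping.keys f.
    Poly_Mapping.lookup f w * Poly_Mapping.lookup (app (prod_list (map op_gen w)) v) m)"
  unfolding ev_def by (simp add: app_sum_endo lookup_sum app_mult scalar_op.rep_eq)

lemma lookup_ev_below:
  assumes "f \<in> below (Suc n)" "lam_deg N m = n"
  shows "Poly_Mapping.lookup (app (ev f) (Poly_Mapping.single base 1)) m
    = (\<Sum>w\<in>Poly_Mapping.keys f. if word_end w = m then Poly_Mapping.lookup f w else 0)"
  unfolding lookup_ev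
proof (rule sum.cong[OF refl])
  fix w assume "w \<in> Poly_Mapping.keys f"
  then have "set w \<subseteq> cyc_gens N" "weight w \<le> lam_deg N m"
    using assms by (auto simp: below_def C_iff)
  from lookup_word[OF this]
  show "Poly_Mapping.lookup f w * Poly_Mapping.lookup (app (prod_list (map op_gen w)) (Poly_Mapping.single base 1)) m
      = (if word_end w = m then Poly_Mapping.lookup f w else 0)" by simp
qed

text \<open>Elements of I act by zero, and a word of weight below n takes \<open>base\<close> to
  vectors of degree below n.\<close>

lemma filt_lookup:
  assumes "f \<in> filt n" "n \<le> lam_deg N m"
  shows "Poly_Mapping.lookup (app (ev f) (Poly_Mapping.single base 1)) m = 0"
proof -
  obtain g where g: "g \<in> below n" "f - g \<in> I" using assms(1) by (auto simp: filt_def)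
  have "ev f = ev g" using ev_I[OF g(2)] by (simp add: ev_diff)
  moreover have "g \<in> below (Suc (lam_deg N m))" using below_mono[OF g(1)] assms(2) by simp
  moreover have "word_end w \<noteq> m" if "w \<in> Poly_Mapping.keys g" for w
  proof -
    have "set w \<subseteq> cyc_gens N" "weight w < n" using g(1) that by (auto simp: below_def C_iff)
    then show ?thesis using word_symbol(1)[of w] assms(2) by auto
  qed
  ultimately show ?thesis
    using lookup_ev_below[of g "lam_deg N m" m] by (simp cong: sum.cong)
qed

text \<open>At the end point of u the image of u has coefficient 1. If v ended elsewhere, its image
  would have coefficient 0 there, but the difference of the two has no terms in this degree.\<close>

lemma weq_word_end:
  assumes "u \<approx> v"
  shows "word_end u = word_end v"
proof (rule ccontr)
  assume ne: "word_end u \<noteq> word_end v"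
  have uv: "set u \<subseteq> cyc_gens N" "set v \<subseteq> cyc_gens N" "weight u = weight v"
    and f: "Poly_Mapping.single u 1 - Poly_Mapping.single v 1 \<in> filt (weight u)"
    using assms by (auto simp: weq_def)
  have deg: "lam_deg N (word_end u) = weight u" by (rule word_symbol(1)[OF uv(1)])
  have "Poly_Mapping.lookup (app (ev (Poly_Mapping.single u 1 - Poly_Mapping.single v 1))
      (Poly_Mapping.single base 1)) (word_end u) = 0"
    by (rule filt_lookup[OF f]) (simp add: deg)
  then show False
    using lookup_word[OF uv(1), of "word_end u"] lookup_word[OF uv(2), of "word_end u"] deg uv(3) ne
    by (simp add: ev_diff ev_single app_simps lookup_minus)
qed

text \<open>By \<open>weq_word_end\<close> both words are congruent to normal forms with the same
  end point, which determines a normal form up to the order of its letters.\<close>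

lemma word_end_weq:
  assumes "set u \<subseteq> cyc_gens N" "set v \<subseteq> cyc_gens N" "word_end u = word_end v"
  shows "u \<approx> v"
proof -
  obtain a p where a: "set a \<subseteq> perm_free N" "reduced a" "p permutes {1..N}" "u \<approx> a @ [CPerm p]"
    using weq_normal_form[OF assms(1)] by blast
  obtain b q where b: "set b \<subseteq> perm_free N" "reduced b" "q permutes {1..N}" "v \<approx> b @ [CPerm q]"
    using weq_normal_form[OF assms(2)] by blast
  have "word_end (a @ [CPerm p]) = word_end (b @ [CPerm q])"
    using weq_word_end[OF a(4)] weq_word_end[OF b(4)] assms(3) by simp
  then have pq: "p = q" and "mset a = mset b"
    using reduced_word_sym_inject[OF a(1) b(1) a(2) b(2)] unfolding word_end_def base_def by blast+
  have "a @ [CPerm p] \<approx> b @ [CPerm p]"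
    by (rule weq_append1[OF weq_mset[OF \<open>mset a = mset b\<close> a(1)]]) (use CPerm_gens[OF a(3)] in auto)
  then show ?thesis
    using weq_trans[OF weq_trans[OF a(4)]] weq_sym[OF b(4)] pq by blast
qed

text \<open>The top-weight part of an element of the kernel is rewritten with one representative for each
  endpoint; its coefficients are then coefficients of the image of the base vector.\<close>

lemma filt_descend:
  assumes "f \<in> filt (Suc n)" "ev f = 0"
  shows "f \<in> filt n"
proof -
  obtain g where g: "g \<in> below (Suc n)" "f - g \<in> I" using assms(1) by (auto simp: filt_def)
  have evg: "ev g = 0" using ev_I[OF g(2)] assms(2) by (simp add: ev_diff)
  define top where "top = {w \<in> Poly_Mapping.keys g. weight w = n}"
  define rest where "rest = {w \<in> Poly_Mapping.keys g. weight w < n}"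
  let ?c = "Poly_Mapping.lookup g"
  have gk: "set w \<subseteq> cyc_gens N" "?c w \<in> K" if "w \<in> Poly_Mapping.keys g" for w
    using g(1) that by (auto simp: below_def C_iff)
  have keys: "Poly_Mapping.keys g = top \<union> rest" "top \<inter> rest = {}"
    using g(1) by (auto simp: top_def rest_def below_def)
  have fin: "finite top" "finite rest" by (auto simp: top_def rest_def)
  define rep where "rep m = (SOME w. w \<in> top \<and> word_end w = m)" for m
  have rep: "rep (word_end w) \<in> top" "word_end (rep (word_end w)) = word_end w" if "w \<in> top" for w
    using someI_ex[of "\<lambda>u. u \<in> top \<and> word_end u = word_end w"] that unfolding rep_def by blast+
  have zero: "(\<Sum>w\<in>{w \<in> top. word_end w = m}. ?c w) = 0" if m: "m \<in> word_end ` top" for m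
  proof -
    obtain u where u: "u \<in> top" "m = word_end u" using m by blast
    have deg: "lam_deg N m = n" using word_symbol(1)[OF gk(1)] u by (auto simp: top_def)
    have "(\<Sum>w\<in>Poly_Mapping.keys g. if word_end w = m then ?c w else 0) = 0"
      using lookup_ev_below[OF g(1) deg] evg by (simp add: app_simps)
    \<comment> \<open>A word of lower weight ends in lower degree, so it cannot end at m.\<close>
    also have "(\<Sum>w\<in>Poly_Mapping.keys g. if word_end w = m then ?c w else 0)
        = (\<Sum>w\<in>top. if word_end w = m then ?c w else 0)"
    proof (rule sum.mono_neutral_right)
      show "\<forall>w\<in>Poly_Mapping.keys g - top. (if word_end w = m then ?c w else 0) = 0"
        using word_symbol(1)[OF gk(1)] deg by (auto simp: top_def)
    qed (auto simp: top_def)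
    also have "\<dots> = (\<Sum>w\<in>{w \<in> top. word_end w = m}. ?c w)"
      using fin(1) by (simp add: sum.inter_filter)
    finally show ?thesis .
  qed
  let ?s = "\<lambda>w. Poly_Mapping.single w (1 :: 'k)"
  have "(\<Sum>w\<in>top. free_const (?c w) * ?s (rep (word_end w)))
      = (\<Sum>m\<in>word_end ` top. \<Sum>w\<in>{w \<in> top. word_end w = m}. free_const (?c w) * ?s (rep (word_end w)))"
    by (rule sum.image_gen[OF fin(1)])
  also have "\<dots> = (\<Sum>m\<in>word_end ` top. Poly_Mapping.single (rep m) (\<Sum>w\<in>{w \<in> top. word_end w = m}. ?c w))"
  proof (rule sum.cong[OF refl])
    have "Poly_Mapping.single v (sum c A) = (\<Sum>w\<in>A. Poly_Mapping.single v (c w))"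
      for v :: "cyc_gen list" and c :: "cyc_gen list \<Rightarrow> 'k" and A
      by (induct A rule: infinite_finite_induct) (auto simp: single_add)
    then show "(\<Sum>w\<in>{w \<in> top. word_end w = m}. free_const (?c w) * ?s (rep (word_end w)))
        = Poly_Mapping.single (rep m) (\<Sum>w\<in>{w \<in> top. word_end w = m}. ?c w)" for m
      by (simp add: free_const_mult_single)
  qed
  \<comment> \<open>The representatives add up to zero; subtracting them makes every summand a
    multiple of a difference of congruent words.\<close>
  also have "\<dots> = 0" by (rule sum.neutral) (simp add: zero)
  finally have "(\<Sum>w\<in>top. Poly_Mapping.single w (?c w))
      = (\<Sum>w\<in>top. free_const (?c w) * (?s w - ?s (rep (word_end w))))"
    by (simp add: right_diff_distrib sum_subtractf free_const_mult_single)
  also have "\<dots> \<in> filt n"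
  proof (rule filt_sum)
    fix w assume w: "w \<in> top"
    have wk: "w \<in> Poly_Mapping.keys g" "rep (word_end w) \<in> Poly_Mapping.keys g" "weight w = n"
      using w rep(1)[OF w] by (auto simp: top_def)
    have "w \<approx> rep (word_end w)"
      by (rule word_end_weq[OF gk(1)[OF wk(1)] gk(1)[OF wk(2)]]) (simp add: rep(2)[OF w])
    then have "?s w - ?s (rep (word_end w)) \<in> filt n"
      unfolding weq_def wk(3) by blast
    from filt_lmult[OF below_const[OF gk(2)[OF wk(1)], of 0] this]
    show "free_const (?c w) * (?s w - ?s (rep (word_end w))) \<in> filt n" by simp
  qed
  finally have top: "(\<Sum>w\<in>top. Poly_Mapping.single w (?c w)) \<in> filt n" .
  have "(\<Sum>w\<in>rest. Poly_Mapping.single w (?c w)) \<in> filt n"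
    using gk by (intro below_filt below_sum below_single) (auto simp: rest_def)
  with top have "(\<Sum>w\<in>top \<union> rest. Poly_Mapping.single w (?c w)) \<in> filt n"
    using fin keys(2) by (simp add: sum.union_disjoint filt_add)
  then have "g \<in> filt n" unfolding keys(1)[symmetric] pm_expand .
  from filt_add[OF this I_filt[OF g(2)]] show ?thesis by simp
qed

text \<open>Every element lies in some step of the filtration, and one in the kernel descends step
  by step to \<open>filt 0\<close>, which is I.\<close>

theorem ev_kernel:
  assumes "f \<in> C" "ev f = 0"
  shows "f \<in> I"
proof -
  have *: "f \<in> filt n \<Longrightarrow> f \<in> I" for n
    using filt_zero_iff filt_descend[OF _ assms(2)] by (induction n) auto
  \<comment> \<open>The inserted 0 covers f = 0, which has no words.\<close>
  define n where "n = Suc (Max (insert 0 (weight ` Poly_Mapping.keys f)))"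
  have "weight w < n" if "w \<in> Poly_Mapping.keys f" for w
    unfolding n_def less_Suc_eq_le by (rule Max_ge) (use that in auto)
  then have "f \<in> below n" using assms(1) by (simp add: below_def)
  then show ?thesis by (intro * below_filt)
qed

end

section \<open>Evaluation of the relation sets, and the leading parts of the relations\<close>

section \<open>The defining ideals\<close>

lemma ball_rel_simps:
  "(\<forall>x\<in>A \<union> B. P' x) \<longleftrightarrow> (\<forall>x\<in>A. P' x) \<and> (\<forall>x\<in>B. P' x)"
  "(\<forall>x\<in>{y}. P' x) \<longleftrightarrow> P' y"
  "(\<forall>x\<in>{(f i, g i) | i. Q i}. P x) \<longleftrightarrow> (\<forall>i. Q i \<longrightarrow> P (f i, g i))"
  "(\<forall>x\<in>{(f2 i j, g2 i j) | i j. Q2 i j}. P2 x) \<longleftrightarrow> (\<forall>i j. Q2 i j \<longrightarrow> P2 (f2 i j, g2 i j))"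
  by (blast | fastforce)+

text \<open>Expanded for an arbitrary predicate P on pairs, since the relations are consulted for
  validity in a ring, membership in the carrier, differences in an ideal and images under
  evaluation.\<close>

lemma cyclotomic_rels_all:
  "(\<forall>x\<in>cyclotomic_rels N l h k z T Y X D. P (fst x) (snd x)) \<longleftrightarrow>
    P (T id) 1 \<and>
    (\<forall>p q. p permutes {1..N} \<longrightarrow> q permutes {1..N} \<longrightarrow> P (T p * T q) (T (p \<circ> q))) \<and>
    (\<forall>i. i \<in> {1..<N} \<longrightarrow> P (T (transpose i (i+1)) * Y i) (Y (i+1) * T (transpose i (i+1)) + k)) \<and>
    (\<forall>i j. i \<in> {1..<N} \<longrightarrow> j \<in> {1..N} \<longrightarrow> j \<noteq> i \<longrightarrow> j \<noteq> i+1 \<longrightarrow>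
      P (T (transpose i (i+1)) * Y j) (Y j * T (transpose i (i+1)))) \<and>
    (\<forall>i j. i \<in> {1..N} \<longrightarrow> j \<in> {1..N} \<longrightarrow> P (commutator (Y i) (Y j)) 0) \<and>
    (\<forall>p i. p permutes {1..N} \<longrightarrow> i \<in> {1..N} \<longrightarrow> P (T p * X i) (X (p i) * T p)) \<and>
    (\<forall>i j. i \<in> {1..N} \<longrightarrow> j \<in> {1..N} \<longrightarrow> P (commutator (X i) (X j)) 0) \<and>
    (\<forall>i. i \<in> {2..N} \<longrightarrow> P (commutator (Y i) (X 1)) (k * X 1 * T (transpose 1 i))) \<and>
    P (commutator (Y 1) (X 1)) (h * X 1 - k * (\<Sum>i \<in> {2..N}. X 1 * T (transpose 1 i))) \<and>
    (\<forall>p i. p permutes {1..N} \<longrightarrow> i \<in> {1..N} \<longrightarrow> P (T p * D i) (D (p i) * T p)) \<and>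
    (\<forall>i j. i \<in> {1..N} \<longrightarrow> j \<in> {1..N} \<longrightarrow> P (commutator (D i) (D j)) 0) \<and>
    (\<forall>j. j \<in> {2..N} \<longrightarrow> P (commutator (Y j) (D 1)) (- k * T (transpose 1 j) * D 1)) \<and>
    P (commutator (Y 1) (D 1)) (- h * D 1 + k * (\<Sum>i \<in> {2..N}. T (transpose 1 i) * D 1)) \<and>
    P (commutator (D 1) (X 1)) (\<Sum>r \<in> {1..l}.
      prod_list (map (\<lambda>i. Y 1 - z i + (h - k * (\<Sum>j \<in> {2..N}. T (transpose 1 j)))) [1..<r]) *
      (h - k * (\<Sum>j \<in> {2..N}. T (transpose 1 j))) * prod_list (map (\<lambda>i. Y 1 - z i) [r+1..<l+1])) \<and>
    (\<forall>m. m \<in> {2..N} \<longrightarrow> P (commutator (D 1) (X m)) (k * (\<Sum>r \<in> {1..l}.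
      prod_list (map (\<lambda>i. Y 1 - z i + (h - k * (\<Sum>j \<in> {2..N}. T (transpose 1 j)))) [1..<r]) *
      T (transpose 1 m) * prod_list (map (\<lambda>i. Y 1 - z i) [r+1..<l+1])))) \<and>
    P (X 1 * D 1) (prod_list (map (\<lambda>i. Y 1 - z i) [1..<l+1]))"
  unfolding cyclotomic_rels_def Let_def symmetric_group_rels_def hecke_rels_def permuted_family_rels_def
  by (simp only: ball_rel_simps fst_conv snd_conv imp_conjL conj_assoc)

lemma daha_rels_all:
  "(\<forall>x\<in>daha_rels N h k T X Xinv Y. P (fst x) (snd x)) \<longleftrightarrow>
    P (T id) 1 \<and>
    (\<forall>p q. p permutes {1..N} \<longrightarrow> q permutes {1..N} \<longrightarrow> P (T p * T q) (T (p \<circ> q))) \<and>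
    (\<forall>p i. p permutes {1..N} \<longrightarrow> i \<in> {1..N} \<longrightarrow> P (T p * X i) (X (p i) * T p)) \<and>
    (\<forall>i j. i \<in> {1..N} \<longrightarrow> j \<in> {1..N} \<longrightarrow> P (commutator (X i) (X j)) 0) \<and>
    (\<forall>i. i \<in> {1..N} \<longrightarrow> P (X i * Xinv i) 1) \<and>
    (\<forall>i. i \<in> {1..N} \<longrightarrow> P (Xinv i * X i) 1) \<and>
    (\<forall>i. i \<in> {1..<N} \<longrightarrow> P (T (transpose i (i+1)) * Y i) (Y (i+1) * T (transpose i (i+1)) + k)) \<and>
    (\<forall>i j. i \<in> {1..<N} \<longrightarrow> j \<in> {1..N} \<longrightarrow> j \<noteq> i \<longrightarrow> j \<noteq> i+1 \<longrightarrow>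
      P (T (transpose i (i+1)) * Y j) (Y j * T (transpose i (i+1)))) \<and>
    (\<forall>i j. i \<in> {1..N} \<longrightarrow> j \<in> {1..N} \<longrightarrow> P (commutator (Y i) (Y j)) 0) \<and>
    (\<forall>i j. i \<in> {1..N} \<longrightarrow> j \<in> {1..N} \<longrightarrow> i > j \<longrightarrow> P (commutator (Y i) (X j)) (k * X j * T (transpose i j))) \<and>
    (\<forall>i j. i \<in> {1..N} \<longrightarrow> j \<in> {1..N} \<longrightarrow> i < j \<longrightarrow> P (commutator (Y i) (X j)) (k * X i * T (transpose i j))) \<and>
    (\<forall>i. i \<in> {1..N} \<longrightarrow> P (commutator (Y i) (X i)) (h * X i - k * (\<Sum>r \<in> {1..<i}. X r * T (transpose i r))
               - k * (\<Sum>r \<in> {i<..N}. X i * T (transpose i r))))"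
  unfolding daha_rels_def symmetric_group_rels_def hecke_rels_def permuted_family_rels_def
  by (simp only: ball_rel_simps fst_conv snd_conv imp_conjL conj_assoc)

text \<open>The relations are built by ring operations, which evaluation respects; so it is enough
  that the images of the generators satisfy them.\<close>

lemma (in alg_hom) ev_cyclotomic_rels:
  assumes "\<forall>x\<in>cyclotomic_rels N l (ev h) (ev k) (\<lambda>i. ev (z i)) (\<lambda>p. ev (T p)) (\<lambda>i. ev (Y i))
    (\<lambda>i. ev (X i)) (\<lambda>i. ev (D i)). fst x = snd x"
  shows "\<forall>x\<in>cyclotomic_rels N l h k z T Y X D. ev (fst x) = ev (snd x)"
  using assms
  unfolding cyclotomic_rels_all[of N l h k z T Y X D "\<lambda>a b. ev a = ev b"]
    cyclotomic_rels_all[of _ _ _ _ _ _ _ _ _ "(=)"]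
    ev_mult ev_diff ev_add ev_uminus ev_sum ev_prod_list ev_0 ev_1 .

lemma (in alg_hom) ev_daha_rels:
  assumes "\<forall>x\<in>daha_rels N (ev h) (ev k) (\<lambda>p. ev (T p)) (\<lambda>i. ev (X i)) (\<lambda>i. ev (Xinv i))
    (\<lambda>i. ev (Y i)). fst x = snd x"
  shows "\<forall>x\<in>daha_rels N h k T X Xinv Y. ev (fst x) = ev (snd x)"
  using assms
  unfolding daha_rels_all[of N h k T X Xinv Y "\<lambda>a b. ev a = ev b"]
    daha_rels_all[of _ _ _ _ _ _ _ "(=)"]
    ev_mult ev_diff ev_add ev_uminus ev_sum ev_prod_list ev_0 ev_1 .

context free_alg
begin

lemma C_prod_list_map: "(\<And>i. i \<in> set xs \<Longrightarrow> f i \<in> C) \<Longrightarrow> prod_list (map f xs) \<in> C"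
  by (rule C_prod_list) auto

lemma C_cyclotomic_rels:
  assumes N: "1 \<le> N" and h: "h \<in> C" and k: "k \<in> C" and z: "\<And>i. i \<in> {1..l} \<Longrightarrow> z i \<in> C"
    and T: "\<And>p. p permutes {1..N} \<Longrightarrow> T p \<in> C"
    and Y: "\<And>i. i \<in> {1..N} \<Longrightarrow> Y i \<in> C" and X: "\<And>i. i \<in> {1..N} \<Longrightarrow> X i \<in> C"
    and D: "\<And>i. i \<in> {1..N} \<Longrightarrow> D i \<in> C"
  shows "\<forall>x\<in>cyclotomic_rels N l h k z T Y X D. fst x \<in> C \<and> snd x \<in> C"
proof -
  have t: "T (transpose i j) \<in> C" if "i \<in> {1..N}" "j \<in> {1..N}" for i j
    by (rule T[OF transpose_permutes[OF that]])
  have pi: "p i \<in> {1..N}" if "p permutes {1..N}" "i \<in> {1..N}" for p i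
    using that by (simp only: permutes_in_image)
  have sub: "i \<in> {2..N} \<Longrightarrow> i \<in> {1..N}" "i \<in> {1..<N} \<Longrightarrow> i \<in> {1..N}" "i \<in> {1..<N} \<Longrightarrow> i + 1 \<in> {1..N}"
    "1 \<in> {1..N}" for i using N by auto
  have r: "i \<in> set [1..<r] \<Longrightarrow> r \<in> {1..l} \<Longrightarrow> i \<in> {1..l}" "i \<in> set [r+1..<l+1] \<Longrightarrow> i \<in> {1..l}"
    "i \<in> set [1..<l+1] \<Longrightarrow> i \<in> {1..l}" for i r by auto
  show ?thesis
    unfolding cyclotomic_rels_all[of _ _ _ _ _ _ _ _ _ "\<lambda>a b. a \<in> C \<and> b \<in> C"]
    by (intro conjI allI ballI impI C_mult C_add C_diff C_uminus C_sum C_0 C_1 C_prod_list_map;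
        (assumption | rule t h k permutes_id permutes_compose sub(4) | erule sub(1) sub(2) sub(3) r(2) r(3)
            | erule (1) r(1) | rule T Y X D z | erule (1) pi)+)
qed

lemma C_daha_rels:
  assumes h: "h \<in> C" and k: "k \<in> C"
    and T: "\<And>p. p permutes {1..N} \<Longrightarrow> T p \<in> C"
    and Y: "\<And>i. i \<in> {1..N} \<Longrightarrow> Y i \<in> C" and X: "\<And>i. i \<in> {1..N} \<Longrightarrow> X i \<in> C"
    and Xinv: "\<And>i. i \<in> {1..N} \<Longrightarrow> Xinv i \<in> C"
  shows "\<forall>x\<in>daha_rels N h k T X Xinv Y. fst x \<in> C \<and> snd x \<in> C"
proof -
  have t: "T (transpose i j) \<in> C" if "i \<in> {1..N}" "j \<in> {1..N}" for i j
    by (rule T[OF transpose_permutes[OF that]])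
  have pi: "p i \<in> {1..N}" if "p permutes {1..N}" "i \<in> {1..N}" for p i
    using that by (simp only: permutes_in_image)
  have sub: "i \<in> {1..<N} \<Longrightarrow> i \<in> {1..N}" "i \<in> {1..<N} \<Longrightarrow> i + 1 \<in> {1..N}" for i by auto
  have sub2: "r \<in> {1..<i} \<Longrightarrow> i \<in> {1..N} \<Longrightarrow> r \<in> {1..N}" "r \<in> {i<..N} \<Longrightarrow> i \<in> {1..N} \<Longrightarrow> r \<in> {1..N}" for i r
    by auto
  show ?thesis
    unfolding daha_rels_all[of _ _ _ _ _ _ _ "\<lambda>a b. a \<in> C \<and> b \<in> C"]
    by (intro conjI allI ballI impI C_mult C_add C_diff C_uminus C_sum C_0 C_1 C_prod_list_map;
        (assumption | rule t h k permutes_id permutes_compose | erule sub(1) sub(2)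
            | erule (1) sub2 | rule T Y X Xinv | erule (1) pi)+)
qed

lemma rel_ideal:
  assumes "\<forall>x\<in>R. fst x \<in> C \<and> snd x \<in> C"
  shows "ideal (rel_ideal F R) F" and "(a, b) \<in> R \<Longrightarrow> a - b \<in> rel_ideal F R"
proof -
  interpret ring F by (rule ring_F)
  have sub: "{a - b | a b. (a, b) \<in> R} \<subseteq> C" using assms by (fastforce intro: C_diff)
  show "ideal (rel_ideal F R) F" unfolding rel_ideal_def by (rule genideal_ideal[OF sub])
  show "a - b \<in> rel_ideal F R" if "(a, b) \<in> R"
    unfolding rel_ideal_def using genideal_self[OF sub] that by blast
qed

end

text \<open>The kernel of evaluation is an ideal containing the differences of the relations, and
  the ideal of relations is the smallest such.\<close>

lemma (in alg_hom) ev_rel_ideal: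
  assumes "free_alg K" and R: "\<forall>x\<in>R. fst x \<in> carrier (free_algebra K G) \<and> snd x \<in> carrier (free_algebra K G)"
    and ev_R: "\<forall>x\<in>R. ev (fst x) = ev (snd x)" and f: "f \<in> rel_ideal (free_algebra K G) R"
  shows "ev f = 0"
proof -
  interpret A: free_alg K G by fact
  interpret ring A.F by (rule A.ring_F)
  have "ideal {f \<in> A.C. ev f = 0} A.F"
  proof (rule idealI)
    show "subgroup {f \<in> A.C. ev f = 0} (add_monoid A.F)"
    proof (rule add.subgroupI)
      show "{f \<in> A.C. ev f = 0} \<noteq> {}" using A.C_0 by auto
    qed (auto simp: A.F_a_inv A.F_a_inv[unfolded a_inv_def] ev_uminus ev_add A.C_uminus A.C_add)
  qed (auto simp: ev_mult A.C_mult ring_axioms)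
  moreover have "{a - b | a b. (a, b) \<in> R} \<subseteq> {f \<in> A.C. ev f = 0}"
    using R ev_R by (fastforce simp: ev_diff intro: A.C_diff)
  ultimately have "rel_ideal A.F R \<subseteq> {f \<in> A.C. ev f = 0}"
    unfolding rel_ideal_def by (rule genideal_minimal)
  then show ?thesis using f by blast
qed

text \<open>The ideal has to contain the relations but not to be generated by them, so that
  \<open>IZ\<close>, which is defined through components, qualifies too.\<close>

locale cyc_rel_ideal = weighted_words K "cyc_gens N" I "cyc_wt l"
  for K :: "'k::comm_ring_1 set" and N I l +
  fixes h k :: 'k and z :: "nat \<Rightarrow> 'k"
  assumes N_pos: "1 \<le> N" and h_K: "h \<in> K" and k_K: "k \<in> K" and z_K: "i \<in> {1..l} \<Longrightarrow> z i \<in> K"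
    and rels: "\<forall>x\<in>cyclotomic_rels N l (free_const h) (free_const k) (\<lambda>i. free_const (z i))
      (\<lambda>p. free_gen (CPerm p)) (\<lambda>i. free_gen (CY i)) (\<lambda>i. free_gen (CX i)) (\<lambda>i. free_gen (CD i)).
      fst x - snd x \<in> I"
begin

notation weq (infix "\<approx>" 50)

lemmas rels' = rels[unfolded cyclotomic_rels_all[where P = "\<lambda>a b. a - b \<in> I"]]

lemmas I_id = rels'[THEN conjunct1, rule_format]
lemmas I_perm = rels'[THEN conjunct2, THEN conjunct1, rule_format]
lemmas I_simple_Y = rels'[THEN conjunct2, THEN conjunct2, THEN conjunct1, rule_format]
lemmas I_simple_Y_other = rels'[THEN conjunct2, THEN conjunct2, THEN conjunct2, THEN conjunct1, rule_format]
lemmas I_Y_Y = rels'[THEN conjunct2, THEN conjunct2, THEN conjunct2, THEN conjunct2, THEN conjunct1, rule_format]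
lemmas I_perm_X = rels'[THEN conjunct2, THEN conjunct2, THEN conjunct2, THEN conjunct2, THEN conjunct2, THEN conjunct1, rule_format]
lemmas I_X_X = rels'[THEN conjunct2, THEN conjunct2, THEN conjunct2, THEN conjunct2, THEN conjunct2, THEN conjunct2, THEN conjunct1, rule_format]
lemmas I_Y_X_other = rels'[THEN conjunct2, THEN conjunct2, THEN conjunct2, THEN conjunct2, THEN conjunct2, THEN conjunct2, THEN conjunct2, THEN conjunct1, rule_format]
lemmas I_Y_X_1 = rels'[THEN conjunct2, THEN conjunct2, THEN conjunct2, THEN conjunct2, THEN conjunct2, THEN conjunct2, THEN conjunct2, THEN conjunct2, THEN conjunct1, rule_format]
lemmas I_perm_D = rels'[THEN conjunct2, THEN conjunct2, THEN conjunct2, THEN conjunct2, THEN conjunct2, THEN conjunct2, THEN conjunct2, THEN conjunct2, THEN conjunct2, THEN conjunct1, rule_format]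
lemmas I_D_D = rels'[THEN conjunct2, THEN conjunct2, THEN conjunct2, THEN conjunct2, THEN conjunct2, THEN conjunct2, THEN conjunct2, THEN conjunct2, THEN conjunct2, THEN conjunct2, THEN conjunct1, rule_format]
lemmas I_Y_D_other = rels'[THEN conjunct2, THEN conjunct2, THEN conjunct2, THEN conjunct2, THEN conjunct2, THEN conjunct2, THEN conjunct2, THEN conjunct2, THEN conjunct2, THEN conjunct2, THEN conjunct2, THEN conjunct1, rule_format]
lemmas I_Y_D_1 = rels'[THEN conjunct2, THEN conjunct2, THEN conjunct2, THEN conjunct2, THEN conjunct2, THEN conjunct2, THEN conjunct2, THEN conjunct2, THEN conjunct2, THEN conjunct2, THEN conjunct2, THEN conjunct2, THEN conjunct1, rule_format]
lemmas I_D_X_1 = rels'[THEN conjunct2, THEN conjunct2, THEN conjunct2, THEN conjunct2, THEN conjunct2, THEN conjunct2, THEN conjunct2, THEN conjunct2, THEN conjunct2, THEN conjunct2, THEN conjunct2, THEN conjunct2, THEN conjunct2, THEN conjunct1, rule_format]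
lemmas I_D_X_other = rels'[THEN conjunct2, THEN conjunct2, THEN conjunct2, THEN conjunct2, THEN conjunct2, THEN conjunct2, THEN conjunct2, THEN conjunct2, THEN conjunct2, THEN conjunct2, THEN conjunct2, THEN conjunct2, THEN conjunct2, THEN conjunct2, THEN conjunct1, rule_format]
lemmas I_X_D = rels'[THEN conjunct2, THEN conjunct2, THEN conjunct2, THEN conjunct2, THEN conjunct2, THEN conjunct2, THEN conjunct2, THEN conjunct2, THEN conjunct2, THEN conjunct2, THEN conjunct2, THEN conjunct2, THEN conjunct2, THEN conjunct2, THEN conjunct2, rule_format]

lemma pair_word: "Poly_Mapping.single [a, b] (1 :: 'k) = free_gen a * free_gen b"
  by (simp add: free_gen_def mult_single plus_list_def)

text \<open>The element r is the error term, of lower weight, in a relation between u and v.\<close>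

lemma weqI:
  assumes "set u \<subseteq> cyc_gens N" "set v \<subseteq> cyc_gens N" "weight u = weight v"
    and "Poly_Mapping.single u 1 - Poly_Mapping.single v 1 - r \<in> I" "r \<in> below (weight u)"
  shows "u \<approx> v"
  unfolding weq_def using assms filtI[OF assms(5,4)] by blast

lemma weq_pairI:
  assumes "a \<in> cyc_gens N" "b \<in> cyc_gens N" "c \<in> cyc_gens N" "d \<in> cyc_gens N"
    "cyc_wt l a + cyc_wt l b = cyc_wt l c + cyc_wt l d"
    "free_gen a * free_gen b - free_gen c * free_gen d - r \<in> I" "r \<in> below (cyc_wt l a + cyc_wt l b)"
  shows "[a, b] \<approx> [c, d]"
  by (rule weqI[where r = r]) (use assms in \<open>simp_all add: pair_word\<close>)

lemma gens:
  "p permutes {1..N} \<Longrightarrow> CPerm p \<in> cyc_gens N" "i \<in> {1..N} \<Longrightarrow> CY i \<in> cyc_gens N"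
  "i \<in> {1..N} \<Longrightarrow> CX i \<in> cyc_gens N" "i \<in> {1..N} \<Longrightarrow> CD i \<in> cyc_gens N"
  by (simp_all add: cyc_gens_def)

lemma one_mem: "1 \<in> {1..N}"
  using N_pos by simp

lemma ij_cases: "i \<in> {1..N} \<Longrightarrow> i = 1 \<or> i \<in> {2..N}"
  by auto

lemma below_T: "i \<in> {2..N} \<Longrightarrow> free_gen (CPerm (transpose 1 i)) \<in> below 1"
  by (rule below_gen) (auto intro!: gens transpose_permutes)

lemma below_mult_0: "x \<in> below 1 \<Longrightarrow> y \<in> below n \<Longrightarrow> x * y \<in> below n"
  by (erule below_mult) auto

lemma below_1_mult: "x \<in> below n \<Longrightarrow> y \<in> below 1 \<Longrightarrow> x * y \<in> below n"
  by (erule below_mult) auto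

lemma below_k: "free_const k \<in> below 1" and below_h: "free_const h \<in> below 1"
  using below_const[OF k_K, of 0] below_const[OF h_K, of 0] by simp_all

lemma below_X: "free_gen (CX 1) \<in> below 1"
  using gens(3)[OF one_mem] by (intro below_gen) auto

lemma below_Y: "free_gen (CY 1) \<in> below 2"
  using gens(2)[OF one_mem] by (intro below_gen) auto

lemma below_D: "free_gen (CD 1) \<in> below (Suc l)"
  using gens(4)[OF one_mem] by (intro below_gen) auto

abbreviation J where
  "J \<equiv> free_const h - free_const k * (\<Sum>j \<in> {2..N}. free_gen (CPerm (transpose 1 j)))"

lemma below_J: "J \<in> below 1"
  by (intro below_diff below_mult_0 below_h below_k below_sum below_T)

text \<open>The r-th summand has r - 1 factors of weight at most 1 on the left of q and l - r on the
  right, hence weight at most l - 1: the commutator of D_1 and X_m has lower weight than their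
  product.\<close>

lemma below_leibniz:
  assumes "q \<in> below 1"
  shows "(\<Sum>r \<in> {1..l}. prod_list (map (\<lambda>i. free_gen (CY 1) - free_const (z i) + J) [1..<r]) * q
    * prod_list (map (\<lambda>i. free_gen (CY 1) - free_const (z i)) [r+1..<l+1])) \<in> below l"
proof (rule below_sum)
  fix r assume r: "r \<in> {1..l}"
  have f: "free_gen (CY 1) - free_const (z i) \<in> below 2" if "i \<in> {1..l}" for i
    using below_const[OF z_K[OF that], of 1] below_Y unfolding Suc_1 by (rule below_diff[rotated])
  have "prod_list (map (\<lambda>i. free_gen (CY 1) - free_const (z i) + J) [1..<r]) \<in> below (Suc (length [1..<r]))"
    using r by (intro below_prod_list below_add f below_mono[OF below_J]) auto
  moreover have "prod_list (map (\<lambda>i. free_gen (CY 1) - free_const (z i)) [r+1..<l+1]) \<in> below (Suc (length [r+1..<l+1]))"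
    using r by (intro below_prod_list f) auto
  ultimately show "prod_list (map (\<lambda>i. free_gen (CY 1) - free_const (z i) + J) [1..<r]) * q
    * prod_list (map (\<lambda>i. free_gen (CY 1) - free_const (z i)) [r+1..<l+1]) \<in> below l"
    using r by (intro below_mult[OF below_1_mult[OF _ assms]]) (assumption | simp)+
qed

text \<open>With P the product and S the power for the remaining factors, (y - c) P - y S = y (P -
  S) - c P, and both terms have lower weight.\<close>

lemma below_prod_minus_power:
  assumes "\<And>i. i \<in> set rs \<Longrightarrow> c i \<in> K"
  shows "prod_list (map (\<lambda>i. free_gen (CY 1) - free_const (c i)) rs)
    - Poly_Mapping.single (replicate (length rs) (CY 1)) 1 \<in> below (length rs)"
  using assms
proof (induction rs)
  case (Cons a rs)
  let ?P = "prod_list (map (\<lambda>i. free_gen (CY 1) - free_const (c i)) rs)"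
  let ?y = "free_gen (CY 1) :: cyc_gen list \<Rightarrow>\<^sub>0 'k"
  let ?S = "Poly_Mapping.single (replicate (length rs) (CY 1)) (1 :: 'k)"
  have "?P - ?S \<in> below (length rs)" using Cons by simp
  then have "?y * (?P - ?S) \<in> below (Suc (length rs))"
    using below_mult[OF below_Y] by simp
  moreover have "?P \<in> below (Suc (length rs))"
    using Cons.prems below_const[of _ 1] below_Y by (intro below_prod_list below_diff) (auto simp: numeral_2_eq_2)
  then have "free_const (c a) * ?P \<in> below (Suc (length rs))"
    using below_const[of "c a" 0] Cons.prems by (intro below_mult_0) auto
  ultimately have "?y * (?P - ?S) - free_const (c a) * ?P \<in> below (Suc (length rs))" by (rule below_diff)
  moreover have "?y * (?P - ?S) - free_const (c a) * ?P
      = prod_list (map (\<lambda>i. ?y - free_const (c i)) (a # rs)) - Poly_Mapping.single (replicate (length (a # rs)) (CY 1)) 1"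
    by (simp add: single_Cons algebra_simps)
  ultimately show ?case by simp
qed (simp add: below_0)

lemma single_word: "Poly_Mapping.single [a] (1 :: 'k) = free_gen a"
  by (simp add: free_gen_def)

lemma rel_perm:
  assumes "p permutes {1..N}" "q permutes {1..N}"
  shows "[CPerm p, CPerm q] \<approx> [CPerm (p \<circ> q)]"
proof (rule weqI)
  have "free_gen (CPerm p) * free_gen (CPerm q) - free_gen (CPerm (p \<circ> q)) \<in> I"
    by (rule I_perm[OF assms])
  then show "Poly_Mapping.single [CPerm p, CPerm q] 1 - Poly_Mapping.single [CPerm (p \<circ> q)] 1 - 0 \<in> I"
    by (simp only: pair_word single_word diff_zero)
  have "CPerm (p \<circ> q) \<in> cyc_gens N" by (rule gens(1)[OF permutes_compose[OF assms(2,1)]])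
  then show "set [CPerm (p \<circ> q)] \<subseteq> cyc_gens N" by (simp only: list.set insert_subset empty_subsetI simp_thms)
qed (use gens(1) assms in \<open>simp_all add: below_0\<close>)

lemma rel_id: "[CPerm id] \<approx> []"
proof (rule weqI)
  have "free_gen (CPerm id) - 1 \<in> I" by (rule I_id)
  then show "Poly_Mapping.single [CPerm id] 1 - Poly_Mapping.single [] 1 - 0 \<in> I"
    by (simp only: single_word single_Nil_one diff_zero)
  show "set [CPerm id] \<subseteq> cyc_gens N"
    using gens(1)[OF permutes_id] by (simp only: list.set insert_subset empty_subsetI simp_thms)
qed (simp_all add: below_0)

lemma rel_perm_Y:
  assumes i: "i \<in> {1..<N}" and j: "j \<in> {1..N}"
  shows "[CPerm (transpose i (i+1)), CY j] \<approx> [CY (transpose i (i+1) j), CPerm (transpose i (i+1))]"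
proof -
  let ?s = "transpose i (i+1)"
  have iN: "i \<in> {1..N}" "i + 1 \<in> {1..N}" using i by auto
  have s: "?s permutes {1..N}" by (rule transpose_permutes[OF iN])
  have first: "[CPerm ?s, CY i] \<approx> [CY (i+1), CPerm ?s]"
  proof (rule weq_pairI[where r = "free_const k"])
    have "free_gen (CPerm ?s) * free_gen (CY i) - (free_gen (CY (i+1)) * free_gen (CPerm ?s) + free_const k) \<in> I"
      by (rule I_simple_Y[OF i])
    then show "free_gen (CPerm ?s) * free_gen (CY i) - free_gen (CY (i+1)) * free_gen (CPerm ?s) - free_const k \<in> I"
      by (simp only: diff_diff_eq)
    show "free_const k \<in> below (cyc_wt l (CPerm ?s) + cyc_wt l (CY i))" using below_k by simp
  qed (use s iN in \<open>simp_all only: gens, simp\<close>)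
  consider "j = i" | "j = i + 1" | "j \<noteq> i" "j \<noteq> i + 1" by blast
  then show ?thesis
  proof cases
    case 1
    then show ?thesis using first by (simp only: transpose_apply_first)
  next
    case 2
    \<comment> \<open>This case is not among the relations. As s s is trivial, s Y_{i+1} \<approx> s
      Y_{i+1} s s \<approx> s s Y_i s \<approx> Y_i s.\<close>
    have "[CPerm ?s, CPerm ?s] \<approx> [CPerm (?s \<circ> ?s)]" by (rule rel_perm[OF s s])
    also have "?s \<circ> ?s = id" by (rule transpose_comp_involutory)
    also note rel_id
    finally have ss: "[CPerm ?s, CPerm ?s] \<approx> []" .
    have g: "set [CPerm ?s] \<subseteq> cyc_gens N" "set [CPerm ?s, CY (i+1)] \<subseteq> cyc_gens N" "set [CY i, CPerm ?s] \<subseteq> cyc_gens N"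
      using gens(1)[OF s] gens(2)[OF iN(1)] gens(2)[OF iN(2)]
      by (simp_all only: list.set insert_subset empty_subsetI simp_thms)
    have "[CPerm ?s, CY (i+1)] @ [] \<approx> [CPerm ?s, CY (i+1)] @ [CPerm ?s, CPerm ?s]"
      by (rule weq_append2[OF weq_sym[OF ss] g(2)])
    also have "\<dots> = [CPerm ?s] @ ([CY (i+1), CPerm ?s] @ [CPerm ?s])" by simp
    also have "\<dots> \<approx> [CPerm ?s] @ ([CPerm ?s, CY i] @ [CPerm ?s])"
      by (rule weq_append2[OF weq_append1[OF weq_sym[OF first] g(1)] g(1)])
    also have "\<dots> = [CPerm ?s, CPerm ?s] @ [CY i, CPerm ?s]" by simp
    also have "\<dots> \<approx> [] @ [CY i, CPerm ?s]" by (rule weq_append1[OF ss g(3)])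
    finally show ?thesis using 2 by simp
  next
    case 3
    then have t: "?s j = j" by simp
    show ?thesis
      unfolding t
    proof (rule weq_pairI[where r = 0])
      show "free_gen (CPerm ?s) * free_gen (CY j) - free_gen (CY j) * free_gen (CPerm ?s) - 0 \<in> I"
        unfolding diff_zero by (rule I_simple_Y_other[OF i j 3])
    qed (rule gens(1)[OF s] gens(2)[OF j] below_0 | simp)+
  qed
qed

lemma rel_Y_X: "i \<in> {1..N} \<Longrightarrow> [CY i, CX 1] \<approx> [CX 1, CY i]"
proof -
  assume i: "i \<in> {1..N}"
  have "\<exists>r. free_gen (CY i) * free_gen (CX 1) - free_gen (CX 1) * free_gen (CY i) - r \<in> I \<and> r \<in> below 1"
    using ij_cases[OF i]
  proof
    assume 1: "i = 1"
    have "free_gen (CY 1) * free_gen (CX 1) - free_gen (CX 1) * free_gen (CY 1) -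
        (free_const h * free_gen (CX 1) - free_const k * (\<Sum>i \<in> {2..N}. free_gen (CX 1) * free_gen (CPerm (transpose 1 i)))) \<in> I"
      by (rule I_Y_X_1)
    moreover have "free_const h * free_gen (CX 1) - free_const k * (\<Sum>i \<in> {2..N}. free_gen (CX 1) * free_gen (CPerm (transpose 1 i))) \<in> below 1"
      by (intro below_diff below_mult_0 below_sum below_k below_h below_X below_T)
    ultimately show ?thesis unfolding 1 by blast
  next
    assume i: "i \<in> {2..N}"
    have "free_gen (CY i) * free_gen (CX 1) - free_gen (CX 1) * free_gen (CY i) -
        free_const k * free_gen (CX 1) * free_gen (CPerm (transpose 1 i)) \<in> I"
      by (rule I_Y_X_other[OF i])
    moreover have "free_const k * free_gen (CX 1) * free_gen (CPerm (transpose 1 i)) \<in> below 1"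
      by (intro below_mult_0 below_k below_X below_T i)
    ultimately show ?thesis by blast
  qed
  then obtain r where "free_gen (CY i) * free_gen (CX 1) - free_gen (CX 1) * free_gen (CY i) - r \<in> I" "r \<in> below 1" by blast
  then show ?thesis using i gens one_mem by (intro weq_pairI[where r = r]) simp_all
qed

lemma rel_Y_D: "i \<in> {1..N} \<Longrightarrow> [CY i, CD 1] \<approx> [CD 1, CY i]"
proof -
  assume i: "i \<in> {1..N}"
  have "\<exists>r. free_gen (CY i) * free_gen (CD 1) - free_gen (CD 1) * free_gen (CY i) - r \<in> I \<and> r \<in> below (Suc l)"
    using ij_cases[OF i]
  proof
    assume 1: "i = 1"
    have "free_gen (CY 1) * free_gen (CD 1) - free_gen (CD 1) * free_gen (CY 1) -
        (- free_const h * free_gen (CD 1) + free_const k * (\<Sum>i \<in> {2..N}. free_gen (CPerm (transpose 1 i)) * free_gen (CD 1))) \<in> I"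
      by (rule I_Y_D_1)
    moreover have "- free_const h * free_gen (CD 1) + free_const k * (\<Sum>i \<in> {2..N}. free_gen (CPerm (transpose 1 i)) * free_gen (CD 1)) \<in> below (Suc l)"
      by (intro below_add below_mult_0 below_uminus below_sum below_k below_h below_D below_T)
    ultimately show ?thesis unfolding 1 by blast
  next
    assume i: "i \<in> {2..N}"
    have "free_gen (CY i) * free_gen (CD 1) - free_gen (CD 1) * free_gen (CY i) -
        - free_const k * free_gen (CPerm (transpose 1 i)) * free_gen (CD 1) \<in> I"
      by (rule I_Y_D_other[OF i])
    moreover have "- free_const k * free_gen (CPerm (transpose 1 i)) * free_gen (CD 1) \<in> below (Suc l)"
      by (intro below_mult_0 below_uminus below_k below_D below_T i)
    ultimately show ?thesis by blast
  qed
  then obtain r where "free_gen (CY i) * free_gen (CD 1) - free_gen (CD 1) * free_gen (CY i) - r \<in> I" "r \<in> below (Suc l)" by blast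
  then show ?thesis using i gens one_mem by (intro weq_pairI[where r = r]) simp_all
qed

lemma rel_D_X: "i \<in> {1..N} \<Longrightarrow> [CD 1, CX i] \<approx> [CX i, CD 1]"
proof -
  assume i: "i \<in> {1..N}"
  have "\<exists>r. free_gen (CD 1) * free_gen (CX i) - free_gen (CX i) * free_gen (CD 1) - r \<in> I \<and> r \<in> below l"
    using ij_cases[OF i]
  proof
    assume 1: "i = 1"
    show ?thesis unfolding 1 by (rule exI, rule conjI[OF I_D_X_1 below_leibniz[OF below_J]])
  next
    assume i: "i \<in> {2..N}"
    show ?thesis by (rule exI, rule conjI[OF I_D_X_other[OF i] below_mult_0[OF below_k below_leibniz[OF below_T[OF i]]]])
  qed
  then obtain r where "free_gen (CD 1) * free_gen (CX i) - free_gen (CX i) * free_gen (CD 1) - r \<in> I" "r \<in> below l" by blast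
  then show ?thesis using i gens one_mem by (intro weq_pairI[where r = r]) simp_all
qed

lemma rel_X_D: "[CX 1, CD 1] \<approx> replicate l (CY 1)"
proof (rule weqI)
  let ?P = "prod_list (map (\<lambda>i. free_gen (CY 1) - free_const (z i)) [1..<l+1])"
  have "free_gen (CX 1) * free_gen (CD 1) - ?P \<in> I" by (rule I_X_D)
  moreover have "a - s - (p - s) = a - p" for a s p :: "cyc_gen list \<Rightarrow>\<^sub>0 'k" by simp
  ultimately show "Poly_Mapping.single [CX 1, CD 1] 1 - Poly_Mapping.single (replicate l (CY 1)) 1
      - (?P - Poly_Mapping.single (replicate l (CY 1)) 1) \<in> I"
    by (simp only: pair_word)
  have "?P - Poly_Mapping.single (replicate (length [1..<l+1]) (CY 1)) 1 \<in> below (length [1..<l+1])"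
    by (rule below_prod_minus_power) (auto intro: z_K)
  moreover have "length [1..<l+1] = l" unfolding length_upt by simp
  ultimately show "?P - Poly_Mapping.single (replicate l (CY 1)) 1 \<in> below (weight [CX 1, CD 1])"
    by (simp del: upt_Suc)
  show "set (replicate l (CY 1)) \<subseteq> cyc_gens N"
    using gens(2)[OF one_mem] by (auto simp: set_replicate_conv_if)
  show "weight [CX 1, CD 1] = weight (replicate l (CY 1))"
    by (simp add: weight_def sum_list_replicate)
qed (use gens one_mem in simp)

sublocale cyc_words K N I l
proof
  show "1 \<le> N" by (rule N_pos)
  show "weq [CPerm id] []" by (rule rel_id)
  show "weq [CX 1, CD 1] (replicate l (CY 1))" by (rule rel_X_D)
  fix i assume i: "i \<in> {1..N}"
  show "weq [CY i, CX 1] [CX 1, CY i]" by (rule rel_Y_X[OF i])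
  show "weq [CY i, CD 1] [CD 1, CY i]" by (rule rel_Y_D[OF i])
  show "weq [CD 1, CX i] [CX i, CD 1]" by (rule rel_D_X[OF i])
  { fix p :: "nat \<Rightarrow> nat" assume p: "p permutes {1..N}"
    have pi: "p i \<in> {1..N}" using i by (simp only: permutes_in_image[OF p])
    have "free_gen (CPerm p) * free_gen (CX i) - free_gen (CX (p i)) * free_gen (CPerm p) \<in> I"
      "free_gen (CPerm p) * free_gen (CD i) - free_gen (CD (p i)) * free_gen (CPerm p) \<in> I"
      by (rule I_perm_X[OF p i], rule I_perm_D[OF p i])
    then show "weq [CPerm p, CX i] [CX (p i), CPerm p]" "weq [CPerm p, CD i] [CD (p i), CPerm p]"
      using gens p i pi by (auto intro!: weq_pairI[where r = 0] simp: below_0) }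
  fix j assume j: "j \<in> {1..N}"
  have "free_gen (CY i) * free_gen (CY j) - free_gen (CY j) * free_gen (CY i) - 0 \<in> I"
    "free_gen (CX i) * free_gen (CX j) - free_gen (CX j) * free_gen (CX i) - 0 \<in> I"
    "free_gen (CD i) * free_gen (CD j) - free_gen (CD j) * free_gen (CD i) - 0 \<in> I"
    using I_Y_Y[OF i j] I_X_X[OF i j] I_D_D[OF i j] by (simp_all only: diff_zero)
  then show "weq [CY i, CY j] [CY j, CY i]" "weq [CX i, CX j] [CX j, CX i]" "weq [CD i, CD j] [CD j, CD i]"
    using gens i j by (auto intro!: weq_pairI[where r = 0] simp: below_0)
qed (rule rel_perm rel_perm_Y; assumption)+

end

section \<open>Inverses of the X_i satisfy the relations of the D_i for l = 0\<close>

section \<open>The degenerate DAHA as the case of no cyclotomic parameters\<close>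

lemma free_const_left: "f * (free_const c * g) = free_const (c :: 'k::comm_ring_1) * (f * g)"
  by (metis free_const_commute mult.assoc)

locale daha_rel_ideal = free_alg_ideal K G I for K :: "'k::comm_ring_1 set" and G :: "'g set" and I +
  fixes N :: nat and h k :: 'k and T X Xinv Y
  assumes N_pos: "1 \<le> N" and hk: "h \<in> K" "k \<in> K"
    and T_C: "p permutes {1..N} \<Longrightarrow> T p \<in> C"
    and X_C: "i \<in> {1..N} \<Longrightarrow> X i \<in> C" and Xinv_C: "i \<in> {1..N} \<Longrightarrow> Xinv i \<in> C"
    and Y_C: "i \<in> {1..N} \<Longrightarrow> Y i \<in> C"
    and rels: "\<forall>x\<in>daha_rels N (free_const h) (free_const k) T X Xinv Y. fst x - snd x \<in> I"
begin

lemmas rels' = rels[unfolded daha_rels_all[where P = "\<lambda>a b. a - b \<in> I"]]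
lemmas I_id = rels'[THEN conjunct1, rule_format]
lemmas I_perm = rels'[THEN conjunct2, THEN conjunct1, rule_format]
lemmas I_perm_X = rels'[THEN conjunct2, THEN conjunct2, THEN conjunct1, rule_format]
lemmas rels3 = rels'[THEN conjunct2, THEN conjunct2, THEN conjunct2]
lemmas I_X_X = rels3[THEN conjunct1, rule_format]
lemmas I_X_Xinv = rels3[THEN conjunct2, THEN conjunct1, rule_format]
lemmas I_Xinv_X = rels3[THEN conjunct2, THEN conjunct2, THEN conjunct1, rule_format]
lemmas rels6 = rels3[THEN conjunct2, THEN conjunct2, THEN conjunct2]
lemmas I_simple_Y = rels6[THEN conjunct1, rule_format]
lemmas I_simple_Y_other = rels6[THEN conjunct2, THEN conjunct1, rule_format]
lemmas I_Y_Y = rels6[THEN conjunct2, THEN conjunct2, THEN conjunct1, rule_format]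
lemmas rels9 = rels6[THEN conjunct2, THEN conjunct2, THEN conjunct2]
lemmas I_Y_X_greater = rels9[THEN conjunct1, rule_format]
lemmas I_Y_X_same = rels9[THEN conjunct2, THEN conjunct2, rule_format]

text \<open>Counterpart modulo I of \<open>Xinv_conj\<close>: the difference is written as a
  combination of multiples of the hypothesis and of the two inverse relations.\<close>

lemma conj_Xinv:
  assumes ij: "i \<in> {1..N}" "j \<in> {1..N}" and C: "a \<in> C" "b \<in> C" and "a * X i - X j * b \<in> I"
  shows "b * Xinv i - Xinv j * a \<in> I"
proof -
  have "b * Xinv i - Xinv j * a = (X i * Xinv i - 1) * 0 - Xinv j * (a * X i - X j * b) * Xinv i
      - (Xinv j * X j - 1) * (b * Xinv i) + Xinv j * a * (X i * Xinv i - 1)"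
    by (simp add: algebra_simps)
  also have "\<dots> \<in> I"
    by (intro I_add I_diff I_lmult[where y = "a * X i - X j * b"] I_rmult[where y = "_ - 1"]
        I_rmult[where y = "Xinv j * (a * X i - X j * b)"] I_lmult[where y = "_ - 1"]
        assms I_X_Xinv I_Xinv_X C_mult Xinv_C C_0)
  finally show ?thesis .
qed

lemma one_mem: "1 \<in> {1..N}"
  using N_pos by simp

lemma t_C: "i \<in> {2..N} \<Longrightarrow> T (transpose 1 i) \<in> C"
  by (rule T_C[OF transpose_permutes]) auto

lemma hk_C: "free_const h \<in> C" "free_const k \<in> C"
  using hk by (simp_all add: C_const)

lemma I_X_Xinv_commute: "i \<in> {1..N} \<Longrightarrow> j \<in> {1..N} \<Longrightarrow> X i * Xinv j - Xinv j * X i \<in> I"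
  by (rule conj_Xinv) (auto intro: X_C I_X_X[unfolded diff_zero])

lemma Y_X_other:
  assumes "i \<in> {2..N}"
  shows "commutator (Y i) (X 1) - free_const k * X 1 * T (transpose 1 i) \<in> I"
  using I_Y_X_greater[of i 1] assms one_mem by (simp add: transpose_commute[of i])

lemma Y_X_1: "commutator (Y 1) (X 1) -
    (free_const h * X 1 - free_const k * (\<Sum>i \<in> {2..N}. X 1 * T (transpose 1 i))) \<in> I"
proof -
  have "{1<..N} = {2..N}" by auto
  then show ?thesis using I_Y_X_same[OF one_mem] by simp
qed

lemma Y_Xinv:
  assumes "j \<in> {1..N}" "q \<in> C" "Y j * X 1 - X 1 * (Y j + q) \<in> I"
  shows "commutator (Y j) (Xinv 1) - - q * Xinv 1 \<in> I"
  using conj_Xinv[OF one_mem one_mem Y_C[OF assms(1)] C_add[OF Y_C[OF assms(1)] assms(2)] assms(3)]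
  by (simp add: algebra_simps)

lemma Y_Xinv_other:
  assumes "j \<in> {2..N}"
  shows "commutator (Y j) (Xinv 1) - - free_const k * T (transpose 1 j) * Xinv 1 \<in> I"
proof -
  have e: "Y j * X 1 - X 1 * (Y j + free_const k * T (transpose 1 j))
      = commutator (Y j) (X 1) - free_const k * X 1 * T (transpose 1 j)"
    by (simp add: distrib_left free_const_left mult.assoc)
  have "commutator (Y j) (Xinv 1) - - (free_const k * T (transpose 1 j)) * Xinv 1 \<in> I"
  proof (rule Y_Xinv)
    show "j \<in> {1..N}" using assms by simp
    show "Y j * X 1 - X 1 * (Y j + free_const k * T (transpose 1 j)) \<in> I"
      unfolding e by (rule Y_X_other[OF assms])
  qed (intro C_mult hk_C t_C assms)
  then show ?thesis by (simp add: mult.assoc)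
qed

lemma Y_Xinv_1: "commutator (Y 1) (Xinv 1) - (- free_const h * Xinv 1
    + free_const k * (\<Sum>i \<in> {2..N}. T (transpose 1 i) * Xinv 1)) \<in> I"
proof -
  let ?q = "free_const h - free_const k * (\<Sum>i \<in> {2..N}. T (transpose 1 i))"
  have e: "Y 1 * X 1 - X 1 * (Y 1 + ?q) = commutator (Y 1) (X 1) -
      (free_const h * X 1 - free_const k * (\<Sum>i \<in> {2..N}. X 1 * T (transpose 1 i)))"
    by (simp add: distrib_left right_diff_distrib free_const_commute[of h] free_const_left sum_distrib_left)
  have "commutator (Y 1) (Xinv 1) - - ?q * Xinv 1 \<in> I"
  proof (rule Y_Xinv)
    show "Y 1 * X 1 - X 1 * (Y 1 + ?q) \<in> I" unfolding e by (rule Y_X_1)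
  qed (intro one_mem C_diff C_mult C_sum hk_C t_C; assumption)+
  moreover have "- ?q * Xinv 1 = - free_const h * Xinv 1
    + free_const k * (\<Sum>i \<in> {2..N}. T (transpose 1 i) * Xinv 1)"
    by (simp add: left_diff_distrib sum_distrib_right mult.assoc)
  ultimately show ?thesis by (simp only:)
qed

text \<open>With D_i read as X_i^{-1}, the products over the z_r are 1 and the sums giving
  [D_1, X_m] are empty; the relations for D then say how the inverses commute with the rest.\<close>

theorem cyclotomic_rels_0:
  "\<forall>x\<in>cyclotomic_rels N 0 (free_const h) (free_const k) z T Y X Xinv. fst x - snd x \<in> I"
  unfolding cyclotomic_rels_all[where P = "\<lambda>a b. a - b \<in> I"]
proof (intro conjI allI impI)
  fix i j assume i: "i \<in> {1..N}" and j: "j \<in> {1..N}"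
  show "commutator (Xinv i) (Xinv j) - 0 \<in> I"
  proof -
    have "Xinv i * X j - X j * Xinv i \<in> I"
      using I_uminus[OF I_X_Xinv_commute[OF j i]] by simp
    from conj_Xinv[OF j j Xinv_C[OF i] Xinv_C[OF i] this] show ?thesis by simp
  qed
  show "T p * Xinv i - Xinv (p i) * T p \<in> I" if p: "p permutes {1..N}" for p
  proof -
    have pi: "p i \<in> {1..N}" using i by (simp only: permutes_in_image[OF p])
    show ?thesis by (rule conj_Xinv[OF i pi T_C[OF p] T_C[OF p] I_perm_X[OF p i]])
  qed
next
  have "Xinv 1 * X 1 - 1 - (X 1 * Xinv 1 - 1) \<in> I" by (rule I_diff[OF I_Xinv_X[OF one_mem] I_X_Xinv[OF one_mem]])
  then show "commutator (Xinv 1) (X 1) - (\<Sum>r = 1..0. prod_list (map (\<lambda>i. Y 1 - z i + (free_const h - free_const k *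
      (\<Sum>j = 2..N. T (transpose 1 j)))) [1..<r]) * (free_const h - free_const k * (\<Sum>j = 2..N. T (transpose 1 j)))
      * prod_list (map (\<lambda>i. Y 1 - z i) [r + 1..<0 + 1])) \<in> I" by simp
  show "X 1 * Xinv 1 - prod_list (map (\<lambda>i. Y 1 - z i) [1..<0 + 1]) \<in> I"
    using I_X_Xinv[OF one_mem] by simp
next
  fix m assume "m \<in> {2..N}"
  then have "Xinv 1 * X m - X m * Xinv 1 \<in> I"
    using I_uminus[OF I_X_Xinv_commute[of m 1]] one_mem by simp
  then show "commutator (Xinv 1) (X m) - free_const k * (\<Sum>r = 1..0. prod_list (map (\<lambda>i. Y 1 - z i + (free_const h - free_const k *
      (\<Sum>j = 2..N. T (transpose 1 j)))) [1..<r]) * T (transpose 1 m)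
      * prod_list (map (\<lambda>i. Y 1 - z i) [r + 1..<0 + 1])) \<in> I" by simp
qed (rule I_id I_perm I_simple_Y I_simple_Y_other I_Y_Y I_perm_X I_X_X Y_X_other Y_X_1 Y_Xinv_other Y_Xinv_1; assumption?)+

end

section \<open>Expansion in monomials of z, and the DAHA over the ring of parameters\<close>

section \<open>Components in the parameters\<close>

lemma free_alg_coeffs_z: "free_alg (coeffs_z l)"
proof
  fix x y assume xy: "x \<in> coeffs_z l" "y \<in> coeffs_z l"
  show "x + y \<in> coeffs_z l"
    using xy Poly_Mapping.keys_add[of x y] unfolding coeffs_z_def by blast
  show "- x \<in> coeffs_z l" using xy by (simp add: coeffs_z_def in_keys_iff)
  show "x * y \<in> coeffs_z l"
    unfolding coeffs_z_def
  proof (intro CollectI ballI)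
    fix m assume "m \<in> Poly_Mapping.keys (x * y)"
    then obtain a b where "m = a + b" "a \<in> Poly_Mapping.keys x" "b \<in> Poly_Mapping.keys y"
      using keys_mult[of x y] by blast
    then show "Poly_Mapping.keys m \<subseteq> {1..l}"
      using xy Poly_Mapping.keys_add[of a b] unfolding coeffs_z_def by blast
  qed
qed (auto simp: coeffs_z_def)

lemma hk_const_coeffs_z: "hk_const c \<in> coeffs_z l"
  by (simp add: coeffs_z_def hk_const_def)

lemma z_var_coeffs_z: "i \<in> {1..l} \<Longrightarrow> z_var i \<in> coeffs_z l"
  by (simp add: coeffs_z_def z_var_def)

lemma single_0_simps:
  "Poly_Mapping.single 0 a * Poly_Mapping.single 0 b = Poly_Mapping.single (0 :: nat \<Rightarrow>\<^sub>0 nat) (a * b :: 'a::ring_1)"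
  "Poly_Mapping.single 0 a + Poly_Mapping.single 0 b = Poly_Mapping.single (0 :: nat \<Rightarrow>\<^sub>0 nat) (a + b)"
  "Poly_Mapping.single 0 a - Poly_Mapping.single 0 b = Poly_Mapping.single (0 :: nat \<Rightarrow>\<^sub>0 nat) (a - b)"
  "- Poly_Mapping.single 0 a = Poly_Mapping.single (0 :: nat \<Rightarrow>\<^sub>0 nat) (- a)"
  by (simp_all add: mult_single single_add single_diff single_uminus)

lemma single_0_sum: "(\<Sum>i\<in>A. Poly_Mapping.single 0 (f i)) = Poly_Mapping.single (0 :: nat \<Rightarrow>\<^sub>0 nat) (\<Sum>i\<in>A. f i :: 'a::ring_1)"
  by (induct A rule: infinite_finite_induct) (auto simp: single_0_simps)

lemma single_0_prod_list: "prod_list (map (\<lambda>i. Poly_Mapping.single 0 (f i)) xs)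
    = Poly_Mapping.single (0 :: nat \<Rightarrow>\<^sub>0 nat) (prod_list (map f xs) :: 'a::ring_1)"
  by (induct xs) (auto simp: single_0_simps)

type_synonym daha_z_free = "(nat \<Rightarrow>\<^sub>0 nat) \<Rightarrow>\<^sub>0 (daha_gen list \<Rightarrow>\<^sub>0 coeff_hk)"

text \<open>In \<open>daha_z_ring\<close> an element is a family of elements of the DAHA indexed by
  monomials in z, whereas the free algebra on \<open>cyc_gens\<close> has z among its scalars. This
  map, extended to words by \<open>comp\<close>, passes from the second form to the first.\<close>

definition comp_const :: "coeff_hkz \<Rightarrow> daha_z_free"
  where "comp_const c = Poly_Mapping.map free_const c"

lemma lookup_comp_const: "Poly_Mapping.lookup (comp_const c) m = free_const (Poly_Mapping.lookup c m)"
proof -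
  have "free_const 0 = (0 :: daha_gen list \<Rightarrow>\<^sub>0 coeff_hk)" by (simp add: free_const_def)
  then show ?thesis by (simp add: comp_const_def Poly_Mapping.map.rep_eq when_def)
qed

lemma comp_const_add: "comp_const (x + y) = comp_const x + comp_const y"
  by (rule poly_mapping_eqI) (simp add: lookup_comp_const lookup_add free_const_simps)

lemma comp_const_single: "comp_const (Poly_Mapping.single m c) = Poly_Mapping.single m (free_const c)"
  by (rule poly_mapping_eqI) (auto simp: lookup_comp_const lookup_single when_def free_const_def)

lemma comp_const_sum: "comp_const (\<Sum>i\<in>A. f i) = (\<Sum>i\<in>A. comp_const (f i))"
proof (induct A rule: infinite_finite_induct)
qed (auto simp: comp_const_add comp_const_single[of 0 0, simplified] free_const_def)

lemma comp_const_mult: "comp_const (x * y) = comp_const x * comp_const y"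
proof -
  have ex: "comp_const z = (\<Sum>m\<in>Poly_Mapping.keys z. Poly_Mapping.single m (free_const (Poly_Mapping.lookup z m)))" for z
    using comp_const_sum[of "\<lambda>m. Poly_Mapping.single m (Poly_Mapping.lookup z m)" "Poly_Mapping.keys z"]
    by (simp only: pm_expand comp_const_single)
  have "comp_const x * comp_const y = (\<Sum>u\<in>Poly_Mapping.keys x. \<Sum>v\<in>Poly_Mapping.keys y.
      Poly_Mapping.single (u + v) (free_const (Poly_Mapping.lookup x u) * free_const (Poly_Mapping.lookup y v)))"
    by (subst ex[of x], subst ex[of y]) (simp only: sum_product mult_single)
  then show ?thesis
    unfolding mult_expand[of x y] by (simp only: comp_const_sum comp_const_single free_const_simps)
qed

lemma comp_const_central: "comp_const x * p = p * comp_const x"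
proof -
  have "comp_const (\<Sum>m\<in>Poly_Mapping.keys x. Poly_Mapping.single m (Poly_Mapping.lookup x m)) * Poly_Mapping.single n f
    = Poly_Mapping.single n f * comp_const (\<Sum>m\<in>Poly_Mapping.keys x. Poly_Mapping.single m (Poly_Mapping.lookup x m))" for n f
    by (simp add: comp_const_sum comp_const_single sum_distrib_left sum_distrib_right mult_single
        free_const_commute add.commute)
  then have c: "comp_const x * Poly_Mapping.single n f = Poly_Mapping.single n f * comp_const x" for n f
    unfolding pm_expand .
  have "comp_const x * (\<Sum>m\<in>Poly_Mapping.keys p. Poly_Mapping.single m (Poly_Mapping.lookup p m))
    = (\<Sum>m\<in>Poly_Mapping.keys p. Poly_Mapping.single m (Poly_Mapping.lookup p m)) * comp_const x"
    by (simp add: sum_distrib_left sum_distrib_right c)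
  then show ?thesis by (simp only: pm_expand)
qed

fun daha_letter :: "cyc_gen \<Rightarrow> daha_gen" where
  "daha_letter (CPerm p) = Perm p" | "daha_letter (CY i) = GY i" | "daha_letter (CX i) = GX i"
| "daha_letter (CD i) = GXinv i"

interpretation comp: alg_hom comp_const "\<lambda>g. Poly_Mapping.single 0 (free_gen (daha_letter g)) :: daha_z_free"
proof
  show "comp_const 1 = 1" using comp_const_single[of 0 1] by (simp add: free_const_simps)
qed (rule comp_const_add comp_const_mult comp_const_central)+

lemma prod_list_free_gen: "prod_list (map free_gen w) = Poly_Mapping.single w (1 :: 'k::comm_ring_1)"
  by (induct w) (simp_all add: single_Cons)

lemma lookup_mult_single_0:
  "Poly_Mapping.lookup (p * Poly_Mapping.single (0 :: nat \<Rightarrow>\<^sub>0 nat) x) m = Poly_Mapping.lookup p m * (x :: 'a::ring_1)"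
proof -
  have "Poly_Mapping.lookup ((\<Sum>n\<in>Poly_Mapping.keys p. Poly_Mapping.single n (Poly_Mapping.lookup p n)) * Poly_Mapping.single 0 x) m
      = Poly_Mapping.lookup p m * x"
    by (auto simp: sum_distrib_right mult_single lookup_sum lookup_single when_def in_keys_iff sum.delta')
  then show ?thesis by (simp only: pm_expand)
qed

lemma lookup_comp: "Poly_Mapping.lookup (comp.ev f) m = (\<Sum>w\<in>Poly_Mapping.keys f.
    Poly_Mapping.single (map daha_letter w) (Poly_Mapping.lookup (Poly_Mapping.lookup f w) m))"
proof -
  have "prod_list (map (\<lambda>g. Poly_Mapping.single 0 (free_gen (daha_letter g)) :: daha_z_free) w)
      = Poly_Mapping.single 0 (Poly_Mapping.single (map daha_letter w) 1)" for w
    using single_0_prod_list[of "\<lambda>g. free_gen (daha_letter g) :: daha_gen list \<Rightarrow>\<^sub>0 coeff_hk" w]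
      prod_list_free_gen[of "map daha_letter w", where 'k=coeff_hk]
    by (simp add: comp_def)
  then show ?thesis
    by (simp add: comp.ev_def lookup_sum lookup_mult_single_0 lookup_comp_const free_const_mult_single)
qed

locale daha_setup =
  fixes N l :: nat
  assumes N_pos: "1 \<le> N"
begin

sublocale H: free_alg UNIV "daha_gens N"
  by standard auto

sublocale Z: free_alg "coeffs_z l" "cyc_gens N"
  by (rule free_alg_coeffs_z)

definition IH where "IH = rel_ideal (daha_free N) (daha_relations N)"

lemma H_gens:
  "p permutes {1..N} \<Longrightarrow> free_gen (Perm p) \<in> H.C" "i \<in> {1..N} \<Longrightarrow> free_gen (GX i) \<in> H.C"
  "i \<in> {1..N} \<Longrightarrow> free_gen (GXinv i) \<in> H.C" "i \<in> {1..N} \<Longrightarrow> free_gen (GY i) \<in> H.C"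
  by (rule H.C_gen; simp add: daha_gens_def)+

lemma Z_gens:
  "p permutes {1..N} \<Longrightarrow> free_gen (CPerm p) \<in> Z.C" "i \<in> {1..N} \<Longrightarrow> free_gen (CX i) \<in> Z.C"
  "i \<in> {1..N} \<Longrightarrow> free_gen (CD i) \<in> Z.C" "i \<in> {1..N} \<Longrightarrow> free_gen (CY i) \<in> Z.C"
  by (rule Z.C_gen; simp add: cyc_gens_def)+

lemma Z_consts: "free_const (hk_const c) \<in> Z.C" "i \<in> {1..l} \<Longrightarrow> free_const (z_var i) \<in> Z.C"
  by (simp_all add: Z.C_const hk_const_coeffs_z z_var_coeffs_z)

lemma H_rels_C: "\<forall>x\<in>daha_relations N. fst x \<in> H.C \<and> snd x \<in> H.C"
  by (rule H.C_daha_rels) (rule H_gens H.C_const UNIV_I; assumption?)+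

sublocale H: free_alg_ideal UNIV "daha_gens N" IH
  unfolding IH_def
  by (intro free_alg_ideal.intro free_alg_ideal_axioms.intro H.free_alg_axioms H.rel_ideal(1)[OF H_rels_C])

sublocale H: daha_rel_ideal UNIV "daha_gens N" IH N hbar_var k_var
  "\<lambda>p. free_gen (Perm p)" "\<lambda>i. free_gen (GX i)" "\<lambda>i. free_gen (GXinv i)" "\<lambda>i. free_gen (GY i)"
proof
  show "\<forall>x\<in>daha_relations N. fst x - snd x \<in> IH"
    using H.rel_ideal(2)[OF H_rels_C] by (auto simp: IH_def)
qed (rule N_pos UNIV_I H_gens; assumption?)+

text \<open>Letters of \<^typ>\<open>cyc_gen\<close> are also used for the degenerate DAHA over the ring of parameters, with
  \<open>CD i\<close> standing for the inverse of \<open>CX i\<close>.\<close>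

definition IZ where "IZ = {f \<in> Z.C. \<forall>m. Poly_Mapping.lookup (comp.ev f) m \<in> IH}"

text \<open>Both parts of m are supported in the support of m and bounded by it. Finiteness keeps
  \<open>finsum\<close> in the product of \<open>mpoly_ring\<close> from taking its default
  value.\<close>

lemma finite_antidiagonal: "finite {x :: (nat \<Rightarrow>\<^sub>0 nat) \<times> (nat \<Rightarrow>\<^sub>0 nat). fst x + snd x = m}"
proof -
  let ?B = "\<Union>i\<in>Poly_Mapping.keys m. {..Poly_Mapping.lookup m i}"
  have "finite {f. \<forall>i. (i \<in> Poly_Mapping.keys m \<longrightarrow> f i \<in> ?B) \<and> (i \<notin> Poly_Mapping.keys m \<longrightarrow> f i = 0)}" (is "finite ?F")
    by (rule finite_set_of_finite_funs) auto
  moreover have "inj_on Poly_Mapping.lookup (UNIV :: (nat \<Rightarrow>\<^sub>0 nat) set)" by (simp add: inj_on_def lookup_inject)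
  moreover have mem: "Poly_Mapping.lookup a \<in> ?F" if "a + b = m" for a b
  proof (intro CollectI allI conjI impI)
    fix i
    show "Poly_Mapping.lookup a i \<in> ?B" if "i \<in> Poly_Mapping.keys m"
      using that \<open>a + b = m\<close> by (intro UN_I[of i]) (auto simp: lookup_add)
    show "Poly_Mapping.lookup a i = 0" if "i \<notin> Poly_Mapping.keys m"
      using that \<open>a + b = m\<close> by (auto simp: in_keys_iff lookup_add)
  qed
  have "Poly_Mapping.lookup ` {a. \<exists>b. a + b = m} \<subseteq> ?F"
  proof (rule image_subsetI)
    fix a assume "a \<in> {a. \<exists>b. a + b = m}"
    then obtain b where "a + b = m" by blast
    then show "Poly_Mapping.lookup a \<in> ?F" by (rule mem)
  qed
  ultimately have fin: "finite {a. \<exists>b. a + b = m}"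
    by (metis (no_types, lifting) finite_imageD finite_subset inj_on_subset subset_UNIV)
  have "{x. fst x + snd x = m} \<subseteq> {a. \<exists>b. a + b = m} \<times> {a. \<exists>b. a + b = m}"
  proof
    fix x assume "x \<in> {x. fst x + snd x = m}"
    then have "fst x + snd x = m" "snd x + fst x = m" by (simp_all add: add.commute)
    then show "x \<in> {a. \<exists>b. a + b = m} \<times> {a. \<exists>b. a + b = m}" by (cases x) auto
  qed
  then show ?thesis using fin by (meson finite_SigmaI finite_subset)
qed

text \<open>The convolution product, put into the shape of the product of
  \<open>mpoly_ring\<close>.\<close>

lemma lookup_mult_antidiagonal:
  fixes p q :: "(nat \<Rightarrow>\<^sub>0 nat) \<Rightarrow>\<^sub>0 'a::ring_1"
  shows "Poly_Mapping.lookup (p * q) m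
    = (\<Sum>x\<in>{x. fst x + snd x = m}. Poly_Mapping.lookup p (fst x) * Poly_Mapping.lookup q (snd x))"
proof -
  let ?D = "Poly_Mapping.keys p \<times> Poly_Mapping.keys q"
  let ?f = "\<lambda>x. Poly_Mapping.lookup p (fst x) * Poly_Mapping.lookup q (snd x)"
  have "Poly_Mapping.lookup (p * q) m = (\<Sum>x\<in>?D. if fst x + snd x = m then ?f x else 0)"
    unfolding mult_expand[of p q] lookup_sum sum.cartesian_product
    by (intro sum.cong) (auto simp: lookup_single when_def)
  also have "\<dots> = (\<Sum>x\<in>{x \<in> ?D. fst x + snd x = m}. ?f x)"
    by (rule sum.inter_filter[symmetric]) simp
  also have "\<dots> = (\<Sum>x\<in>{x. fst x + snd x = m}. ?f x)"
    by (rule sum.mono_neutral_left[OF finite_antidiagonal]) (auto simp: in_keys_iff)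
  finally show ?thesis .
qed

lemma lookup_comp_C: "f \<in> Z.C \<Longrightarrow> Poly_Mapping.lookup (comp.ev f) m \<in> H.C"
  unfolding lookup_comp
proof (intro H.C_sum H.C_single)
  fix w assume f: "f \<in> Z.C" "w \<in> Poly_Mapping.keys f"
  then have "set w \<subseteq> cyc_gens N" unfolding Z.C_iff by blast
  moreover have "daha_letter g \<in> daha_gens N" if "g \<in> cyc_gens N" for g
    using that by (auto simp: cyc_gens_def daha_gens_def)
  ultimately show "set (map daha_letter w) \<subseteq> daha_gens N" by auto
qed simp

lemma ideal_IZ: "ideal IZ Z.F"
proof -
  interpret ring Z.F by (rule Z.ring_F)
  show ?thesis
  proof (rule idealI)
    show "subgroup IZ (add_monoid Z.F)"
    proof (rule add.subgroupI)
      have "0 \<in> IZ" by (simp add: IZ_def Z.C_0 H.I_0)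
      then show "IZ \<noteq> {}" by auto
    qed (auto simp: IZ_def Z.F_a_inv Z.F_a_inv[unfolded a_inv_def] comp.ev_uminus comp.ev_add Z.C_uminus
        Z.C_add H.I_uminus H.I_add lookup_add)
  qed (auto simp: IZ_def ring_axioms comp.ev_mult lookup_mult_antidiagonal Z.C_mult lookup_comp_C
      intro!: H.I_sum intro: H.I_lmult H.I_rmult)
qed

text \<open>The parameter l is 0 here although the scalars contain z_1, ..., z_l:
  \<open>CD i\<close> stands for X_i^{-1} and has weight 0.\<close>

sublocale Z: cyc_rel_ideal "coeffs_z l" N IZ 0 "hk_const hbar_var" "hk_const k_var" z_var
proof (intro cyc_rel_ideal.intro weighted_words.intro free_alg_ideal.intro free_alg_ideal_axioms.intro
    cyc_rel_ideal_axioms.intro Z.free_alg_axioms ideal_IZ)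
  let ?R = "cyclotomic_rels N 0 (free_const (hk_const hbar_var)) (free_const (hk_const k_var))
    (\<lambda>i. free_const (z_var i)) (\<lambda>p. free_gen (CPerm p)) (\<lambda>i. free_gen (CY i)) (\<lambda>i. free_gen (CX i)) (\<lambda>i. free_gen (CD i))"
  have hk: "comp_const (hk_const c) = Poly_Mapping.single 0 (free_const c)" for c
    by (simp add: hk_const_def comp_const_single)
  have one: "(1 :: daha_z_free) = Poly_Mapping.single 0 1" by simp
  have zero: "(0 :: daha_z_free) = Poly_Mapping.single 0 0" by simp
  have empty: "{1..0::nat} = {}" "[1..<0 + 1] = []" by simp_all
  \<comment> \<open>For l = 0 the relations are free of z, so their images have a component at the
    monomial 1 only, and that lies in \<open>IH\<close> by \<open>cyclotomic_rels_0\<close>.\<close>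
  have "\<forall>x\<in>?R. comp.ev (fst x) - comp.ev (snd x) \<in> Poly_Mapping.single 0 ` IH"
    using H.cyclotomic_rels_0
    unfolding cyclotomic_rels_all[where P = "\<lambda>a b. a - b \<in> IH"]
      cyclotomic_rels_all[where P = "\<lambda>a b. comp.ev a - comp.ev b \<in> Poly_Mapping.single 0 ` IH"]
      empty sum.empty list.map prod_list.Nil
      comp.ev_mult comp.ev_diff comp.ev_add comp.ev_uminus comp.ev_sum comp.ev_0 comp.ev_1 comp.ev_gen
      comp.ev_const hk daha_letter.simps one zero single_0_simps single_0_sum inj_image_mem_iff[OF inj_single] .
  then have "comp.ev (fst x - snd x) \<in> Poly_Mapping.single 0 ` IH" if "x \<in> ?R" for x
    using that by (simp only: comp.ev_diff)
  moreover have "Poly_Mapping.lookup f m \<in> IH" if "f \<in> Poly_Mapping.single 0 ` IH" for f and m :: "nat \<Rightarrow>\<^sub>0 nat"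
    using that by (auto simp: lookup_single when_def H.I_0)
  moreover have "\<forall>x\<in>?R. fst x \<in> Z.C \<and> snd x \<in> Z.C"
    by (rule Z.C_cyclotomic_rels[OF N_pos]) (auto intro: Z_gens Z_consts)
  ultimately show "\<forall>x\<in>?R. fst x - snd x \<in> IZ" by (auto simp: IZ_def Z.C_diff)
qed (use N_pos in \<open>auto simp: hk_const_coeffs_z z_var_coeffs_z\<close>)

end

section \<open>The two representations over the ring of parameters, for l = 0 and for the given
  l\<close>

context daha_setup
begin

text \<open>Both share the operators for permutations, X and Y; l enters only through the operator
  of \<open>CD i\<close>, which is X_i^{-1} in \<open>R0\<close> and D_i in
  \<open>Rl\<close>.\<close>

sublocale R0: cherednik_rep N "hk_const hbar_var" "hk_const k_var" z_var 0 .
sublocale Rl: cherednik_rep N "hk_const hbar_var" "hk_const k_var" z_var l .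

fun opH :: "daha_gen \<Rightarrow> (basis, coeff_hkz) endo" where
  "opH (Perm p) = T_op p" | "opH (GX i) = X_op i" | "opH (GXinv i) = Xinv_op i" | "opH (GY i) = R0.Y i"

sublocale HR: alg_hom "\<lambda>c. scalar_op (hk_const c) :: (basis, coeff_hkz) endo" opH
proof
  fix x y :: coeff_hk
  show "scalar_op (hk_const (x + y)) = scalar_op (hk_const x) + (scalar_op (hk_const y) :: (basis, coeff_hkz) endo)"
    by (simp add: hk_const_def single_add)
  have "hk_const (x * y) = hk_const x * hk_const y" by (simp add: hk_const_def mult_single)
  then show "scalar_op (hk_const (x * y)) = scalar_op (hk_const x) * (scalar_op (hk_const y) :: (basis, coeff_hkz) endo)"
    by simp
  show "scalar_op (hk_const 1) = (1 :: (basis, coeff_hkz) endo)" by (simp add: hk_const_def)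
qed (rule scalar_op_commute)

lemma HR_IH: "x \<in> IH \<Longrightarrow> HR.ev x = 0"
  unfolding IH_def
proof (erule HR.ev_rel_ideal[OF H.free_alg_axioms H_rels_C, rotated])
  show "\<forall>x\<in>daha_relations N. HR.ev (fst x) = HR.ev (snd x)"
  proof (rule HR.ev_daha_rels)
    show "\<forall>x\<in>daha_rels N (HR.ev (free_const hbar_var)) (HR.ev (free_const k_var))
        (\<lambda>p. HR.ev (free_gen (Perm p))) (\<lambda>i. HR.ev (free_gen (GX i))) (\<lambda>i. HR.ev (free_gen (GXinv i)))
        (\<lambda>i. HR.ev (free_gen (GY i))). fst x = snd x"
      unfolding HR.ev_const HR.ev_gen opH.simps using R0.daha_rels_hold by force
  qed
qed

lemma R0_D: "R0.D i = Xinv_op i"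
  by (simp add: R0.D_def R0.cyc_def)

lemma opH_letter: "opH (daha_letter g) = R0.op_gen g"
  by (cases g) (simp_all add: R0_D)

text \<open>Collecting by monomials of z gives the action as the sum of z^m times the action of the
  component at m. Since components in \<open>IH\<close> act by zero, so does
  \<open>IZ\<close>.\<close>

lemma R0_ev_components:
  "R0.ev f = (\<Sum>m\<in>(\<Union>w\<in>Poly_Mapping.keys f. Poly_Mapping.keys (Poly_Mapping.lookup f w)).
    scalar_op (Poly_Mapping.single m 1) * HR.ev (Poly_Mapping.lookup (comp.ev f) m))"
proof -
  let ?M = "\<Union>w\<in>Poly_Mapping.keys f. Poly_Mapping.keys (Poly_Mapping.lookup f w)"
  let ?c = "\<lambda>w m. Poly_Mapping.lookup (Poly_Mapping.lookup f w) m"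
  let ?p = "\<lambda>w. prod_list (map R0.op_gen w)"
  have scalar_sum: "scalar_op (\<Sum>i\<in>A. g i) = (\<Sum>i\<in>A. scalar_op (g i) :: (basis, coeff_hkz) endo)"
    for A :: "(nat \<Rightarrow>\<^sub>0 nat) set" and g
    by (induct A rule: infinite_finite_induct) auto
  have fin: "finite ?M" by simp
  have "scalar_op (Poly_Mapping.lookup f w) = (\<Sum>m\<in>?M. scalar_op (Poly_Mapping.single m 1) *
      (scalar_op (hk_const (?c w m)) :: (basis, coeff_hkz) endo))" if "w \<in> Poly_Mapping.keys f" for w
  proof -
    have "Poly_Mapping.lookup f w = (\<Sum>m\<in>Poly_Mapping.keys (Poly_Mapping.lookup f w). Poly_Mapping.single m (?c w m))"
      by (simp only: pm_expand)
    also have "\<dots> = (\<Sum>m\<in>?M. Poly_Mapping.single m (?c w m))"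
      by (rule sum.mono_neutral_left[OF fin]) (use that in \<open>auto simp: in_keys_iff\<close>)
    also have "\<dots> = (\<Sum>m\<in>?M. Poly_Mapping.single m 1 * hk_const (?c w m))"
      by (simp add: hk_const_def mult_single)
    finally have e: "Poly_Mapping.lookup f w = (\<Sum>m\<in>?M. Poly_Mapping.single m 1 * hk_const (?c w m))" .
    show ?thesis
      by (rule trans[OF arg_cong[where f = scalar_op, OF e]]) (simp only: scalar_sum scalar_op_simps)
  qed
  then have "R0.ev f = (\<Sum>w\<in>Poly_Mapping.keys f. \<Sum>m\<in>?M. scalar_op (Poly_Mapping.single m 1) *
      (scalar_op (hk_const (?c w m)) * ?p w))"
    unfolding R0.ev_def by (intro sum.cong refl) (simp only: sum_distrib_right mult.assoc)
  also have "\<dots> = (\<Sum>m\<in>?M. scalar_op (Poly_Mapping.single m 1) * (\<Sum>w\<in>Poly_Mapping.keys f. scalar_op (hk_const (?c w m)) * ?p w))"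
    by (subst sum.swap) (simp only: sum_distrib_left)
  also have "\<dots> = (\<Sum>m\<in>?M. scalar_op (Poly_Mapping.single m 1) * HR.ev (Poly_Mapping.lookup (comp.ev f) m))"
    by (intro sum.cong refl) (simp add: lookup_comp HR.ev_sum HR.ev_single opH_letter comp_def)
  finally show ?thesis .
qed

sublocale Z: cyc_rep_words "coeffs_z l" N IZ 0 "hk_const hbar_var" "hk_const k_var" z_var
proof (intro cyc_rep_words.intro Z.cyc_words_axioms cyc_rep_words_axioms.intro)
  fix f assume "f \<in> IZ"
  then have "HR.ev (Poly_Mapping.lookup (comp.ev f) m) = 0" for m by (intro HR_IH) (simp add: IZ_def)
  then show "R0.ev f = 0" unfolding R0_ev_components by simp
qed

definition IC where "IC = rel_ideal (cyc_free N l) (cyc_relations N l)"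

lemma C_rels_C: "\<forall>x\<in>cyc_relations N l. fst x \<in> Z.C \<and> snd x \<in> Z.C"
  by (rule Z.C_cyclotomic_rels[OF N_pos]) (auto intro: Z_gens Z_consts)

sublocale CR: cyc_rel_ideal "coeffs_z l" N IC l "hk_const hbar_var" "hk_const k_var" z_var
proof (intro cyc_rel_ideal.intro weighted_words.intro free_alg_ideal.intro free_alg_ideal_axioms.intro
    cyc_rel_ideal_axioms.intro Z.free_alg_axioms)
  show "ideal IC Z.F" unfolding IC_def by (rule Z.rel_ideal(1)[OF C_rels_C])
  show "\<forall>x\<in>cyc_relations N l. fst x - snd x \<in> IC"
    using Z.rel_ideal(2)[OF C_rels_C] by (auto simp: IC_def)
qed (use N_pos in \<open>auto simp: hk_const_coeffs_z z_var_coeffs_z\<close>)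

sublocale CR: cyc_rep_words "coeffs_z l" N IC l "hk_const hbar_var" "hk_const k_var" z_var
proof (intro cyc_rep_words.intro CR.cyc_words_axioms cyc_rep_words_axioms.intro)
  have "\<forall>x\<in>cyc_relations N l. Rl.ev (fst x) = Rl.ev (snd x)"
  proof (rule Rl.ev_cyclotomic_rels)
    show "\<forall>x\<in>cyclotomic_rels N l (Rl.ev (free_const (hk_const hbar_var))) (Rl.ev (free_const (hk_const k_var)))
        (\<lambda>i. Rl.ev (free_const (z_var i))) (\<lambda>p. Rl.ev (free_gen (CPerm p))) (\<lambda>i. Rl.ev (free_gen (CY i)))
        (\<lambda>i. Rl.ev (free_gen (CX i))) (\<lambda>i. Rl.ev (free_gen (CD i))). fst x = snd x"
      unfolding Rl.ev_const Rl.ev_gen Rl.op_gen.simps using Rl.cyclotomic_rels_hold[OF N_pos] by force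
  qed
  then show "f \<in> IC \<Longrightarrow> Rl.ev f = 0" for f
    unfolding IC_def using Rl.ev_rel_ideal[OF free_alg_coeffs_z C_rels_C] by blast
qed

section \<open>Substitution of the cyclotomic D_i into the DAHA\<close>

section \<open>Comparison of the two presentations\<close>

abbreviation cyc_word where
  "cyc_word \<equiv> prod_list (map (\<lambda>r. free_gen (CY 1) - free_const (z_var r)) [1..<l+1])"

text \<open>\<open>CD i\<close> denotes \<open>D\<^sub>i\<close> on the left but the inverse of \<open>X\<^sub>i\<close> on the right.\<close>

fun chi_gen :: "cyc_gen \<Rightarrow> (cyc_gen list \<Rightarrow>\<^sub>0 coeff_hkz)" where
  "chi_gen (CPerm p) = free_gen (CPerm p)"
| "chi_gen (CY i) = free_gen (CY i)"
| "chi_gen (CX i) = free_gen (CX i)"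
| "chi_gen (CD i) = free_gen (CPerm (transpose 1 i)) * (free_gen (CD 1) * (cyc_word * free_gen (CPerm (transpose 1 i))))"

sublocale chi: alg_hom free_const chi_gen
  by (standard, rule free_const_simps, rule free_const_simps, rule free_const_simps, rule free_const_commute)

lemma one_mem: "1 \<in> {1..N}"
  using N_pos by simp

lemma transpose_1_perm: "i \<in> {1..N} \<Longrightarrow> transpose 1 i permutes {1..N}"
  by (rule transpose_permutes[OF one_mem])

lemma cyc_word_C: "cyc_word \<in> Z.C"
  using one_mem by (intro Z.C_prod_list_map Z.C_diff Z_gens Z_consts) auto

lemma chi_gen_C: "g \<in> cyc_gens N \<Longrightarrow> chi_gen g \<in> Z.C"
proof (cases g)
  case (CD i)
  assume "g \<in> cyc_gens N"
  then have "i \<in> {1..N}" using CD by (auto simp: cyc_gens_def)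
  then show ?thesis unfolding CD chi_gen.simps
    by (intro Z.C_mult Z_gens transpose_1_perm one_mem cyc_word_C)
qed (auto simp: Z.C_gen)

lemma chi_C: "f \<in> Z.C \<Longrightarrow> chi.ev f \<in> Z.C"
  unfolding chi.ev_def
proof (intro Z.C_sum Z.C_mult Z.C_const Z.C_prod_list_map chi_gen_C)
  fix w assume f: "f \<in> Z.C" "w \<in> Poly_Mapping.keys f"
  then show "Poly_Mapping.lookup f w \<in> coeffs_z l" by (simp add: Z.C_iff)
  show "g \<in> cyc_gens N" if "g \<in> set w" for g using f that unfolding Z.C_iff by blast
qed

text \<open>In the representation D_i = s_{1i} D_1 s_{1i}, and D_1 is X_1^{-1} times the product of
  the Y_1 - z_r because U_1 = Y_1.\<close>

lemma R0_chi_gen: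
  assumes "g \<in> cyc_gens N"
  shows "R0.ev (chi_gen g) = Rl.op_gen g"
proof (cases g)
  case (CD i)
  then have i: "i \<in> {1..N}" using assms by (auto simp: cyc_gens_def)
  let ?t = "transpose 1 i"
  have "R0.ev cyc_word = Rl.cyc (Rl.U 1)"
    unfolding Rl.cyc_def Rl.Y_1[symmetric]
    by (simp add: R0.ev_prod_list R0.ev_diff R0.ev_gen R0.ev_const del: upt_Suc)
  then have "R0.ev (chi_gen g) = T_op ?t * Rl.D 1 * T_op ?t"
    unfolding CD chi_gen.simps R0.ev_mult R0.ev_gen R0.op_gen.simps R0_D Rl.D_def by (simp only: mult.assoc)
  also have "\<dots> = Rl.D i * (T_op ?t * T_op ?t)"
    unfolding Rl.T_D[OF transpose_1_perm[OF i] one_mem] transpose_apply_first by (simp only: mult.assoc)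
  also have "\<dots> = Rl.D i" unfolding R0.T_transpose_sq[OF one_mem i] by simp
  finally show ?thesis by (simp only: CD Rl.op_gen.simps)
qed (simp_all add: R0.ev_gen)

lemma R0_chi:
  assumes "f \<in> Z.C"
  shows "R0.ev (chi.ev f) = Rl.ev f"
  unfolding chi.ev_def Rl.ev_def R0.ev_sum R0.ev_mult R0.ev_const R0.ev_prod_list
proof (intro sum.cong refl arg_cong2[where f = "(*)"] arg_cong[where f = prod_list] map_cong)
  fix w g assume "w \<in> Poly_Mapping.keys f" "g \<in> set w"
  then have "g \<in> cyc_gens N" using assms unfolding Z.C_iff by blast
  then show "R0.ev (chi_gen g) = Rl.op_gen g" by (rule R0_chi_gen)
qed

text \<open>Each ideal is the kernel of its representation, and \<open>R0\<close> after the
  substitution is \<open>Rl\<close>. One direction says that the substitution respects the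
  relations, the other that it is injective on the quotient.\<close>

theorem chi_mem_IZ_iff:
  assumes "f \<in> Z.C"
  shows "chi.ev f \<in> IZ \<longleftrightarrow> f \<in> IC"
  using Z.ev_I[of "chi.ev f"] Z.ev_kernel[OF chi_C[OF assms]] CR.ev_I[of f] CR.ev_kernel[OF assms]
  unfolding R0_chi[OF assms] by blast

end

lemma (in free_alg) C_induct:
  assumes "f \<in> C" and "P 0" and add: "\<And>x y. x \<in> C \<Longrightarrow> y \<in> C \<Longrightarrow> P x \<Longrightarrow> P y \<Longrightarrow> P (x + y)"
    and mult: "\<And>x y. x \<in> C \<Longrightarrow> y \<in> C \<Longrightarrow> P x \<Longrightarrow> P y \<Longrightarrow> P (x * y)"
    and const: "\<And>c. c \<in> K \<Longrightarrow> P (free_const c)" and gen: "\<And>g. g \<in> G \<Longrightarrow> P (free_gen g)"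
  shows "P f"
proof -
  have word: "P (Poly_Mapping.single w 1)" if "set w \<subseteq> G" for w
    using that
  proof (induction w)
    case Nil
    then show ?case using const[OF K_1] by (simp add: free_const_simps)
  next
    case (Cons g w)
    then show ?case unfolding single_Cons by (intro mult C_gen C_single gen K_1) auto
  qed
  have tm: "P (Poly_Mapping.single w c)" if "set w \<subseteq> G" "c \<in> K" for w c
    using mult[OF C_const[OF that(2)] C_single[OF that(1) K_1] const[OF that(2)] word[OF that(1)]]
    by (simp add: free_const_mult_single)
  have "(\<Sum>w\<in>A. Poly_Mapping.single w (Poly_Mapping.lookup f w)) \<in> C \<and>
      P (\<Sum>w\<in>A. Poly_Mapping.single w (Poly_Mapping.lookup f w))"
    if "finite A" "A \<subseteq> Poly_Mapping.keys f" for A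
    using that
  proof (induction A rule: finite_induct)
    case (insert w A)
    have "set w \<subseteq> G" "Poly_Mapping.lookup f w \<in> K" using insert.prems assms(1) unfolding C_iff by blast+
    then show ?case
      using insert by (auto intro!: add C_add C_single tm)
  qed (simp add: C_0 assms(2))
  from this[OF finite_keys order_refl] show ?thesis by (simp only: pm_expand)
qed

section \<open>The polynomial ring over the DAHA as a quotient of the free algebra\<close>

context daha_setup
begin

abbreviation Q where "Q \<equiv> degenerate_daha N"
abbreviation S where "S \<equiv> daha_z_ring N l"
abbreviation cl where "cl \<equiv> daha_class N"

lemma Q_eq: "Q = H.F Quot IH"
  by (simp add: degenerate_daha_def presented_algebra_def IH_def)

lemma cl_eq: "cl = (\<lambda>x. IH +>\<^bsub>H.F\<^esub> x)"
  by (simp add: fun_eq_iff daha_class_def presented_class_def IH_def)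

lemma ring_Q: "ring Q"
  unfolding Q_eq by (rule ideal.quotient_is_ring[OF H.ideal_I])

lemma cl_hom: "cl \<in> ring_hom H.F Q"
  unfolding Q_eq cl_eq by (rule ideal.rcos_ring_hom[OF H.ideal_I])

lemma cl_simps:
  "x \<in> H.C \<Longrightarrow> cl x \<in> carrier Q"
  "x \<in> H.C \<Longrightarrow> y \<in> H.C \<Longrightarrow> cl (x + y) = cl x \<oplus>\<^bsub>Q\<^esub> cl y"
  "x \<in> H.C \<Longrightarrow> y \<in> H.C \<Longrightarrow> cl (x * y) = cl x \<otimes>\<^bsub>Q\<^esub> cl y"
  "cl 1 = \<one>\<^bsub>Q\<^esub>"
  using ring_hom_closed[OF cl_hom] ring_hom_add[OF cl_hom] ring_hom_mult[OF cl_hom] ring_hom_one[OF cl_hom]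
  by simp_all

lemma cl_eq_0_iff: "x \<in> H.C \<Longrightarrow> cl x = \<zero>\<^bsub>Q\<^esub> \<longleftrightarrow> x \<in> IH"
  using ideal.rcos_const_imp_mem[OF H.ideal_I, of x] ring.a_rcos_zero[OF H.ring_F H.ideal_I, of x]
  unfolding Q_eq cl_eq by (auto simp: FactRing_def)

lemma cl_0: "cl 0 = \<zero>\<^bsub>Q\<^esub>"
  using cl_eq_0_iff[OF H.C_0] H.I_0 by simp

lemma cl_cong:
  assumes "x \<in> H.C" "y \<in> H.C" "x - y \<in> IH"
  shows "cl x = cl y"
proof -
  interpret Q: ring Q by (rule ring_Q)
  have "cl x = cl ((x - y) + y)" by simp
  also have "\<dots> = cl (x - y) \<oplus>\<^bsub>Q\<^esub> cl y" by (rule cl_simps(2)) (use assms H.C_diff in auto)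
  also have "cl (x - y) = \<zero>\<^bsub>Q\<^esub>" using cl_eq_0_iff[OF H.C_diff[OF assms(1,2)]] assms(3) by simp
  finally show ?thesis using cl_simps(1)[OF assms(2)] by simp
qed

lemma cl_finsum:
  assumes "finite A" "\<And>x. x \<in> A \<Longrightarrow> f x \<in> H.C"
  shows "finsum Q (\<lambda>x. cl (f x)) A = cl (\<Sum>x\<in>A. f x)"
  using assms
proof (induction A rule: finite_induct)
  case empty
  interpret Q: ring Q by (rule ring_Q)
  show ?case by (simp add: cl_0)
next
  case (insert a A)
  interpret Q: ring Q by (rule ring_Q)
  have "finsum Q (\<lambda>x. cl (f x)) (insert a A) = cl (f a) \<oplus>\<^bsub>Q\<^esub> finsum Q (\<lambda>x. cl (f x)) A"
    using insert by (intro Q.finsum_insert) (auto intro: cl_simps(1))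
  also have "\<dots> = cl (f a + (\<Sum>x\<in>A. f x))"
    using insert by (simp add: cl_simps(2) H.C_sum)
  finally show ?case using insert by simp
qed

text \<open>The quotient map onto \<open>daha_z_ring\<close>, with kernel \<open>IZ\<close>: each
  component goes to its class in the DAHA.\<close>

definition Theta :: "(cyc_gen list \<Rightarrow>\<^sub>0 coeff_hkz) \<Rightarrow> daha_z"
  where "Theta f = (\<lambda>m. cl (Poly_Mapping.lookup (comp.ev f) m))"

lemma S_simps:
  "carrier S = {f. (\<forall>m. f m \<in> carrier Q) \<and> finite {m. f m \<noteq> \<zero>\<^bsub>Q\<^esub>} \<and>
    (\<forall>m. f m \<noteq> \<zero>\<^bsub>Q\<^esub> \<longrightarrow> Poly_Mapping.keys m \<subseteq> {1..l})}"
  "mult S = (\<lambda>f g m. \<Oplus>\<^bsub>Q\<^esub>p \<in> {p. fst p + snd p = m}. f (fst p) \<otimes>\<^bsub>Q\<^esub> g (snd p))"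
  "one S = (\<lambda>m. if m = 0 then \<one>\<^bsub>Q\<^esub> else \<zero>\<^bsub>Q\<^esub>)" "zero S = (\<lambda>m. \<zero>\<^bsub>Q\<^esub>)"
  "add S = (\<lambda>f g m. f m \<oplus>\<^bsub>Q\<^esub> g m)"
  unfolding daha_z_ring_def mpoly_ring_def by simp_all

lemma Theta_carrier:
  assumes f: "f \<in> Z.C"
  shows "Theta f \<in> carrier S"
proof -
  have nz: "Poly_Mapping.lookup (comp.ev f) m \<noteq> 0" if "Theta f m \<noteq> \<zero>\<^bsub>Q\<^esub>" for m
    using that unfolding Theta_def by (metis cl_0)
  have "{m. Theta f m \<noteq> \<zero>\<^bsub>Q\<^esub>} \<subseteq> Poly_Mapping.keys (comp.ev f)"
    by (rule subsetI) (simp only: mem_Collect_eq in_keys_iff nz not_False_eq_True)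
  then have "finite {m. Theta f m \<noteq> \<zero>\<^bsub>Q\<^esub>}" by (rule finite_subset) simp
  moreover have "Poly_Mapping.keys m \<subseteq> {1..l}" if m: "Theta f m \<noteq> \<zero>\<^bsub>Q\<^esub>" for m
  proof -
    obtain w where "w \<in> Poly_Mapping.keys f" "Poly_Mapping.lookup (Poly_Mapping.lookup f w) m \<noteq> 0"
      using nz[OF m] unfolding lookup_comp by (metis (no_types, lifting) single_zero sum.neutral)
    moreover have "Poly_Mapping.lookup f w \<in> coeffs_z l" using f by (simp add: Z.C_iff)
    ultimately show ?thesis by (auto simp: coeffs_z_def in_keys_iff)
  qed
  ultimately show ?thesis unfolding S_simps(1) using cl_simps(1)[OF lookup_comp_C[OF f]] by (auto simp: Theta_def)
qed

lemma Theta_hom: "Theta \<in> ring_hom Z.F S"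
proof (rule ring_hom_memI)
  fix x y assume "x \<in> Z.C" "y \<in> Z.C"
  note C = lookup_comp_C[OF \<open>x \<in> Z.C\<close>] lookup_comp_C[OF \<open>y \<in> Z.C\<close>]
  show "Theta (x \<oplus>\<^bsub>Z.F\<^esub> y) = Theta x \<oplus>\<^bsub>S\<^esub> Theta y"
    by (simp add: Theta_def S_simps comp.ev_add lookup_add cl_simps(2) C)
  have "(\<Oplus>\<^bsub>Q\<^esub>p\<in>{p. fst p + snd p = m}. cl (Poly_Mapping.lookup (comp.ev x) (fst p)) \<otimes>\<^bsub>Q\<^esub> cl (Poly_Mapping.lookup (comp.ev y) (snd p)))
      = cl (Poly_Mapping.lookup (comp.ev x * comp.ev y) m)" for m
    unfolding lookup_mult_antidiagonal cl_simps(3)[OF C, symmetric]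
    by (rule cl_finsum[OF finite_antidiagonal]) (intro H.C_mult C)
  then show "Theta (x \<otimes>\<^bsub>Z.F\<^esub> y) = Theta x \<otimes>\<^bsub>S\<^esub> Theta y"
    by (simp add: Theta_def S_simps comp.ev_mult)
next
  show "Theta \<one>\<^bsub>Z.F\<^esub> = \<one>\<^bsub>S\<^esub>"
    by (auto simp: Theta_def S_simps comp.ev_1 lookup_one when_def cl_simps(4) cl_0 fun_eq_iff)
qed (simp add: Theta_carrier)

fun cyc_letter :: "daha_gen \<Rightarrow> cyc_gen" where
  "cyc_letter (Perm p) = CPerm p" | "cyc_letter (GX i) = CX i" | "cyc_letter (GXinv i) = CD i" | "cyc_letter (GY i) = CY i"

text \<open>A right inverse of \<open>comp.ev\<close> on elements free of z, from which surjectivity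
  of \<open>Theta\<close> follows.\<close>

definition lift_daha :: "(daha_gen list \<Rightarrow>\<^sub>0 coeff_hk) \<Rightarrow> (cyc_gen list \<Rightarrow>\<^sub>0 coeff_hkz)"
  where "lift_daha x = (\<Sum>w\<in>Poly_Mapping.keys x. Poly_Mapping.single (map cyc_letter w) (hk_const (Poly_Mapping.lookup x w)))"

lemma comp_lift: "comp.ev (lift_daha x) = Poly_Mapping.single 0 x"
proof -
  have "daha_letter (cyc_letter g) = g" for g by (cases g) simp_all
  then have "prod_list (map (\<lambda>g. Poly_Mapping.single 0 (free_gen (daha_letter g)) :: daha_z_free) (map cyc_letter w))
      = Poly_Mapping.single 0 (Poly_Mapping.single w 1)" for w
    using single_0_prod_list[of "free_gen :: daha_gen \<Rightarrow> daha_gen list \<Rightarrow>\<^sub>0 coeff_hk" w]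
      prod_list_free_gen[of w, where 'k = coeff_hk] by (simp add: comp_def)
  then have "comp.ev (lift_daha x) = Poly_Mapping.single 0 (\<Sum>w\<in>Poly_Mapping.keys x. Poly_Mapping.single w (Poly_Mapping.lookup x w))"
    unfolding lift_daha_def comp.ev_sum comp.ev_single
    by (simp add: hk_const_def comp_const_single single_0_simps free_const_mult_single single_0_sum)
  then show ?thesis by (simp only: pm_expand)
qed

lemma lift_daha_C: "x \<in> H.C \<Longrightarrow> lift_daha x \<in> Z.C"
  unfolding lift_daha_def
proof (intro Z.C_sum Z.C_single hk_const_coeffs_z)
  fix w assume x: "x \<in> H.C" "w \<in> Poly_Mapping.keys x"
  then have "set w \<subseteq> daha_gens N" unfolding H.C_iff by blast
  moreover have "cyc_letter g \<in> cyc_gens N" if "g \<in> daha_gens N" for g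
    using that by (auto simp: cyc_gens_def daha_gens_def)
  ultimately show "set (map cyc_letter w) \<subseteq> cyc_gens N" by auto
qed

text \<open>Coefficients are lifted one by one and multiplied by their monomials in z. This also
  yields the ring axioms for \<open>daha_z_ring\<close>, as the image of a ring under a
  homomorphism.\<close>

lemma Theta_surj: "Theta ` Z.C = carrier S"
proof
  show "Theta ` Z.C \<subseteq> carrier S" using Theta_carrier by blast
  show "carrier S \<subseteq> Theta ` Z.C"
  proof
    fix f assume f: "f \<in> carrier S"
    define M where "M = {m. f m \<noteq> \<zero>\<^bsub>Q\<^esub>}"
    have M: "finite M" "m \<in> M \<Longrightarrow> Poly_Mapping.keys m \<subseteq> {1..l}" for m
      using f by (auto simp: S_simps M_def)
    have "\<exists>x\<in>H.C. cl x = f m" for m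
    proof -
      have "f m \<in> carrier (H.F Quot IH)" using f by (simp add: S_simps Q_eq)
      then show ?thesis unfolding FactRing_def A_RCOSETS_def' cl_eq by auto
    qed
    then obtain r where r: "r m \<in> H.C" "cl (r m) = f m" for m by metis
    define g where "g = (\<Sum>m\<in>M. free_const (Poly_Mapping.single m 1) * lift_daha (r m))"
    have "g \<in> Z.C"
      unfolding g_def using M(2)
      by (intro Z.C_sum Z.C_mult Z.C_const lift_daha_C r(1)) (auto simp: coeffs_z_def)
    moreover have "Poly_Mapping.lookup (comp.ev g) m = (if m \<in> M then r m else 0)" for m
    proof -
      have "comp.ev g = (\<Sum>m\<in>M. Poly_Mapping.single m (r m))"
        unfolding g_def by (simp add: comp.ev_sum comp.ev_mult comp.ev_const comp_const_single comp_lift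
            mult_single free_const_simps)
      then show ?thesis using M(1) by (simp add: lookup_sum lookup_single when_def sum.delta)
    qed
    then have "Theta g = f" using r(2) cl_0 by (auto simp: Theta_def fun_eq_iff M_def)
    ultimately show "f \<in> Theta ` Z.C" by blast
  qed
qed

lemma Theta_0: "Theta 0 = \<zero>\<^bsub>S\<^esub>"
  by (simp add: Theta_def S_simps cl_0)

lemma ring_S: "ring S"
  using ring.ring_hom_imp_img_ring[OF Z.ring_F Theta_hom] unfolding Theta_surj Z.C_ops(3) Theta_0 by simp

sublocale S: ring S
  by (rule ring_S)

sublocale Theta: ring_hom_ring Z.F S Theta
  by (rule ring_hom_ringI2[OF Z.ring_F ring_S Theta_hom])

lemma Theta_simps:
  "x \<in> Z.C \<Longrightarrow> y \<in> Z.C \<Longrightarrow> Theta (x * y) = Theta x \<otimes>\<^bsub>S\<^esub> Theta y"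
  "x \<in> Z.C \<Longrightarrow> y \<in> Z.C \<Longrightarrow> Theta (x + y) = Theta x \<oplus>\<^bsub>S\<^esub> Theta y"
  "Theta 1 = \<one>\<^bsub>S\<^esub>"
  using ring_hom_mult[OF Theta_hom] ring_hom_add[OF Theta_hom] ring_hom_one[OF Theta_hom] by simp_all

lemma Theta_diff:
  assumes "x \<in> Z.C" "y \<in> Z.C"
  shows "Theta (x - y) = Theta x \<ominus>\<^bsub>S\<^esub> Theta y"
proof -
  have "Theta (- y) = \<ominus>\<^bsub>S\<^esub> Theta y" using Theta.hom_a_inv[OF assms(2)] Z.F_a_inv[OF assms(2)] by simp
  then show ?thesis
    using Theta_simps(2)[OF assms(1) Z.C_uminus[OF assms(2)]] by (simp add: a_minus_def)
qed

lemma Theta_cong: "x \<in> Z.C \<Longrightarrow> y \<in> Z.C \<Longrightarrow> x - y \<in> IZ \<Longrightarrow> Theta x = Theta y"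
  unfolding Theta_def by (rule ext, rule cl_cong[OF lookup_comp_C lookup_comp_C])
    (auto simp: IZ_def comp.ev_diff lookup_minus)

lemma Theta_eq_0_iff: "x \<in> Z.C \<Longrightarrow> Theta x = \<zero>\<^bsub>S\<^esub> \<longleftrightarrow> x \<in> IZ"
  using cl_eq_0_iff[OF lookup_comp_C] by (auto simp: Theta_def S_simps fun_eq_iff IZ_def)

lemma Theta_const: "Theta (free_const c) = daha_z_scalar N c"
  by (simp add: Theta_def daha_z_scalar_def comp.ev_const lookup_comp_const)

lemma Theta_gen: "Theta (free_gen g) = daha_z_elem N (free_gen (daha_letter g))"
  by (auto simp: Theta_def daha_z_elem_def mpoly_const_def comp.ev_gen lookup_single when_def cl_0 fun_eq_iff)

lemma el_eqs:
  "el_perm N p = Theta (free_gen (CPerm p))" "el_X N i = Theta (free_gen (CX i))" "el_Y N i = Theta (free_gen (CY i))"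
  by (simp_all add: Theta_gen el_perm_def el_X_def el_Y_def)

lemma list_prod_Theta: "(\<And>i. i \<in> set xs \<Longrightarrow> f i \<in> Z.C) \<Longrightarrow>
    list_prod S (map (\<lambda>i. Theta (f i)) xs) = Theta (prod_list (map f xs))"
  by (induct xs) (auto simp: list_prod_def Theta_simps Z.C_prod_list_map)

lemma el_cyc_eq: "el_cyc N l = Theta cyc_word"
proof -
  have "el_cyc N l = list_prod S (map (\<lambda>i. Theta (free_gen (CY 1) - free_const (z_var i))) [1..<l+1])"
    unfolding el_cyc_def el_eqs Theta_const[symmetric]
    by (intro arg_cong[where f = "list_prod S"] map_cong refl Theta_diff[symmetric] Z_gens one_mem Z_consts) auto
  also have "\<dots> = Theta cyc_word"
    by (rule list_prod_Theta, intro Z.C_diff Z_gens Z_consts one_mem) auto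
  finally show ?thesis .
qed

lemma Theta_perm_mult:
  assumes "p permutes {1..N}" "q permutes {1..N}"
  shows "Theta (free_gen (CPerm p)) \<otimes>\<^bsub>S\<^esub> Theta (free_gen (CPerm q)) = Theta (free_gen (CPerm (p \<circ> q)))"
  unfolding Theta_simps(1)[OF Z_gens(1) Z_gens(1), OF assms, symmetric]
  by (rule Theta_cong[OF _ _ Z.I_perm[OF assms]]) (intro Z.C_mult Z_gens permutes_compose assms)+

lemma Theta_perm_id: "Theta (free_gen (CPerm id)) = \<one>\<^bsub>S\<^esub>"
  unfolding Theta_simps(3)[symmetric] by (rule Theta_cong[OF Z_gens(1)[OF permutes_id] Z.C_1 Z.I_id])

text \<open>For l = 0 the relations for X_1 D_1 and [D_1, X_1] have right sides 1 and 0.\<close>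

lemma X_D_1: "Theta (free_gen (CX 1)) \<otimes>\<^bsub>S\<^esub> Theta (free_gen (CD 1)) = \<one>\<^bsub>S\<^esub>"
  "Theta (free_gen (CD 1)) \<otimes>\<^bsub>S\<^esub> Theta (free_gen (CX 1)) = \<one>\<^bsub>S\<^esub>"
proof -
  have C: "free_gen (CX 1) \<in> Z.C" "free_gen (CD 1) \<in> Z.C" by (intro Z_gens one_mem)+
  have 1: "free_gen (CX 1) * free_gen (CD 1) - 1 \<in> IZ" using Z.I_X_D by simp
  have 2: "free_gen (CD 1) * free_gen (CX 1) - free_gen (CX 1) * free_gen (CD 1) \<in> IZ" using Z.I_D_X_1 by simp
  show X: "Theta (free_gen (CX 1)) \<otimes>\<^bsub>S\<^esub> Theta (free_gen (CD 1)) = \<one>\<^bsub>S\<^esub>"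
    unfolding Theta_simps(1)[OF C, symmetric] Theta_simps(3)[symmetric]
    by (rule Theta_cong[OF Z.C_mult[OF C] Z.C_1 1])
  show "Theta (free_gen (CD 1)) \<otimes>\<^bsub>S\<^esub> Theta (free_gen (CX 1)) = \<one>\<^bsub>S\<^esub>"
    unfolding X[symmetric] Theta_simps(1)[OF C, symmetric] Theta_simps(1)[OF C(2,1), symmetric]
    by (rule Theta_cong[OF Z.C_mult[OF C(2,1)] Z.C_mult[OF C] 2])
qed

end

section \<open>The generators of the cyclotomic subalgebra, and the isomorphism\<close>

context daha_setup
begin

abbreviation gen_T :: "(nat \<Rightarrow> nat) \<Rightarrow> (cyc_gen list \<Rightarrow>\<^sub>0 coeff_hkz)" where
  "gen_T p \<equiv> free_gen (CPerm p)"

definition cycle_word :: "nat list \<Rightarrow> (cyc_gen list \<Rightarrow>\<^sub>0 coeff_hkz)"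
  where "cycle_word xs = prod_list (map (\<lambda>i. gen_T (transpose i (i+1))) xs)"

lemma adjacent_perm: "i \<in> {1..<N} \<Longrightarrow> transpose i (i+1) permutes {1..N}"
  by (rule transpose_permutes) auto

lemma cycle_word_C: "set xs \<subseteq> {1..<N} \<Longrightarrow> cycle_word xs \<in> Z.C"
  unfolding cycle_word_def by (intro Z.C_prod_list_map Z_gens adjacent_perm) auto

lemma Theta_transpose_sq:
  assumes "i \<in> {1..N}" "j \<in> {1..N}"
  shows "Theta (gen_T (transpose i j)) \<otimes>\<^bsub>S\<^esub> Theta (gen_T (transpose i j)) = \<one>\<^bsub>S\<^esub>"
  unfolding Theta_perm_mult[OF transpose_permutes transpose_permutes, OF assms assms]
    transpose_comp_involutory by (rule Theta_perm_id)

lemma S_mult_cancel: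
  assumes "a \<in> carrier S" "b \<in> carrier S" "c \<in> carrier S" "d \<in> carrier S"
    "a \<otimes>\<^bsub>S\<^esub> d = \<one>\<^bsub>S\<^esub>" "b \<otimes>\<^bsub>S\<^esub> c = \<one>\<^bsub>S\<^esub>"
  shows "(a \<otimes>\<^bsub>S\<^esub> b) \<otimes>\<^bsub>S\<^esub> (c \<otimes>\<^bsub>S\<^esub> d) = \<one>\<^bsub>S\<^esub>"
proof -
  have "(a \<otimes>\<^bsub>S\<^esub> b) \<otimes>\<^bsub>S\<^esub> (c \<otimes>\<^bsub>S\<^esub> d) = a \<otimes>\<^bsub>S\<^esub> (b \<otimes>\<^bsub>S\<^esub> c) \<otimes>\<^bsub>S\<^esub> d"
    using assms(1-4) by (simp add: S.m_assoc)
  then show ?thesis using assms by simp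
qed

text \<open>Each letter is an involution, so the inverse is the reversed word.\<close>

lemma Theta_cycle_word_rev:
  assumes "set xs \<subseteq> {1..<N}"
  shows "Theta (cycle_word xs) \<otimes>\<^bsub>S\<^esub> Theta (cycle_word (rev xs)) = \<one>\<^bsub>S\<^esub>"
  using assms
proof (induction xs)
  case Nil
  then show ?case by (simp add: cycle_word_def Theta_simps(3))
next
  case (Cons i xs)
  let ?t = "gen_T (transpose i (i+1))"
  have i: "i \<in> {1..N}" "i + 1 \<in> {1..N}" and xs: "set xs \<subseteq> {1..<N}" "set (rev xs) \<subseteq> {1..<N}"
    using Cons.prems by auto
  have C: "?t \<in> Z.C" by (rule Z_gens(1)[OF transpose_permutes[OF i]])
  have "cycle_word (i # xs) = ?t * cycle_word xs" "cycle_word (rev (i # xs)) = cycle_word (rev xs) * ?t"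
    by (simp_all add: cycle_word_def)
  then have "Theta (cycle_word (i # xs)) \<otimes>\<^bsub>S\<^esub> Theta (cycle_word (rev (i # xs)))
      = (Theta ?t \<otimes>\<^bsub>S\<^esub> Theta (cycle_word xs)) \<otimes>\<^bsub>S\<^esub> (Theta (cycle_word (rev xs)) \<otimes>\<^bsub>S\<^esub> Theta ?t)"
    by (simp only: Theta_simps(1)[OF C cycle_word_C[OF xs(1)]] Theta_simps(1)[OF cycle_word_C[OF xs(2)] C])
  also have "\<dots> = \<one>\<^bsub>S\<^esub>"
    by (intro S_mult_cancel Theta_carrier C cycle_word_C xs Theta_transpose_sq[OF i] Cons.IH[OF xs(1)])
  finally show ?case .
qed

abbreviation sigma where "sigma \<equiv> cycle_word [1..<N]"
abbreviation sigma' where "sigma' \<equiv> cycle_word (rev [1..<N])"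

lemma sigma_C: "sigma \<in> Z.C" "sigma' \<in> Z.C"
  by (auto intro: cycle_word_C)

lemma sigma_inverse:
  "Theta sigma \<otimes>\<^bsub>S\<^esub> Theta sigma' = \<one>\<^bsub>S\<^esub>" "Theta sigma' \<otimes>\<^bsub>S\<^esub> Theta sigma = \<one>\<^bsub>S\<^esub>"
  using Theta_cycle_word_rev[of "[1..<N]"] Theta_cycle_word_rev[of "rev [1..<N]"] by auto

lemma gen_1_C: "free_gen (CX 1) \<in> Z.C" "free_gen (CD 1) \<in> Z.C"
  by (intro Z_gens one_mem)+

lemma el_pi_eq: "el_pi N l = Theta (free_gen (CX 1)) \<otimes>\<^bsub>S\<^esub> Theta sigma"
proof -
  have "list_prod S (map (\<lambda>i. Theta (gen_T (transpose i (i+1)))) [1..<N]) = Theta sigma"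
    unfolding cycle_word_def by (rule list_prod_Theta, intro Z_gens adjacent_perm) auto
  then show ?thesis unfolding el_pi_def el_eqs by simp
qed

lemma inv_el_pi: "inv\<^bsub>S\<^esub> (el_pi N l) = Theta sigma' \<otimes>\<^bsub>S\<^esub> Theta (free_gen (CD 1))"
  unfolding el_pi_eq
  by (rule S.inv_char) (intro S.m_closed Theta_carrier gen_1_C sigma_C S_mult_cancel X_D_1 sigma_inverse)+

text \<open>With sigma = s_1 ... s_{N-1} one has pi = X_1 sigma, so pi_- is sigma^{-1} D_1.\<close>

lemma el_pi_minus_eq:
  "el_pi_minus N l = Theta sigma' \<otimes>\<^bsub>S\<^esub> (Theta (free_gen (CD 1)) \<otimes>\<^bsub>S\<^esub> Theta cyc_word)"
  unfolding el_pi_minus_def inv_el_pi el_cyc_eq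
  by (rule S.m_assoc) (intro Theta_carrier gen_1_C sigma_C cyc_word_C)+

lemma inv_el_X_1: "inv\<^bsub>S\<^esub> (el_X N 1) = Theta (free_gen (CD 1))"
  unfolding el_eqs by (rule S.inv_char) (intro Theta_carrier gen_1_C X_D_1)+

definition comparison :: "(cyc_gen list \<Rightarrow>\<^sub>0 coeff_hkz) \<Rightarrow> daha_z"
  where "comparison f = Theta (chi.ev f)"

lemma comparison_hom: "comparison \<in> ring_hom Z.F S"
proof (rule ring_hom_memI)
  fix x y assume "x \<in> Z.C" "y \<in> Z.C"
  then show "comparison (x \<otimes>\<^bsub>Z.F\<^esub> y) = comparison x \<otimes>\<^bsub>S\<^esub> comparison y"
    "comparison (x \<oplus>\<^bsub>Z.F\<^esub> y) = comparison x \<oplus>\<^bsub>S\<^esub> comparison y"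
    by (simp_all add: comparison_def chi.ev_mult chi.ev_add Theta_simps chi_C)
qed (simp_all add: comparison_def Theta_carrier chi_C chi.ev_1 Theta_simps(3))

sublocale comparison: ring_hom_ring Z.F S comparison
  by (rule ring_hom_ringI2[OF Z.ring_F ring_S comparison_hom])

lemma comparison_kernel: "a_kernel Z.F S comparison = IC"
proof -
  have "comparison f = \<zero>\<^bsub>S\<^esub> \<longleftrightarrow> f \<in> IC" if "f \<in> Z.C" for f
    unfolding comparison_def using Theta_eq_0_iff[OF chi_C[OF that]] chi_mem_IZ_iff[OF that] by blast
  then show ?thesis
    unfolding a_kernel_def' using CR.I_C by blast
qed

lemma comparison_const: "comparison (free_const c) = daha_z_scalar N c"
  by (simp add: comparison_def chi.ev_const Theta_const)

lemma comparison_gens: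
  "comparison (free_gen (CPerm p)) = el_perm N p" "comparison (free_gen (CX i)) = el_X N i"
  "comparison (free_gen (CY i)) = el_Y N i"
  by (simp_all add: comparison_def chi.ev_gen el_eqs)

text \<open>The second form keeps X_1^{-1} and the product over the z_r together: D_1 lies in the
  subalgebra, whereas X_1^{-1} by itself need not.\<close>

lemma comparison_D:
  assumes i: "i \<in> {1..N}"
  shows "comparison (free_gen (CD i)) = el_D N l i"
    and "comparison (free_gen (CD i)) = el_perm N (transpose 1 i) \<otimes>\<^bsub>S\<^esub>
      ((Theta (free_gen (CD 1)) \<otimes>\<^bsub>S\<^esub> Theta cyc_word) \<otimes>\<^bsub>S\<^esub> el_perm N (transpose 1 i))"
proof -
  let ?t = "gen_T (transpose 1 i)"
  have C: "?t \<in> Z.C" by (rule Z_gens(1)[OF transpose_1_perm[OF i]])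
  have 1: "comparison (free_gen (CD i)) = Theta ?t \<otimes>\<^bsub>S\<^esub> (Theta (free_gen (CD 1)) \<otimes>\<^bsub>S\<^esub> (Theta cyc_word \<otimes>\<^bsub>S\<^esub> Theta ?t))"
    unfolding comparison_def chi.ev_gen chi_gen.simps
    by (simp only: Theta_simps(1) C gen_1_C cyc_word_C Z.C_mult)
  show "comparison (free_gen (CD i)) = el_D N l i"
    unfolding 1 el_D_def list_prod_def inv_el_X_1 el_cyc_eq
    unfolding el_eqs foldr.simps o_apply id_apply S.r_one[OF Theta_carrier[OF C]] ..
  show "comparison (free_gen (CD i)) = el_perm N (transpose 1 i) \<otimes>\<^bsub>S\<^esub>
      ((Theta (free_gen (CD 1)) \<otimes>\<^bsub>S\<^esub> Theta cyc_word) \<otimes>\<^bsub>S\<^esub> el_perm N (transpose 1 i))"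
    unfolding 1 el_eqs
      S.m_assoc[OF Theta_carrier[OF gen_1_C(2)] Theta_carrier[OF cyc_word_C] Theta_carrier[OF C]] ..
qed

lemma el_perm_mult: "p permutes {1..N} \<Longrightarrow> q permutes {1..N} \<Longrightarrow>
    el_perm N (p \<circ> q) = el_perm N p \<otimes>\<^bsub>S\<^esub> el_perm N q"
  unfolding el_eqs by (rule Theta_perm_mult[symmetric])

lemma el_X_conj:
  assumes i: "i \<in> {1..N}"
  shows "el_X N i = el_perm N (transpose 1 i) \<otimes>\<^bsub>S\<^esub> (el_X N 1 \<otimes>\<^bsub>S\<^esub> el_perm N (transpose 1 i))"
proof -
  let ?t = "gen_T (transpose 1 i)"
  have C: "?t \<in> Z.C" "free_gen (CX i) \<in> Z.C"
    by (rule Z_gens(1)[OF transpose_1_perm[OF i]]) (rule Z_gens(2)[OF i])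
  have "?t * free_gen (CX 1) - free_gen (CX (transpose 1 i 1)) * ?t \<in> IZ"
    by (rule Z.I_perm_X[OF transpose_1_perm[OF i] one_mem])
  then have "Theta (?t * free_gen (CX 1)) = Theta (free_gen (CX i) * ?t)"
    unfolding transpose_apply_first by (intro Theta_cong Z.C_mult C gen_1_C)
  then have "Theta ?t \<otimes>\<^bsub>S\<^esub> Theta (free_gen (CX 1)) = Theta (free_gen (CX i)) \<otimes>\<^bsub>S\<^esub> Theta ?t"
    by (simp only: Theta_simps(1) C gen_1_C)
  then have "Theta ?t \<otimes>\<^bsub>S\<^esub> (Theta (free_gen (CX 1)) \<otimes>\<^bsub>S\<^esub> Theta ?t)
      = Theta (free_gen (CX i)) \<otimes>\<^bsub>S\<^esub> (Theta ?t \<otimes>\<^bsub>S\<^esub> Theta ?t)"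
    using Theta_carrier[OF C(1)] Theta_carrier[OF C(2)] Theta_carrier[OF gen_1_C(1)]
    by (metis S.m_assoc)
  then show ?thesis
    unfolding el_eqs Theta_transpose_sq[OF one_mem i] using Theta_carrier[OF C(2)] by simp
qed

abbreviation cyc_generators where
  "cyc_generators \<equiv> daha_z_scalar N ` coeffs_z l \<union>
       {el_perm N (transpose i (i+1)) | i. i \<in> {1..<N}} \<union>
       {el_Y N i | i. i \<in> {1..N}} \<union>
       {el_pi N l, el_pi_minus N l}"

lemma generators_in_image: "cyc_generators \<subseteq> comparison ` Z.C"
proof -
  have chi_cycle: "chi.ev (cycle_word xs) = cycle_word xs" for xs
    by (simp add: cycle_word_def chi.ev_prod_list chi.ev_gen)
  have sigma: "comparison (cycle_word xs) = Theta (cycle_word xs)" for xs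
    by (simp only: comparison_def chi_cycle)
  have mult: "comparison (x * y) = comparison x \<otimes>\<^bsub>S\<^esub> comparison y" if "x \<in> Z.C" "y \<in> Z.C" for x y
    using ring_hom_mult[OF comparison_hom that] by simp
  have "daha_z_scalar N c \<in> comparison ` Z.C" if "c \<in> coeffs_z l" for c
    using Z.C_const[OF that] comparison_const by (metis imageI)
  moreover have "el_perm N (transpose i (i+1)) \<in> comparison ` Z.C" if "i \<in> {1..<N}" for i
    using Z_gens(1)[OF adjacent_perm[OF that]] comparison_gens(1) by (metis imageI)
  moreover have "el_Y N i \<in> comparison ` Z.C" if "i \<in> {1..N}" for i
    using Z_gens(4)[OF that] comparison_gens(3) by (metis imageI)
  moreover have "el_pi N l = comparison (free_gen (CX 1) * sigma)"
    by (simp only: mult[OF gen_1_C(1) sigma_C(1)] sigma comparison_gens el_eqs el_pi_eq)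
  moreover have "el_pi_minus N l = comparison (sigma' * free_gen (CD 1))"
  proof -
    \<comment> \<open>For i = 1 the conjugating element s_{11} is the identity.\<close>
    have "el_perm N (transpose 1 1) = \<one>\<^bsub>S\<^esub>" unfolding transpose_same el_eqs by (rule Theta_perm_id)
    then have "comparison (free_gen (CD 1)) = Theta (free_gen (CD 1)) \<otimes>\<^bsub>S\<^esub> Theta cyc_word"
      using comparison_D(2)[OF one_mem] Theta_carrier[OF gen_1_C(2)] Theta_carrier[OF cyc_word_C]
      by (simp only: S.l_one S.r_one S.m_closed)
    then show ?thesis by (simp only: mult[OF sigma_C(2) gen_1_C(2)] sigma el_pi_minus_eq)
  qed
  ultimately show ?thesis using Z.C_mult[OF gen_1_C(1) sigma_C(1)] Z.C_mult[OF sigma_C(2) gen_1_C(2)] by blast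
qed

text \<open>For the nontrivial inclusion, adjacent transpositions generate S_N, X_1 = pi sigma^{-1},
  D_1 = sigma pi_-, and the other X_i and D_i are conjugates of these by s_{1i}.\<close>

lemma image_eq_generate: "comparison ` Z.C = generate_ring S cyc_generators"
proof
  have imgC: "comparison ` Z.C \<subseteq> carrier S"
    using ring_hom_closed[OF comparison_hom] by blast
  then have gC: "cyc_generators \<subseteq> carrier S" using generators_in_image by (rule order_trans[rotated])
  let ?G = "generate_ring S cyc_generators"
  have "subring Z.C Z.F" using ring.carrier_is_subring[OF Z.ring_F] .
  then have "subring (comparison ` Z.C) S" by (rule comparison.img_is_subring)
  then show "?G \<subseteq> comparison ` Z.C" by (rule S.generate_ring_min_subring1[OF gC _ generators_in_image])
  have incl: "x \<in> ?G" if "x \<in> cyc_generators" for x using that by (rule generate_ring.incl)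
  note mult = generate_ring.eng_mult[of _ S cyc_generators]
  have perm: "el_perm N p \<in> ?G" if "p permutes {1..N}" for p
    using that
  proof (induction rule: permutes_adjacent_induct)
    case id
    show ?case unfolding el_eqs Theta_perm_id by (rule generate_ring.one)
  next
    case (comp p q)
    then show ?case unfolding el_perm_mult[OF comp(1,2)] by (intro mult)
  next
    case (adj i)
    then show ?case by (intro incl) blast
  qed
  have cycle: "Theta (cycle_word xs) \<in> ?G" if "set xs \<subseteq> {1..<N}" for xs
    using that
  proof (induction xs)
    case Nil
    show ?case unfolding cycle_word_def by (simp add: Theta_simps(3) generate_ring.one)
  next
    case (Cons i xs)
    then have i: "i \<in> {1..<N}" and xs: "set xs \<subseteq> {1..<N}" by auto
    have "Theta (cycle_word (i # xs)) = el_perm N (transpose i (i+1)) \<otimes>\<^bsub>S\<^esub> Theta (cycle_word xs)"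
      unfolding el_eqs Theta_simps(1)[OF Z_gens(1)[OF adjacent_perm[OF i]] cycle_word_C[OF xs], symmetric]
      by (simp add: cycle_word_def)
    then show ?case using mult[OF perm[OF adjacent_perm[OF i]] Cons.IH[OF xs]] by simp
  qed
  have sig: "Theta sigma \<in> ?G" "Theta sigma' \<in> ?G" by (rule cycle; simp)+
  have X1: "el_X N 1 \<in> ?G"
  proof -
    have "el_pi N l \<otimes>\<^bsub>S\<^esub> Theta sigma' = el_X N 1"
      unfolding el_pi_eq el_eqs
      using S.m_assoc[OF Theta_carrier[OF gen_1_C(1)] Theta_carrier[OF sigma_C(1)] Theta_carrier[OF sigma_C(2)]]
        sigma_inverse(1) Theta_carrier[OF gen_1_C(1)] by simp
    moreover have "el_pi N l \<otimes>\<^bsub>S\<^esub> Theta sigma' \<in> ?G" by (intro mult incl sig) blast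
    ultimately show ?thesis by simp
  qed
  have D1: "Theta (free_gen (CD 1)) \<otimes>\<^bsub>S\<^esub> Theta cyc_word \<in> ?G"
  proof -
    let ?d = "Theta (free_gen (CD 1)) \<otimes>\<^bsub>S\<^esub> Theta cyc_word"
    have d: "?d \<in> carrier S" by (intro S.m_closed Theta_carrier gen_1_C cyc_word_C)
    have "Theta sigma \<otimes>\<^bsub>S\<^esub> el_pi_minus N l = ?d"
      unfolding el_pi_minus_eq
      using S.m_assoc[OF Theta_carrier[OF sigma_C(1)] Theta_carrier[OF sigma_C(2)] d] sigma_inverse(1) d by simp
    moreover have "Theta sigma \<otimes>\<^bsub>S\<^esub> el_pi_minus N l \<in> ?G" by (intro mult incl sig) blast
    ultimately show ?thesis by simp
  qed
  have "comparison f \<in> ?G" if "f \<in> Z.C" for f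
    using that
  proof (rule Z.C_induct)
    have "comparison 0 = \<zero>\<^bsub>S\<^esub>" using comparison.hom_zero by simp
    then show "comparison 0 \<in> ?G" using S.zero_in_generate by simp
    show "comparison (x + y) \<in> ?G" if "x \<in> Z.C" "y \<in> Z.C" "comparison x \<in> ?G" "comparison y \<in> ?G" for x y
      using generate_ring.eng_add[OF that(3,4)] ring_hom_add[OF comparison_hom that(1,2)] by simp
    show "comparison (x * y) \<in> ?G" if "x \<in> Z.C" "y \<in> Z.C" "comparison x \<in> ?G" "comparison y \<in> ?G" for x y
      using mult[OF that(3,4)] ring_hom_mult[OF comparison_hom that(1,2)] by simp
    show "comparison (free_const c) \<in> ?G" if "c \<in> coeffs_z l" for c
      unfolding comparison_const by (rule incl) (use that in blast)
    fix g assume g: "g \<in> cyc_gens N"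
    show "comparison (free_gen g) \<in> ?G"
    proof (cases g)
      case (CPerm p)
      then show ?thesis using g perm by (auto simp: cyc_gens_def comparison_gens)
    next
      case (CY i)
      then have "i \<in> {1..N}" using g by (auto simp: cyc_gens_def)
      then show ?thesis unfolding CY comparison_gens by (intro incl) blast
    next
      case (CX i)
      then have i: "i \<in> {1..N}" using g by (auto simp: cyc_gens_def)
      show ?thesis unfolding CX comparison_gens el_X_conj[OF i]
        by (intro mult perm transpose_1_perm i X1)
    next
      case (CD i)
      then have i: "i \<in> {1..N}" using g by (auto simp: cyc_gens_def)
      show ?thesis unfolding CD comparison_D(2)[OF i]
        by (intro mult perm transpose_1_perm i D1)
    qed
  qed
  then show "comparison ` Z.C \<subseteq> ?G" by blast
qed

lemma cyc_presented_eq: "cyc_presented N l = Z.F Quot a_kernel Z.F S comparison"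
  by (simp add: cyc_presented_def presented_algebra_def comparison_kernel IC_def)

lemma cyclotomic_daha_eq: "cyclotomic_daha N l = S\<lparr>carrier := comparison ` Z.C\<rparr>"
  by (simp only: cyclotomic_daha_def image_eq_generate)

text \<open>The isomorphism theorem for rings: a class is a coset of the kernel,
  \<open>comparison\<close> is constant on it, and \<open>the_elem\<close> picks out that
  value.\<close>

theorem comparison_iso:
  "(\<lambda>A. the_elem (comparison ` A)) \<in> ring_iso (cyc_presented N l) (cyclotomic_daha N l)"
  unfolding cyc_presented_eq cyclotomic_daha_eq by (rule comparison.FactRing_iso_set_aux)

lemma the_elem_comparison: "f \<in> Z.C \<Longrightarrow> the_elem (comparison ` cyc_class N l f) = comparison f"
  using comparison.the_elem_simp[of f]
  by (simp add: cyc_class_def presented_class_def comparison_kernel IC_def)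

end

theorem proposition2p24:
  fixes N l :: nat
  assumes "N \<ge> 1"
  shows "\<exists>\<phi> \<in> ring_iso (cyc_presented N l) (cyclotomic_daha N l).
    (\<forall>c \<in> coeffs_z l. \<phi> (cyc_class N l (free_const c)) = daha_z_scalar N c) \<and>
    (\<forall>p. p permutes {1..N} \<longrightarrow> \<phi> (cyc_class N l (free_gen (CPerm p))) = el_perm N p) \<and>
    (\<forall>i \<in> {1..N}. \<phi> (cyc_class N l (free_gen (CY i))) = el_Y N i \<and>
                   \<phi> (cyc_class N l (free_gen (CX i))) = el_X N i \<and>
                   \<phi> (cyc_class N l (free_gen (CD i))) = el_D N l i)"
proof -
  interpret daha_setup N l by standard (rule assms)
  show ?thesis
    by (rule bexI[OF _ comparison_iso])
      (simp add: the_elem_comparison Z.C_const Z_gens comparison_const comparison_gens comparison_D(1))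
qed

end
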